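(* Let $e$ be a nonzero nilpotent element of even depth $d$ in a semisimple Lie algebra $\mathfrak g$ over an algebraically closed field of characteristic $0$, and suppose $e$ is of semisimple type. Then there exists a reducing subalgebra $\mathfrak q$ for $e$ such that $e\in\mathfrak q$ and $e$ is of regular semisimple type in $\mathfrak q$.
   Context: $G$ is the connected simply connected group with Lie algebra $\mathfrak g$; $\mathfrak s=\{e,h,f\}$ is an $\mathfrak{sl}_2$-triple containing $e$; $\mathfrak g_j$ is the $j$-eigenspace of $\mathrm{ad}\,h$, and the depth $d$ is the largest $j$ with $\mathfrak g_j\ne0$. A cyclic element associated with $e$ is $e+F$ with $0\ne F\in\mathfrak g_{-d}$; $e$ is of semisimple (resp. regular semisimple) type if $e+F$ is semisimple (resp. regular semisimple, i.e. semisimple with centralizer a Cartan subalgebra) for all $F$ in a nonempty Zariski open subset of $\mathfrak g_{-d}$. $Z(\mathfrak s)$ is the centralizer of $\mathfrak s$ in $G$. A reducing subalgebra for $e$ is a semisimple subalgebra $\mathfrak q\subset\mathfrak g$ with $[\mathfrak s,\mathfrak q]\subset\mathfrak q$ such that $Z(\mathfrak s)(\mathfrak q\cap\mathfrak g_{-d})$ is Zariski dense in $\mathfrak g_{-d}$. *)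

theory Defs
  imports "HOL-Analysis.Analysis" "HOL-Computational_Algebra.Polynomial"
begin

text \<open>A finite-dimensional Lie algebra over a field 'k is modelled on the coordinate
space 'k^'n (every finite-dimensional vector space is of this form), with a bracket br.\<close>

type_synonym ('k,'n) bracket = "'k^'n \<Rightarrow> 'k^'n \<Rightarrow> 'k^'n"

definition alg_closed :: "'k::field itself \<Rightarrow> bool" where
  "alg_closed _ \<longleftrightarrow> (\<forall>p::'k poly. degree p \<ge> 1 \<longrightarrow> (\<exists>z. poly p z = 0))"

definition lie_algebra :: "('k::field,'n::finite) bracket \<Rightarrow> bool" where
  "lie_algebra br \<longleftrightarrow>
     (\<forall>x y z. br (x + y) z = br x z + br y z) \<and>
     (\<forall>x y z. br x (y + z) = br x y + br x z) \<and>
     (\<forall>c x y. br (c *s x) y = c *s br x y) \<and>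
     (\<forall>c x y. br x (c *s y) = c *s br x y) \<and>
     (\<forall>x. br x x = 0) \<and>
     (\<forall>x y z. br x (br y z) + br y (br z x) + br z (br x y) = 0)"

definition subalgebra :: "('k::field,'n::finite) bracket \<Rightarrow> ('k^'n) set \<Rightarrow> bool" where
  "subalgebra br q \<longleftrightarrow> vec.subspace q \<and> (\<forall>x\<in>q. \<forall>y\<in>q. br x y \<in> q)"

definition lie_ideal :: "('k::field,'n::finite) bracket \<Rightarrow> ('k^'n) set \<Rightarrow> ('k^'n) set \<Rightarrow> bool" where
  "lie_ideal br L I \<longleftrightarrow> vec.subspace I \<and> I \<subseteq> L \<and> (\<forall>x\<in>L. \<forall>y\<in>I. br x y \<in> I)"

fun derived_series :: "('k::field,'n::finite) bracket \<Rightarrow> ('k^'n) set \<Rightarrow> nat \<Rightarrow> ('k^'n) set" where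
  "derived_series br I 0 = I"
| "derived_series br I (Suc k) =
     vec.span {br x y | x y. x \<in> derived_series br I k \<and> y \<in> derived_series br I k}"

definition solvable_lie :: "('k::field,'n::finite) bracket \<Rightarrow> ('k^'n) set \<Rightarrow> bool" where
  "solvable_lie br I \<longleftrightarrow> (\<exists>k. derived_series br I k \<subseteq> {0})"

definition semisimple_lie :: "('k::field,'n::finite) bracket \<Rightarrow> ('k^'n) set \<Rightarrow> bool" where
  "semisimple_lie br L \<longleftrightarrow> subalgebra br L \<and>
     (\<forall>I. lie_ideal br L I \<and> solvable_lie br I \<longrightarrow> I = {0})"

fun lower_central :: "('k::field,'n::finite) bracket \<Rightarrow> ('k^'n) set \<Rightarrow> nat \<Rightarrow> ('k^'n) set" where
  "lower_central br N 0 = N"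
| "lower_central br N (Suc k) =
     vec.span {br x y | x y. x \<in> N \<and> y \<in> lower_central br N k}"

definition nilpotent_lie :: "('k::field,'n::finite) bracket \<Rightarrow> ('k^'n) set \<Rightarrow> bool" where
  "nilpotent_lie br N \<longleftrightarrow> (\<exists>k. lower_central br N k \<subseteq> {0})"

definition normalizer :: "('k::field,'n::finite) bracket \<Rightarrow> ('k^'n) set \<Rightarrow> ('k^'n) set \<Rightarrow> ('k^'n) set" where
  "normalizer br L H = {x \<in> L. \<forall>y\<in>H. br x y \<in> H}"

definition cartan_subalgebra :: "('k::field,'n::finite) bracket \<Rightarrow> ('k^'n) set \<Rightarrow> ('k^'n) set \<Rightarrow> bool" where
  "cartan_subalgebra br L H \<longleftrightarrow> subalgebra br H \<and> H \<subseteq> L \<and> nilpotent_lie br H \<and>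
     normalizer br L H = H"

definition centralizer_elt :: "('k::field,'n::finite) bracket \<Rightarrow> ('k^'n) set \<Rightarrow> 'k^'n \<Rightarrow> ('k^'n) set" where
  "centralizer_elt br L x = {y \<in> L. br x y = 0}"

definition semisimple_elt :: "('k::field,'n::finite) bracket \<Rightarrow> ('k^'n) set \<Rightarrow> 'k^'n \<Rightarrow> bool" where
  "semisimple_elt br L x \<longleftrightarrow> x \<in> L \<and> L \<subseteq> vec.span {v \<in> L. \<exists>c. br x v = c *s v}"

definition regular_semisimple_elt :: "('k::field,'n::finite) bracket \<Rightarrow> ('k^'n) set \<Rightarrow> 'k^'n \<Rightarrow> bool" where
  "regular_semisimple_elt br L x \<longleftrightarrow> semisimple_elt br L x \<and>
     cartan_subalgebra br L (centralizer_elt br L x)"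

definition ad_nilpotent :: "('k::field,'n::finite) bracket \<Rightarrow> ('k^'n) set \<Rightarrow> 'k^'n \<Rightarrow> bool" where
  "ad_nilpotent br L x \<longleftrightarrow> x \<in> L \<and> (\<exists>k. \<forall>y\<in>L. (br x ^^ k) y = 0)"

definition sl2_triple :: "('k::field,'n::finite) bracket \<Rightarrow> 'k^'n \<Rightarrow> 'k^'n \<Rightarrow> 'k^'n \<Rightarrow> bool" where
  "sl2_triple br e h f \<longleftrightarrow> br h e = 2 *s e \<and> br h f = (-2) *s f \<and> br e f = h"

definition eigsp :: "('k::field,'n::finite) bracket \<Rightarrow> ('k^'n) set \<Rightarrow> 'k^'n \<Rightarrow> int \<Rightarrow> ('k^'n) set" where
  "eigsp br L h j = {x \<in> L. br h x = of_int j *s x}"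

definition depth :: "('k::field,'n::finite) bracket \<Rightarrow> ('k^'n) set \<Rightarrow> 'k^'n \<Rightarrow> int" where
  "depth br L h = Max {j. eigsp br L h j \<noteq> {0}}"

inductive_set polyfun :: "('k::field^'n::finite \<Rightarrow> 'k) set" where
  pconst: "(\<lambda>x. c) \<in> polyfun"
| pcoord: "(\<lambda>x. x $ i) \<in> polyfun"
| padd: "p \<in> polyfun \<Longrightarrow> q \<in> polyfun \<Longrightarrow> (\<lambda>x. p x + q x) \<in> polyfun"
| pmult: "p \<in> polyfun \<Longrightarrow> q \<in> polyfun \<Longrightarrow> (\<lambda>x. p x * q x) \<in> polyfun"

definition zariski_closed_in :: "('k::field^'n::finite) set \<Rightarrow> ('k^'n) set \<Rightarrow> bool" where
  "zariski_closed_in V C \<longleftrightarrow> (\<exists>S \<subseteq> polyfun. C = {x \<in> V. \<forall>p\<in>S. p x = 0})"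

definition zariski_open_in :: "('k::field^'n::finite) set \<Rightarrow> ('k^'n) set \<Rightarrow> bool" where
  "zariski_open_in V U \<longleftrightarrow> U \<subseteq> V \<and> zariski_closed_in V (V - U)"

definition zariski_dense_in :: "('k::field^'n::finite) set \<Rightarrow> ('k^'n) set \<Rightarrow> bool" where
  "zariski_dense_in V A \<longleftrightarrow> A \<subseteq> V \<and> (\<forall>C. zariski_closed_in V C \<and> A \<subseteq> C \<longrightarrow> C = V)"

text \<open>e of semisimple / regular semisimple type in L, w.r.t. the sl2-triple with neutral element h.\<close>
definition semisimple_type :: "('k::field,'n::finite) bracket \<Rightarrow> ('k^'n) set \<Rightarrow> 'k^'n \<Rightarrow> 'k^'n \<Rightarrow> bool" where
  "semisimple_type br L e h \<longleftrightarrow>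
     (\<exists>U. zariski_open_in (eigsp br L h (- depth br L h)) U \<and> U \<noteq> {} \<and>
          (\<forall>F\<in>U. semisimple_elt br L (e + F)))"

definition regular_semisimple_type :: "('k::field,'n::finite) bracket \<Rightarrow> ('k^'n) set \<Rightarrow> 'k^'n \<Rightarrow> 'k^'n \<Rightarrow> bool" where
  "regular_semisimple_type br L e h \<longleftrightarrow>
     (\<exists>U. zariski_open_in (eigsp br L h (- depth br L h)) U \<and> U \<noteq> {} \<and>
          (\<forall>F\<in>U. regular_semisimple_elt br L (e + F)))"

text \<open>exp(ad x) for ad-nilpotent x (ad x ^ n = 0 on an n-dimensional space).\<close>
definition exp_ad :: "('k::field_char_0,'n::finite) bracket \<Rightarrow> 'k^'n \<Rightarrow> 'k^'n \<Rightarrow> 'k^'n" where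
  "exp_ad br x v = (\<Sum>k\<le>CARD('n). inverse (fact k) *s ((br x ^^ k) v))"

text \<open>The image of the simply connected group G under Ad: the adjoint group,
generated by the exp(ad x), x nilpotent.\<close>
inductive_set adjoint_group :: "('k::field_char_0,'n::finite) bracket \<Rightarrow> ('k^'n \<Rightarrow> 'k^'n) set"
  for br where
  ag_id: "id \<in> adjoint_group br"
| ag_step: "\<phi> \<in> adjoint_group br \<Longrightarrow> ad_nilpotent br UNIV x \<Longrightarrow>
            exp_ad br x \<circ> \<phi> \<in> adjoint_group br"

text \<open>Z(s), acting on g through Ad.\<close>
definition Z_sl2 :: "('k::field_char_0,'n::finite) bracket \<Rightarrow> 'k^'n \<Rightarrow> 'k^'n \<Rightarrow> 'k^'n \<Rightarrow> ('k^'n \<Rightarrow> 'k^'n) set" where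
  "Z_sl2 br e h f = {\<phi> \<in> adjoint_group br. \<phi> e = e \<and> \<phi> h = h \<and> \<phi> f = f}"

definition reducing_subalgebra ::
  "('k::field_char_0,'n::finite) bracket \<Rightarrow> 'k^'n \<Rightarrow> 'k^'n \<Rightarrow> 'k^'n \<Rightarrow> ('k^'n) set \<Rightarrow> bool" where
  "reducing_subalgebra br e h f q \<longleftrightarrow>
     semisimple_lie br q \<and>
     (\<forall>x\<in>{e, h, f}. \<forall>y\<in>q. br x y \<in> q) \<and>
     zariski_dense_in (eigsp br UNIV h (- depth br UNIV h))
       (\<Union>\<phi>\<in>Z_sl2 br e h f. \<phi> ` (q \<inter> eigsp br UNIV h (- depth br UNIV h)))"

end

theory Submission
  imports Defs
begin

text \<open>Let \<open>V = g\<^bsub>-d\<^esub>\<close>, let \<open>r\<close> be the centralizer of the triple, and choose \<open>F \<in> V\<close> with \<open>E = e + F\<close>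
semisimple and \<open>[r, F]\<close> as large as possible. Put \<open>k = r \<inter> z(F) = g\<^bsub>0\<^esub> \<inter> z(E)\<close>. The Killing form is
nondegenerate on \<open>z(E)\<close> and, since \<open>E\<close> is homogeneous modulo \<open>d + 2\<close>, also on \<open>k\<close>. Let \<open>x0 \<in> k\<close> be
semisimple with smallest possible centralizer \<open>Z\<close>; then \<open>k \<inter> Z\<close> is central in \<open>Z\<close>, and \<open>q = [Z, Z]\<close>.

Maximality of \<open>[r, F]\<close> gives \<open>[k, V] \<subseteq> [r, F]\<close>. With \<open>g = z(E) \<oplus> [E, g]\<close> this yields
\<open>V = [n, F] + (V \<inter> Z)\<close>, where \<open>n\<close> is spanned by the eigenvectors of \<open>ad x0\<close> in \<open>r\<close> with nonzero eigenvalue.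
These are nilpotent, so the curves \<open>exp(s x\<^sub>1) \<cdots> exp(s x\<^sub>l) (F + s w)\<close> leave \<open>F\<close> in every direction
of \<open>V\<close> and stay in the union of the translates of \<open>V \<inter> Z = q \<inter> V\<close>, which is therefore dense.

For generic \<open>F' \<in> q \<inter> V\<close> the centralizer of \<open>e + F'\<close> in \<open>q\<close> is graded modulo \<open>d + 2\<close> with zero component
of degree 0. It is solvable by Kreknin's theorem, hence abelian because the Killing form is
nondegenerate on it.

The structure theory used here reduces to Engel's theorem and one trace criterion: \<open>ad x\<close> is nilpotent as
soon as it is trace-orthogonal to every derivation acting by \<open>f(c)\<close> on its generalized eigenspaces
of eigenvalue \<open>c\<close>, where \<open>f\<close> runs through the \<open>\<rat>\<close>-linear functionals with values in \<open>\<rat>\<close>.\<close>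

section \<open>Linear maps and generalized eigenspaces\<close>

text \<open>The field is an arbitrary algebraically closed one, so the positivity argument behind
  the trace criterion cannot use complex conjugation; rational-valued functionals take its place.
  Reductivity enters as nondegeneracy of the ambient Killing form on a subalgebra: this passes to
  centralizers of semisimple elements, makes abelian ideals central and makes solvable subalgebras
  abelian. The modulus d + 2 is the one for which e (degree 2) and V (degree -d) have the same
  degree, so the kernel of ad E splits into residue classes. The inclusion [k, V] in [r, F] works as
  follows. Write v in V as c + [E, y] with c in z(E). For a suitable w in r, [x0, v] = [w, F] =
  [w, E] lies in the image of ad E, hence so does [x0, c]; it also lies in the kernel of ad E, which
  is semisimple, hence it is 0. So the part of v in z(E) already commutes with x0, and the rest is
  corrected by an element of r, that is, by a direction tangent to the orbit of F.\<close>

abbreviation lin :: "('k::field^'n::finite \<Rightarrow> 'k^'n) \<Rightarrow> bool" where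
  "lin f \<equiv> Vector_Spaces.linear (*s) (*s) f"

lemma linI:
  assumes "\<And>x y. f (x + y) = f x + f y" "\<And>c x. f (c *s x) = c *s f x"
  shows "lin f"
  using assms by (simp add: Vector_Spaces.linear_iff vec.vector_space_axioms)

lemma lin_add: "lin f \<Longrightarrow> f (x + y) = f x + f y"
  and lin_scale: "lin f \<Longrightarrow> f (c *s x) = c *s f x"
  and lin_0: "lin f \<Longrightarrow> f 0 = 0"
  and lin_diff: "lin f \<Longrightarrow> f (x - y) = f x - f y"
  and lin_sum: "lin f \<Longrightarrow> f (\<Sum>i\<in>I. g i) = (\<Sum>i\<in>I. f (g i))"
  by (simp_all add: vec.linear_add vec.linear_scale vec.linear_0 vec.linear_diff vec.linear_sum)

lemma lin_compose: "lin f \<Longrightarrow> lin g \<Longrightarrow> lin (\<lambda>x. f (g x))"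
  by (rule linI) (simp_all add: lin_add lin_scale)

lemma lin_funpow: "lin f \<Longrightarrow> lin (f ^^ k)"
  by (induction k) (auto intro!: linI simp: lin_add lin_scale)

lemma lin_shift: "lin f \<Longrightarrow> lin (\<lambda>v. f v - c *s v)"
  by (rule linI) (auto simp: lin_add lin_scale vec.scale_right_diff_distrib vec.scale_right_distrib
      vector_smult_assoc mult.commute)

lemma inverse_scale: "a \<noteq> 0 \<Longrightarrow> inverse a *s (a *s x) = (x :: 'k::field^'n)"
  by (simp add: vector_smult_assoc)

lemma subspace_scale_cancel: "vec.subspace M \<Longrightarrow> a \<noteq> 0 \<Longrightarrow> a *s x \<in> M \<Longrightarrow> (x :: 'k::field^'n::finite) \<in> M"
  by (metis inverse_scale vec.subspace_scale)

lemma lin_span_mem: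
  assumes f: "lin f" and M: "vec.subspace M" and S: "\<And>x. x \<in> S \<Longrightarrow> f x \<in> M"
    and v: "v \<in> vec.span S"
  shows "f v \<in> M"
  using v
proof (induction v rule: vec.span_induct)
  case base
  show ?case by (rule vec.linear_subspace_linear_preimage[OF f M])
qed (rule S)

lemma mem_span_insert: "vec.subspace W \<Longrightarrow> x \<in> vec.span (insert a W) \<longleftrightarrow> (\<exists>k. x - k *s a \<in> W)"
  by (simp add: vec.span_breakdown_eq vec.span_eq_iff[THEN iffD2])

lemma span_insert_invariant:
  assumes S: "lin S" and W: "vec.subspace W" "S ` W \<subseteq> W" and a: "S a - c *s a \<in> W"
  shows "S ` vec.span (insert a W) \<subseteq> vec.span (insert a W)"
proof (intro image_subsetI)
  fix x assume "x \<in> vec.span (insert a W)"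
  then obtain k where "x - k *s a \<in> W" using mem_span_insert[OF W(1)] by blast
  then have "S (x - k *s a) + k *s (S a - c *s a) \<in> W"
    using a W(2) by (intro vec.subspace_add[OF W(1)] vec.subspace_scale[OF W(1)]) auto
  then have "S x - (k * c) *s a \<in> W"
    by (simp add: lin_diff[OF S] lin_scale[OF S] vec.scale_right_diff_distrib vector_smult_assoc)
  then show "S x \<in> vec.span (insert a W)" using mem_span_insert[OF W(1)] by blast
qed

text \<open>Stated for a sequence rather than a set, so that a repetition also counts as a relation,
  with coefficients 1 and -1.\<close>

lemma dependent_sequence:
  fixes u :: "nat \<Rightarrow> 'k::field^'n::finite"
  shows "\<exists>c. (\<exists>i\<le>CARD('n). c i \<noteq> 0) \<and> (\<Sum>i\<le>CARD('n). c i *s u i) = 0"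
proof (cases "inj_on u {..CARD('n)}")
  case True
  have "card (u ` {..CARD('n)}) = Suc CARD('n)" using True by (simp add: card_image)
  then have dep: "vec.dependent (u ` {..CARD('n)})"
    using vec.dependent_biggerset_general[of "u ` {..CARD('n)}"] 
    by (metis lessI vec.dim_subset_UNIV vec.dimension_def order_le_less_trans card_cart_basis)
  then obtain a where a: "\<exists>v\<in>u ` {..CARD('n)}. a v \<noteq> 0" "(\<Sum>v\<in>u ` {..CARD('n)}. a v *s v) = 0"
    using vec.dependent_finite[of "u ` {..CARD('n)}"] by auto
  have "(\<Sum>i\<le>CARD('n). a (u i) *s u i) = 0" using a(2) True by (simp add: sum.reindex)
  then show ?thesis using a(1) by (intro exI[of _ "\<lambda>i. a (u i)"]) auto
next
  case False
  then obtain i j where ij: "i \<le> CARD('n)" "j \<le> CARD('n)" "i \<noteq> j" "u i = u j"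
    by (auto simp: inj_on_def)
  let ?c = "\<lambda>k. if k = i then 1 else if k = j then -1 else (0::'k)"
  have "(\<Sum>k\<le>CARD('n). ?c k *s u k) = (\<Sum>k\<in>{i,j}. ?c k *s u k)"
    by (rule sum.mono_neutral_right) (use ij in auto)
  also have "\<dots> = 0" using ij by simp
  finally show ?thesis using ij by (intro exI[of _ ?c]) auto
qed

text \<open>If the first vanishing exponent \<open>m\<close> exceeded the dimension, the nonzero
  iterates of \<open>v\<close> would satisfy a linear relation, and a power of \<open>f\<close>
  would isolate its lowest term.\<close>

lemma funpow_vanish_dim:
  fixes f :: "'k::field^'n::finite \<Rightarrow> 'k^'n"
  assumes l: "lin f" and k: "(f ^^ k) v = 0" and n: "CARD('n) \<le> N"
  shows "(f ^^ N) v = 0"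
proof -
  define m where "m = (LEAST k. (f ^^ k) v = 0)"
  have m: "(f ^^ m) v = 0" unfolding m_def by (rule LeastI[of _ k]) (rule k)
  have m': "(f ^^ i) v \<noteq> 0" if "i < m" for i using not_less_Least that unfolding m_def by blast
  have up: "(f ^^ i) v = 0" if "m \<le> i" for i
  proof -
    have "(f ^^ i) v = (f ^^ (i - m)) ((f ^^ m) v)"
      using that by (metis comp_apply funpow_add le_add_diff_inverse2)
    then show ?thesis using m lin_0[OF lin_funpow[OF l]] by simp
  qed
  have "m \<le> CARD('n)"
  proof (rule ccontr)
    assume gt: "\<not> m \<le> CARD('n)"
    obtain c where c: "\<exists>i\<le>CARD('n). c i \<noteq> 0" "(\<Sum>i\<le>CARD('n). c i *s (f ^^ i) v) = 0"
      using dependent_sequence[of "\<lambda>i. (f ^^ i) v"] by blast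
    define i0 where "i0 = (LEAST i. i \<le> CARD('n) \<and> c i \<noteq> 0)"
    have i0: "i0 \<le> CARD('n)" "c i0 \<noteq> 0"
      using LeastI_ex[of "\<lambda>i. i \<le> CARD('n) \<and> c i \<noteq> 0"] c(1) unfolding i0_def by auto
    have i0': "c i = 0" if "i < i0" for i
      using not_less_Least[of i "\<lambda>i. i \<le> CARD('n) \<and> c i \<noteq> 0"] that i0 unfolding i0_def by auto
    \<comment> \<open>The exponent m - 1 - i0 sends the lowest term of the relation to the last
      nonzero iterate, of exponent m - 1, and every later term to 0.\<close>
    have "0 = (f ^^ (m - 1 - i0)) (\<Sum>i\<le>CARD('n). c i *s (f ^^ i) v)"
      by (simp add: c(2) lin_0[OF lin_funpow[OF l]])
    also have "\<dots> = (\<Sum>i\<le>CARD('n). c i *s (f ^^ (m - 1 - i0 + i)) v)"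
      by (simp add: lin_sum[OF lin_funpow[OF l]] lin_scale[OF lin_funpow[OF l]] funpow_add)
    also have "\<dots> = (\<Sum>i\<in>{i0}. c i *s (f ^^ (m - 1 - i0 + i)) v)"
    proof (rule sum.mono_neutral_right)
      show "\<forall>i\<in>{..CARD('n)} - {i0}. c i *s (f ^^ (m - 1 - i0 + i)) v = 0"
      proof
        fix i assume "i \<in> {..CARD('n)} - {i0}"
        then consider "i < i0" | "m \<le> m - 1 - i0 + i" using gt i0 by force
        then show "c i *s (f ^^ (m - 1 - i0 + i)) v = 0" by cases (auto simp: i0' up)
      qed
    qed (use i0 in auto)
    finally have "(f ^^ (m - 1 - i0 + i0)) v = 0" using i0 by simp
    moreover have "m - 1 - i0 + i0 < m" using gt i0 by simp
    ultimately show False using m' by blast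
  qed
  then show ?thesis using up n by simp
qed

text \<open>\<open>ap P\<close> is P(T) v. Take P nonzero of least degree with P(T) v in B. It has a
  root z, and for P = (X - z) Q the vector Q(T) v lies outside B by minimality and is an eigenvector
  modulo B.\<close>

lemma eigenvector_mod_subspace:
  fixes T :: "'k::field^'n::finite \<Rightarrow> 'k^'n"
  assumes ac: "alg_closed TYPE('k)" and T: "lin T"
    and A: "T ` A \<subseteq> A" "vec.subspace A" and B: "vec.subspace B"
    and v: "v \<in> A" "v \<notin> B"
  shows "\<exists>a\<in>A. a \<notin> B \<and> (\<exists>c. T a - c *s a \<in> B)"
proof -
  define ap where "ap P = (\<Sum>i\<le>degree P. coeff P i *s (T ^^ i) v)" for P :: "'k poly"
  have ap: "ap P = (\<Sum>i\<le>N. coeff P i *s (T ^^ i) v)" if "degree P \<le> N" for P N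
    unfolding ap_def by (rule sum.mono_neutral_left) (use that in \<open>auto simp: coeff_eq_0\<close>)
  have add: "ap (P + Q) = ap P + ap Q" for P Q
  proof -
    have "degree P \<le> max (degree P) (degree Q)" "degree Q \<le> max (degree P) (degree Q)"
      "degree (P + Q) \<le> max (degree P) (degree Q)"
      by (auto intro: degree_add_le)
    then show ?thesis
      by (simp add: ap[of _ "max (degree P) (degree Q)"] vec.scale_left_distrib sum.distrib)
  qed
  have smult: "ap (smult c P) = c *s ap P" for c P
    using ap[of "smult c P" "degree P"]
    by (simp add: degree_smult_le ap_def vec.scale_sum_right vector_smult_assoc)
  have pC: "ap (pCons 0 P) = T (ap P)" for P
  proof -
    have "ap (pCons 0 P) = (\<Sum>i\<le>Suc (degree P). coeff (pCons 0 P) i *s (T ^^ i) v)"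
      by (rule ap) (simp add: degree_pCons_le)
    also have "\<dots> = (\<Sum>i\<le>degree P. coeff P i *s (T ^^ Suc i) v)"
      by (subst sum.atMost_Suc_shift) simp
    also have "\<dots> = T (ap P)" by (simp add: ap_def lin_sum[OF T] lin_scale[OF T])
    finally show ?thesis .
  qed
  have inA: "(T ^^ i) v \<in> A" for i using A(1) by (induction i) (auto simp: v)
  then have apA: "ap P \<in> A" for P
    unfolding ap_def by (intro vec.subspace_sum[OF A(2)] vec.subspace_scale[OF A(2)])
  have "\<exists>P. P \<noteq> 0 \<and> ap P \<in> B"
  proof -
    obtain c where c: "\<exists>i\<le>CARD('n). c i \<noteq> 0" "(\<Sum>i\<le>CARD('n). c i *s (T ^^ i) v) = 0"
      using dependent_sequence[of "\<lambda>i. (T ^^ i) v"] by blast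
    define P where "P = (\<Sum>i\<le>CARD('n). monom (c i) i)"
    have co: "coeff P i = (if i \<le> CARD('n) then c i else 0)" for i
      by (simp add: P_def coeff_sum)
    have "degree P \<le> CARD('n)" by (rule degree_le) (simp add: co)
    then have "ap P = (\<Sum>i\<le>CARD('n). c i *s (T ^^ i) v)"
      by (subst ap) (auto simp: co)
    moreover have "P \<noteq> 0" using c(1) co by (metis coeff_0)
    ultimately show ?thesis using c(2) vec.subspace_0[OF B] by auto
  qed
  then obtain P where P: "P \<noteq> 0" "ap P \<in> B"
    and Pmin: "\<And>Q. Q \<noteq> 0 \<Longrightarrow> ap Q \<in> B \<Longrightarrow> degree P \<le> degree Q"
    using ex_has_least_nat[of "\<lambda>P. P \<noteq> 0 \<and> ap P \<in> B" _ degree] by blast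
  have "degree P \<ge> 1"
  proof (rule ccontr)
    assume "\<not> degree P \<ge> 1"
    then obtain c where c: "P = [:c:]" using degree_eq_zeroE[of P] by (metis less_one not_less)
    then have "c *s v \<in> B" "c \<noteq> 0" using P by (auto simp: ap_def)
    then have "inverse c *s (c *s v) \<in> B" using vec.subspace_scale[OF B] by blast
    then show False using v \<open>c \<noteq> 0\<close> by simp
  qed
  then obtain z where "poly P z = 0" using ac by (auto simp: alg_closed_def)
  then obtain Q where Q: "P = [:-z, 1:] * Q" by (auto simp: poly_eq_0_iff_dvd)
  have Q0: "Q \<noteq> 0" using P Q by auto
  have "degree P = Suc (degree Q)" unfolding Q using Q0 by (subst degree_mult_eq) auto
  then have nB: "ap Q \<notin> B" using Pmin[OF Q0] by auto
  have "P = smult (-z) Q + pCons 0 Q" by (simp add: Q)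
  then have "ap P = T (ap Q) - z *s ap Q" by (simp only: add smult pC) (simp add: vec.scale_minus_left)
  then show ?thesis using P nB apA by metis
qed

lemma ex_max_dim:
  fixes P :: "('k::field^'n::finite) set \<Rightarrow> bool"
  assumes "P M0"
  shows "\<exists>M. P M \<and> (\<forall>M'. P M' \<longrightarrow> vec.dim M' \<le> vec.dim M)"
proof -
  have "vec.dim M < Suc CARD('n)" for M :: "('k^'n) set"
    using vec.dim_subset_UNIV[of M] by (simp add: vec.dimension_def card_cart_basis)
  then have "\<forall>M. P M \<longrightarrow> vec.dim M < Suc CARD('n)" by blast
  then show ?thesis by (rule ex_has_greatest_nat[where P = P, OF assms])
qed

section \<open>Generalized eigenspaces of a linear map\<close>

definition gen_eigenspace :: "('k::field^'n::finite \<Rightarrow> 'k^'n) \<Rightarrow> 'k \<Rightarrow> ('k^'n) set" where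
  "gen_eigenspace T c = {v. \<exists>k. ((\<lambda>v. T v - c *s v) ^^ k) v = 0}"

abbreviation spectrum :: "('k::field^'n::finite \<Rightarrow> 'k^'n) \<Rightarrow> 'k set" where
  "spectrum T \<equiv> {c. gen_eigenspace T c \<noteq> {0}}"

context
  fixes T :: "'k::field^'n::finite \<Rightarrow> 'k^'n"
  assumes T: "lin T"
begin

private abbreviation (input) sh where "sh c \<equiv> (\<lambda>v. T v - c *s v)"

lemma gen_eigenspace_iff: "v \<in> gen_eigenspace T c \<longleftrightarrow> (sh c ^^ CARD('n)) v = 0"
  unfolding gen_eigenspace_def using funpow_vanish_dim[OF lin_shift[OF T, of c]] by blast

lemma subspace_gen_eigenspace: "vec.subspace (gen_eigenspace T c)"
proof -
  have l: "lin (sh c ^^ CARD('n))" by (rule lin_funpow[OF lin_shift[OF T]])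
  show ?thesis
    by (rule vec.subspaceI) (auto simp: gen_eigenspace_iff lin_0[OF l] lin_add[OF l] lin_scale[OF l])
qed

lemma eigenvector_in_gen: "T v = c *s v \<Longrightarrow> v \<in> gen_eigenspace T c"
  unfolding gen_eigenspace_def by (auto intro!: exI[of _ 1])

lemma gen_eigenspace_commute:
  assumes S: "lin S" and ST: "\<And>v. S (T v) = T (S v)" and v: "v \<in> gen_eigenspace T c"
  shows "S v \<in> gen_eigenspace T c"
proof -
  have "(sh c ^^ k) (S v) = S ((sh c ^^ k) v)" for k
    by (induction k) (auto simp: ST lin_diff[OF S] lin_scale[OF S])
  then show ?thesis using v by (simp add: gen_eigenspace_iff lin_0[OF S])
qed

lemma gen_eigenspace_invariant: "v \<in> gen_eigenspace T c \<Longrightarrow> T v \<in> gen_eigenspace T c"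
  by (rule gen_eigenspace_commute) (auto simp: T)

text \<open>T - c0 is invertible on the generalized eigenspace of c, so it cannot carry a vector
  from outside the invariant \<open>M\<close> into \<open>M\<close>. Concretely, (T - c0) u - (T -
  c) u = (c - c0) u, with induction on the power of T - c killing u.\<close>

lemma gen_eigenspace_shift_mem:
  assumes M: "vec.subspace M" "T ` M \<subseteq> M"
    and u: "u \<in> gen_eigenspace T c" "c \<noteq> c0" "(sh c0 ^^ k) u \<in> M"
  shows "u \<in> M"
proof -
  have inv: "sh c x \<in> M" if "x \<in> M" for x c
    by (intro vec.subspace_diff[OF M(1)] image_subset_iff[THEN iffD1, OF M(2), rule_format] vec.subspace_scale[OF M(1)] that)
  have one: "u \<in> M" if "(sh c ^^ j) u = 0" "sh c0 u \<in> M" for u j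
    using that
  proof (induction j arbitrary: u)
    case 0 then show ?case using M(1) by (simp add: vec.subspace_0)
  next
    case (Suc j)
    have "(sh c ^^ j) (sh c u) = 0" using Suc.prems(1) by (simp only: funpow_Suc_right comp_apply)
    moreover have "sh c0 (sh c u) = sh c (sh c0 u)"
      by (simp add: lin_diff[OF T] lin_scale[OF T] vec.scale_right_diff_distrib vector_smult_assoc
          mult.commute)
    ultimately have "sh c u \<in> M" using Suc.IH[of "sh c u"] inv[OF Suc.prems(2), of c] by simp
    then have "sh c0 u - sh c u \<in> M" using Suc.prems(2) vec.subspace_diff[OF M(1)] by blast
    moreover have "sh c0 u - sh c u = (c - c0) *s u" by (simp add: vec.scale_left_diff_distrib)
    ultimately have "(c - c0) *s u \<in> M" by simp
    then show ?case using u(2) subspace_scale_cancel[OF M(1)] by (metis right_minus_eq)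
  qed
  show ?thesis using u(3)
  proof (induction k)
    case (Suc k)
    have "(sh c0 ^^ k) u \<in> gen_eigenspace T c"
      by (rule gen_eigenspace_commute[OF lin_funpow[OF lin_shift[OF T]] _ u(1)])
        (induction k, auto simp: lin_diff[OF T] lin_scale[OF T])
    then have "(sh c ^^ CARD('n)) ((sh c0 ^^ k) u) = 0" by (simp add: gen_eigenspace_iff)
    then have "(sh c0 ^^ k) u \<in> M" by (rule one) (use Suc in simp)
    then show ?case by (rule Suc.IH)
  qed simp
qed

text \<open>A power of T - c0 removes the component for c0; induction puts the images of the others
  into \<open>M\<close>, and \<open>gen_eigenspace_shift_mem\<close> takes that power back.\<close>

lemma gen_components_in_invariant:
  assumes M: "vec.subspace M" "T ` M \<subseteq> M"
    and C: "finite C" "\<And>c. c \<in> C \<Longrightarrow> u c \<in> gen_eigenspace T c" "(\<Sum>c\<in>C. u c) \<in> M"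
  shows "\<forall>c\<in>C. u c \<in> M"
  using C
proof (induction C arbitrary: u rule: finite_induct)
  case (insert c0 C)
  let ?N = "sh c0 ^^ CARD('n)"
  have l: "lin ?N" by (rule lin_funpow[OF lin_shift[OF T]])
  have inv: "(sh c0 ^^ k) x \<in> M" if "x \<in> M" for x k
    using that M(2) by (induction k) (auto intro!: vec.subspace_diff[OF M(1)] vec.subspace_scale[OF M(1)])
  have comm: "?N (T v) = T (?N v)" for v
  proof -
    have "(sh c0 ^^ k) (T v) = T ((sh c0 ^^ k) v)" for k
      by (induction k) (auto simp: lin_diff[OF T] lin_scale[OF T])
    then show ?thesis .
  qed
  have "?N (u c0) = 0" using insert.prems(1)[of c0] by (simp add: gen_eigenspace_iff)
  moreover have "?N (\<Sum>c\<in>insert c0 C. u c) \<in> M" by (rule inv) (rule insert.prems)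
  ultimately have N: "(\<Sum>c\<in>C. ?N (u c)) \<in> M" using insert.hyps by (simp add: lin_add[OF l] lin_sum[OF l])
  have "?N (u c) \<in> gen_eigenspace T c" if "c \<in> C" for c
    by (rule gen_eigenspace_commute[OF l comm]) (use that insert.prems(1) in blast)
  then have "\<forall>c\<in>C. ?N (u c) \<in> M" using N by (rule insert.IH)
  then have C: "\<forall>c\<in>C. u c \<in> M"
  proof (intro ballI)
    fix c assume c: "c \<in> C" "\<forall>c\<in>C. ?N (u c) \<in> M"
    have "c \<noteq> c0" using c(1) insert.hyps by blast
    then show "u c \<in> M"
      using gen_eigenspace_shift_mem[OF M insert.prems(1), of c c0 "CARD('n)"] c by simp
  qed
  then have "(\<Sum>c\<in>C. u c) \<in> M" by (intro vec.subspace_sum[OF M(1)]) auto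
  then have "u c0 \<in> M"
    using insert.prems(2) insert.hyps vec.subspace_diff[OF M(1), of "\<Sum>c\<in>insert c0 C. u c" "\<Sum>c\<in>C. u c"]
    by simp
  then show ?case using C by simp
qed simp

lemma gen_components_zero:
  assumes "finite C" "\<And>c. c \<in> C \<Longrightarrow> u c \<in> gen_eigenspace T c" "(\<Sum>c\<in>C. u c) = 0" "c \<in> C"
  shows "u c = 0"
  using gen_components_in_invariant[of "{0}" C u] assms by (auto simp: lin_0[OF T])

lemma finite_gen_spectrum: "finite (spectrum T)" (is "finite ?L")
proof (rule ccontr)
  assume "infinite ?L"
  then obtain e :: "nat \<Rightarrow> 'k" where e: "inj e" "range e \<subseteq> ?L"
    using infinite_countable_subset[of ?L] by auto
  have "\<forall>c\<in>?L. \<exists>v. v \<in> gen_eigenspace T c \<and> v \<noteq> 0"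
    using vec.subspace_0[OF subspace_gen_eigenspace] by auto
  from bchoice[OF this] obtain w
    where w: "\<And>c. c \<in> ?L \<Longrightarrow> w c \<in> gen_eigenspace T c \<and> w c \<noteq> 0" by blast
  obtain a where a: "\<exists>i\<le>CARD('n). a i \<noteq> 0" "(\<Sum>i\<le>CARD('n). a i *s w (e i)) = 0"
    using dependent_sequence[of "\<lambda>i. w (e i)"] by blast
  define u where "u c = a (the_inv e c) *s w c" for c
  have "(\<Sum>c\<in>e ` {..CARD('n)}. u c) = 0"
    using a(2) e(1) by (simp add: sum.reindex inj_on_subset u_def the_inv_f_f)
  moreover have "u c \<in> gen_eigenspace T c" if "c \<in> e ` {..CARD('n)}" for c
    unfolding u_def using w[of c] e(2) that by (intro vec.subspace_scale[OF subspace_gen_eigenspace]) blast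
  ultimately have "u c = 0" if "c \<in> e ` {..CARD('n)}" for c
    using gen_components_zero[of "e ` {..CARD('n)}" u c] that by blast
  then have "u (e i) = 0" if "i \<le> CARD('n)" for i using that by blast
  moreover have "w (e i) \<noteq> 0" for i by (rule conjunct2[OF w[OF subsetD[OF e(2) rangeI]]])
  ultimately have "a i = 0" if "i \<le> CARD('n)" for i
    using that by (auto simp: u_def the_inv_f_f[OF e(1)])
  then show False using a(1) by auto
qed

lemma subspace_sums_gen:
  "vec.subspace {v. \<exists>u. (\<forall>c. u c \<in> gen_eigenspace T c) \<and> v = (\<Sum>c\<in>spectrum T. u c)}"
  (is "vec.subspace ?W")
proof (rule vec.subspaceI)
  show "0 \<in> ?W" by (auto intro!: exI[of _ "\<lambda>_. 0"] simp: vec.subspace_0 subspace_gen_eigenspace)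
next
  fix x y assume "x \<in> ?W" "y \<in> ?W"
  then obtain u u' where "\<forall>c. u c \<in> gen_eigenspace T c" "x = (\<Sum>c\<in>spectrum T. u c)"
    "\<forall>c. u' c \<in> gen_eigenspace T c" "y = (\<Sum>c\<in>spectrum T. u' c)" by auto
  then show "x + y \<in> ?W"
    by (auto intro!: exI[of _ "\<lambda>c. u c + u' c"] simp: sum.distrib vec.subspace_add subspace_gen_eigenspace)
next
  fix a x assume "x \<in> ?W"
  then obtain u where "\<forall>c. u c \<in> gen_eigenspace T c" "x = (\<Sum>c\<in>spectrum T. u c)" by auto
  then show "a *s x \<in> ?W"
    by (auto intro!: exI[of _ "\<lambda>c. a *s u c"] simp: vec.scale_sum_right vec.subspace_scale subspace_gen_eigenspace)
qed

text \<open>If the sum W of the generalized eigenspaces were proper, some a outside W would be an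
  eigenvector modulo W, say for mu. Subtracting preimages under T - mu of the components for c other
  than mu turns a into a generalized eigenvector for mu, so a would lie in W.\<close>

lemma gen_decomposition:
  assumes ac: "alg_closed TYPE('k)"
  shows "\<exists>u. (\<forall>c. u c \<in> gen_eigenspace T c) \<and> v = (\<Sum>c\<in>spectrum T. u c)"
proof -
  let ?L = "spectrum T"
  define W where "W = {v. \<exists>u. (\<forall>c. u c \<in> gen_eigenspace T c) \<and> v = (\<Sum>c\<in>?L. u c)}"
  have W: "vec.subspace W" unfolding W_def by (rule subspace_sums_gen)
  have genW: "x \<in> W" if "x \<in> gen_eigenspace T c" for x c
  proof (cases "c \<in> ?L")
    case True
    have "x = (\<Sum>c'\<in>?L. if c' = c then x else 0)" using True finite_gen_spectrum by simp
    then show ?thesis unfolding W_def using that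
      by (auto intro!: exI[of _ "\<lambda>c'. if c' = c then x else 0"] simp: vec.subspace_0 subspace_gen_eigenspace)
  qed (use that W in \<open>auto simp: vec.subspace_0\<close>)
  have "W = UNIV"
  proof (rule ccontr)
    assume "W \<noteq> UNIV"
    then obtain v where v: "v \<notin> W" by auto
    have "\<exists>a\<in>UNIV. a \<notin> W \<and> (\<exists>c. T a - c *s a \<in> W)"
      by (rule eigenvector_mod_subspace[OF ac T, of UNIV W v]) (use v W in auto)
    then obtain a \<mu> where a: "a \<notin> W" "T a - \<mu> *s a \<in> W" by auto
    then obtain u where u: "\<forall>c. u c \<in> gen_eigenspace T c" "sh \<mu> a = (\<Sum>c\<in>?L. u c)"
      unfolding W_def by auto
    \<comment> \<open>T - mu maps the generalized eigenspace of any other c onto itself.\<close>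
    have ex: "\<exists>w\<in>gen_eigenspace T c. sh \<mu> w = x" if "c \<noteq> \<mu>" "(sh c ^^ k) x = 0" for c x k
      using that
    proof (induction k arbitrary: x)
      case 0 then show ?case using vec.subspace_0[OF subspace_gen_eigenspace]
        by (intro bexI[of _ 0]) (auto simp: lin_0[OF T])
    next
      case (Suc k)
      have x: "x \<in> gen_eigenspace T c" using Suc.prems(2) unfolding gen_eigenspace_def by blast
      have "(sh c ^^ k) (sh c x) = 0" using Suc.prems(2) by (simp only: funpow_Suc_right comp_apply)
      then obtain w where w: "w \<in> gen_eigenspace T c" "sh \<mu> w = sh c x" using Suc by blast
      have "sh \<mu> (x - w) = (c - \<mu>) *s x" using w(2)
        by (simp add: lin_diff[OF T] vec.scale_left_diff_distrib vec.scale_right_diff_distrib algebra_simps)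
      then have "sh \<mu> (inverse (c - \<mu>) *s (x - w)) = x"
        using Suc.prems(1) lin_scale[OF lin_shift[OF T, of \<mu>], of "inverse (c - \<mu>)" "x - w"]
        by (metis inverse_scale right_minus_eq)
      moreover have "inverse (c - \<mu>) *s (x - w) \<in> gen_eigenspace T c"
        by (intro vec.subspace_scale vec.subspace_diff subspace_gen_eigenspace x w)
      ultimately show ?case by blast
    qed
    have "\<exists>w. c \<noteq> \<mu> \<longrightarrow> w \<in> gen_eigenspace T c \<and> sh \<mu> w = u c" for c
    proof -
      obtain k where "(sh c ^^ k) (u c) = 0" using u(1) by (auto simp: gen_eigenspace_def)
      then show ?thesis using ex by blast
    qed
    then obtain w where w: "\<And>c. c \<noteq> \<mu> \<Longrightarrow> w c \<in> gen_eigenspace T c \<and> sh \<mu> (w c) = u c" by metis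
    let ?s = "\<Sum>c\<in>?L - {\<mu>}. w c"
    have "sh \<mu> (a - ?s) = (\<Sum>c\<in>?L. u c) - (\<Sum>c\<in>?L - {\<mu>}. u c)"
      using w u(2) by (simp only: lin_diff[OF lin_shift[OF T, of \<mu>]] lin_sum[OF lin_shift[OF T, of \<mu>]]) simp
    also have "\<dots> = (if \<mu> \<in> ?L then u \<mu> else 0)"
      using finite_gen_spectrum by (auto simp: sum.remove)
    finally have "sh \<mu> (a - ?s) \<in> gen_eigenspace T \<mu>"
      using u(1) by (simp add: vec.subspace_0 subspace_gen_eigenspace)
    then obtain k where "(sh \<mu> ^^ k) (sh \<mu> (a - ?s)) = 0" unfolding gen_eigenspace_def by blast
    then have "(sh \<mu> ^^ Suc k) (a - ?s) = 0" by (simp only: funpow_Suc_right comp_apply)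
    then have "a - ?s \<in> W" by (intro genW) (auto simp: gen_eigenspace_def simp del: funpow.simps)
    moreover have "?s \<in> W" by (intro vec.subspace_sum[OF W] genW) (use w in auto)
    ultimately have "(a - ?s) + ?s \<in> W" using vec.subspace_add[OF W] by blast
    then show False using a by simp
  qed
  then show ?thesis unfolding W_def by auto
qed

end

text \<open>Meaningful for every \<open>c\<close>: outside the spectrum the chosen family is forced
  to be 0, since it lies in the generalized eigenspaces there too.\<close>

definition gen_proj :: "('k::field^'n::finite \<Rightarrow> 'k^'n) \<Rightarrow> 'k \<Rightarrow> 'k^'n \<Rightarrow> 'k^'n" where
  "gen_proj T c v = (SOME u. (\<forall>c. u c \<in> gen_eigenspace T c) \<and>
      v = (\<Sum>c\<in>spectrum T. u c)) c"

context
  fixes T :: "'k::field^'n::finite \<Rightarrow> 'k^'n"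
  assumes T: "lin T" and ac: "alg_closed TYPE('k)"
begin

lemma gen_proj_mem: "gen_proj T c v \<in> gen_eigenspace T c"
  and gen_proj_sum: "v = (\<Sum>c\<in>spectrum T. gen_proj T c v)"
proof -
  have "(\<forall>c. gen_proj T c v \<in> gen_eigenspace T c) \<and>
      v = (\<Sum>c\<in>spectrum T. gen_proj T c v)"
    unfolding gen_proj_def by (rule someI_ex[OF gen_decomposition[OF T ac]])
  then show "gen_proj T c v \<in> gen_eigenspace T c" "v = (\<Sum>c\<in>spectrum T. gen_proj T c v)"
    by auto
qed

lemma gen_proj_unique:
  assumes u: "\<And>c. u c \<in> gen_eigenspace T c" and v: "v = (\<Sum>c\<in>spectrum T. u c)"
  shows "gen_proj T c v = u c"
proof (cases "gen_eigenspace T c = {0}")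
  case True
  then show ?thesis using u[of c] gen_proj_mem[of c v] by auto
next
  case False
  have "(\<Sum>c\<in>spectrum T. gen_proj T c v - u c) = 0"
    unfolding sum_subtractf v[symmetric] gen_proj_sum[symmetric] by simp
  then have "gen_proj T c v - u c = 0"
    by (rule gen_components_zero[OF T finite_gen_spectrum[OF T], rotated])
      (use False in \<open>auto intro!: vec.subspace_diff[OF subspace_gen_eigenspace[OF T]] gen_proj_mem u\<close>)
  then show ?thesis by simp
qed

lemma lin_gen_proj: "lin (gen_proj T c)"
proof (rule linI)
  fix x y
  show "gen_proj T c (x + y) = gen_proj T c x + gen_proj T c y"
    by (rule gen_proj_unique)
      (auto intro!: vec.subspace_add[OF subspace_gen_eigenspace[OF T]] gen_proj_mem
        simp: sum.distrib gen_proj_sum[symmetric])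
next
  fix a x
  show "gen_proj T c (a *s x) = a *s gen_proj T c x"
    by (rule gen_proj_unique)
      (auto intro!: vec.subspace_scale[OF subspace_gen_eigenspace[OF T]] gen_proj_mem
        simp: vec.scale_sum_right[symmetric] gen_proj_sum[symmetric])
qed

lemma sum_single_gen:
  assumes "v \<in> gen_eigenspace T c" "g c 0 = 0"
  shows "(\<Sum>c'\<in>spectrum T. if c' = c then g c v else 0) = g c v"
proof (cases "gen_eigenspace T c = {0}")
  case True
  then have "v = 0" using assms by simp
  show ?thesis unfolding \<open>v = 0\<close> assms(2) by simp
next
  case False
  then have "c \<in> spectrum T" by blast
  then show ?thesis by (subst sum.delta[OF finite_gen_spectrum[OF T]]) (simp only: if_True)
qed

lemma gen_proj_same:
  assumes v: "v \<in> gen_eigenspace T c"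
  shows "gen_proj T c' v = (if c' = c then v else 0)"
proof (rule gen_proj_unique[of "\<lambda>c'. if c' = c then v else 0"])
  show "v = (\<Sum>c'\<in>spectrum T. if c' = c then v else 0)"
    using sum_single_gen[OF v, of "\<lambda>_ v. v"] by (rule sym) (rule refl)
  show "(if c' = c then v else 0) \<in> gen_eigenspace T c'" for c'
    using v vec.subspace_0[OF subspace_gen_eigenspace[OF T]] by (cases "c' = c") simp_all
qed

lemma gen_proj_in_invariant:
  assumes M: "vec.subspace M" "T ` M \<subseteq> M" and v: "v \<in> M"
  shows "gen_proj T c v \<in> M"
proof (cases "gen_eigenspace T c = {0}")
  case True
  then have "gen_proj T c v = 0" using gen_proj_mem[of c v] by auto
  then show ?thesis using M by (simp add: vec.subspace_0)
next
  case False
  have "(\<Sum>c\<in>spectrum T. gen_proj T c v) \<in> M"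
    using v by (simp only: gen_proj_sum[symmetric])
  then have "\<forall>c\<in>spectrum T. gen_proj T c v \<in> M"
    by (rule gen_components_in_invariant[OF T M finite_gen_spectrum[OF T] gen_proj_mem])
  then show ?thesis using False by blast
qed

lemma gen_proj_commute:
  assumes S: "lin S" "\<And>c v. v \<in> gen_eigenspace T c \<Longrightarrow> S v \<in> gen_eigenspace T c"
  shows "gen_proj T c (S v) = S (gen_proj T c v)"
  by (rule gen_proj_unique)
    (use S gen_proj_mem in \<open>auto simp: lin_sum[OF S(1), symmetric] gen_proj_sum[symmetric]\<close>)

lemma gen_induct:
  assumes "\<And>c x. x \<in> gen_eigenspace T c \<Longrightarrow> P x" "\<And>x y. P x \<Longrightarrow> P y \<Longrightarrow> P (x + y)"
  shows "P v"
proof -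
  have P0: "P 0" using assms(1)[of 0] vec.subspace_0[OF subspace_gen_eigenspace[OF T]] by blast
  have "P (\<Sum>c\<in>C. gen_proj T c v)" if "finite C" for C
    using that by (induction C rule: finite_induct) (auto intro: P0 assms gen_proj_mem)
  then have "P (\<Sum>c\<in>spectrum T. gen_proj T c v)" using finite_gen_spectrum[OF T] by blast
  then show ?thesis by (simp only: gen_proj_sum[symmetric])
qed

text \<open>Acts by \<open>f c\<close> on each generalized eigenspace. The identity gives the
  semisimple part of T, a rational functional gives a replica in the sense of Chevalley, the
  indicator of a residue class gives a graded projection.\<close>

definition eig_map :: "('k \<Rightarrow> 'k) \<Rightarrow> 'k^'n \<Rightarrow> 'k^'n" where
  "eig_map f v = (\<Sum>c\<in>spectrum T. f c *s gen_proj T c v)"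

lemma lin_eig_map: "lin (eig_map f)"
  unfolding eig_map_def
  by (rule linI) (auto simp: lin_add[OF lin_gen_proj] lin_scale[OF lin_gen_proj] sum.distrib
      vec.scale_right_distrib vec.scale_sum_right vector_smult_assoc mult.commute)

lemma eig_map_gen: "v \<in> gen_eigenspace T c \<Longrightarrow> eig_map f v = f c *s v"
proof -
  assume v: "v \<in> gen_eigenspace T c"
  have "eig_map f v = (\<Sum>c'\<in>spectrum T. if c' = c then f c *s v else 0)"
    unfolding eig_map_def by (rule sum.cong) (simp_all add: gen_proj_same[OF v])
  also have "\<dots> = f c *s v" by (rule sum_single_gen[OF v]) simp
  finally show ?thesis .
qed

end

section \<open>Traces\<close>

definition tr :: "('k::field^'n::finite \<Rightarrow> 'k^'n) \<Rightarrow> 'k" where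
  "tr f = (\<Sum>i\<in>UNIV. f (axis i 1) $ i)"

lemma tr_add: "tr (\<lambda>v. f v + g v) = tr f + tr g"
  and tr_diff: "tr (\<lambda>v. f v - g v) = tr f - tr g"
  and tr_scale: "tr (\<lambda>v. c *s f v) = c * tr f"
  and tr_0: "tr (\<lambda>v. 0) = 0"
  by (simp_all add: tr_def sum.distrib sum_subtractf sum_distrib_left)

lemma tr_sum: "tr (\<lambda>v. \<Sum>b\<in>B. f b v) = (\<Sum>b\<in>B. tr (f b))"
  unfolding tr_def sum_component by (rule sum.swap)

lemma tr_commute:
  assumes f: "lin f" and g: "lin g"
  shows "tr (\<lambda>v. f (g v)) = tr (\<lambda>v. g (f v))"
proof -
  have tr: "tr h = trace (matrix h)" for h :: "'a^'b \<Rightarrow> 'a^'b" by (simp add: tr_def trace_def matrix_def)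
  show ?thesis
    using trace_mul_sym[of "matrix f" "matrix g"] matrix_compose_gen[OF f g] matrix_compose_gen[OF g f]
    by (simp add: tr o_def)
qed

text \<open>\<open>f\<close> is the sum over b of the rank one maps sending v to r_b(v) f(b), where
  r_b is the coordinate at b; such a map has trace r_b(f(b)).\<close>

lemma tr_basis:
  fixes f :: "'k::field^'n::finite \<Rightarrow> 'k^'n"
  assumes f: "lin f" and B: "vec.independent B" "vec.span B = UNIV"
  shows "tr f = (\<Sum>b\<in>B. vec.representation B (f b) b)"
proof -
  have fin: "finite B" using B(1) by (rule vec.finiteI_independent)
  let ?r = "vec.representation B"
  have expand: "f v = (\<Sum>b\<in>B. ?r v b *s f b)" for v
  proof -
    have "v = (\<Sum>b\<in>B. ?r v b *s b)" using vec.sum_representation_eq[OF B(1) _ fin, of v] B(2) by simp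
    then have "f v = f (\<Sum>b\<in>B. ?r v b *s b)" by simp
    then show ?thesis by (simp add: lin_sum[OF f] lin_scale[OF f])
  qed
  have one: "tr (\<lambda>v. ?r v b *s u) = ?r u b" for b u
  proof -
    have "?r u b = ?r (\<Sum>i\<in>UNIV. u $ i *s axis i 1) b" by (simp add: basis_expansion)
    also have "\<dots> = (\<Sum>i\<in>UNIV. ?r (u $ i *s axis i 1) b)"
      using B by (subst vec.representation_sum) auto
    also have "\<dots> = (\<Sum>i\<in>UNIV. u $ i * ?r (axis i 1) b)"
      using B by (subst vec.representation_scale) auto
    finally show ?thesis by (simp add: tr_def mult.commute)
  qed
  have "f = (\<lambda>v. \<Sum>b\<in>B. ?r v b *s f b)" by (rule ext) (rule expand)
  then have "tr f = tr (\<lambda>v. \<Sum>b\<in>B. ?r v b *s f b)" by (rule arg_cong)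
  also have "\<dots> = (\<Sum>b\<in>B. ?r (f b) b)" by (simp add: tr_sum one)
  finally show ?thesis .
qed

text \<open>A basis adapted to a flag of invariant subspaces makes T triangular. \<open>good\<close>
  lets a caller demand invariance under further maps, \<open>M\<close> confines the diagonal
  entries, and starting from \<open>B\<close> guarantees that prescribed entries occur in the
  sum.\<close>

lemma tr_flag:
  fixes T :: "'k::field^'n::finite \<Rightarrow> 'k^'n"
  assumes T: "lin T"
    and good: "\<And>W. good W \<Longrightarrow> vec.subspace W \<and> T ` W \<subseteq> W"
    and step: "\<And>W. good W \<Longrightarrow> W \<noteq> UNIV \<Longrightarrow>
      \<exists>a c. a \<notin> W \<and> c \<in> M \<and> T a - c *s a \<in> W \<and> good (vec.span (insert a W))"
    and B: "vec.independent B" "good (vec.span B)"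
      "\<forall>b\<in>B. vec.representation B (T b) b = \<mu> b \<and> \<mu> b \<in> M"
  shows "\<exists>B' \<mu>'. B \<subseteq> B' \<and> finite B' \<and> (\<forall>b\<in>B. \<mu>' b = \<mu> b) \<and> (\<forall>b\<in>B'. \<mu>' b \<in> M) \<and> tr T = sum \<mu>' B'"
  using B
proof (induction "CARD('n) - card B" arbitrary: B \<mu> rule: less_induct)
  case less
  have fin: "finite B" using less.prems(1) by (rule vec.finiteI_independent)
  show ?case
  proof (cases "vec.span B = UNIV")
    case True
    then have "tr T = sum \<mu> B" using tr_basis[OF T less.prems(1)] less.prems(3) by simp
    then show ?thesis using less.prems(3) fin by blast
  next
    case False
    obtain a c where a: "a \<notin> vec.span B" "c \<in> M" "T a - c *s a \<in> vec.span B"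
      "good (vec.span (insert a (vec.span B)))" using step[OF less.prems(2) False] by blast
    have aB: "a \<notin> B" using a(1) vec.span_base by blast
    have span: "vec.span (insert a (vec.span B)) = vec.span (insert a B)"
      by (auto simp: vec.span_breakdown_eq vec.span_span)
    have ind: "vec.independent (insert a B)" using vec.independent_insertI[OF a(1) less.prems(1)] .
    have repB: "vec.representation (insert a B) v = vec.representation B v" if "v \<in> vec.span B" for v
      by (rule vec.representation_extend[OF ind that]) blast
    let ?\<mu> = "\<mu>(a := c)"
    have rest: "vec.representation (insert a B) (T b) b = \<mu> b" if "b \<in> B" for b
    proof -
      have "T b \<in> vec.span B" using good[OF less.prems(2)] that vec.span_base[of b B] by blast
      then show ?thesis using less.prems(3) that by (simp add: repB)
    qed
    have "vec.representation (insert a B) (T a) a = c"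
    proof -
      have aS: "a \<in> vec.span (insert a B)" by (simp add: vec.span_base)
      have w: "T a - c *s a \<in> vec.span (insert a B)" using a(3) vec.span_mono[of B "insert a B"] by blast
      have "vec.representation (insert a B) ((T a - c *s a) + c *s a) a
          = vec.representation (insert a B) (T a - c *s a) a + c * vec.representation (insert a B) a a"
        using vec.representation_add[OF ind w vec.span_scale[OF aS, of c]]
          vec.representation_scale[OF ind aS, of c] by (simp add: fun_eq_iff)
      moreover have "vec.representation (insert a B) a a = 1"
        using vec.representation_basis[OF ind, of a] by simp
      moreover have "vec.representation (insert a B) (T a - c *s a) a = 0"
        using repB[OF a(3)] aB vec.representation_ne_zero by fastforce
      ultimately show ?thesis by simp
    qed
    then have pr: "\<forall>b\<in>insert a B. vec.representation (insert a B) (T b) b = ?\<mu> b \<and> ?\<mu> b \<in> M"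
      using rest a(2) less.prems(3) aB by auto
    have "card (insert a B) \<le> CARD('n)"
      using vec.independent_bound_general[OF ind] vec.dim_subset_UNIV[of "insert a B"]
      by (simp add: vec.dimension_def card_cart_basis)
    then have "CARD('n) - card (insert a B) < CARD('n) - card B" using aB fin by simp
    from less.hyps[OF this ind a(4)[unfolded span] pr]
    obtain B' \<mu>' where "insert a B \<subseteq> B'" "finite B'" "\<forall>b\<in>insert a B. \<mu>' b = ?\<mu> b"
      "\<forall>b\<in>B'. \<mu>' b \<in> M" "tr T = sum \<mu>' B'" by blast
    moreover from this have "\<forall>b\<in>B. \<mu>' b = \<mu> b" using aB by auto
    ultimately show ?thesis by blast
  qed
qed

corollary tr_flag_zero:
  fixes T :: "'k::field^'n::finite \<Rightarrow> 'k^'n"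
  assumes T: "lin T"
    and good: "\<And>W. good W \<Longrightarrow> vec.subspace W \<and> T ` W \<subseteq> W" "good {0}"
    and step: "\<And>W. good W \<Longrightarrow> W \<noteq> UNIV \<Longrightarrow> \<exists>a. a \<notin> W \<and> T a \<in> W \<and> good (vec.span (insert a W))"
  shows "tr T = 0"
proof -
  have "\<exists>(B' :: ('k^'n) set) \<mu>'. {} \<subseteq> B' \<and> finite B' \<and> (\<forall>b\<in>{}. \<mu>' b = (\<lambda>_. 0) b) \<and>
      (\<forall>b\<in>B'. \<mu>' b \<in> {0}) \<and> tr T = sum \<mu>' B'"
    by (rule tr_flag[OF T, of good "{0}" "{}" "\<lambda>_. 0"])
      (use good step in \<open>auto simp: vec.independent_empty\<close>)
  then show ?thesis by auto
qed

lemma last_nonmember: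
  assumes "v \<notin> W" "(f ^^ k) v \<in> W"
  shows "\<exists>j. (f ^^ j) v \<notin> W \<and> f ((f ^^ j) v) \<in> W"
  using assms
proof (induction k)
  case (Suc k) then show ?case by (cases "(f ^^ k) v \<in> W") auto
qed simp

lemma tr_nilpotent:
  fixes T :: "'k::field^'n::finite \<Rightarrow> 'k^'n"
  assumes T: "lin T" and nil: "\<And>v. (T ^^ N) v = 0"
  shows "tr T = 0"
proof (rule tr_flag_zero[OF T, of "\<lambda>W. vec.subspace W \<and> T ` W \<subseteq> W"])
    fix W assume W: "vec.subspace W \<and> T ` W \<subseteq> W" "W \<noteq> UNIV"
    then obtain v where "v \<notin> W" by blast
    moreover have "(T ^^ N) v \<in> W" using W nil by (simp add: vec.subspace_0)
    ultimately obtain j where j: "(T ^^ j) v \<notin> W" "T ((T ^^ j) v) \<in> W" using last_nonmember by metis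
    let ?a = "(T ^^ j) v"
    have "T ` vec.span (insert ?a W) \<subseteq> vec.span (insert ?a W)"
      by (rule span_insert_invariant[OF T, where c = 0]) (use W j(2) in auto)
    then show "\<exists>a. a \<notin> W \<and> T a \<in> W \<and>
        (vec.subspace (vec.span (insert a W)) \<and> T ` vec.span (insert a W) \<subseteq> vec.span (insert a W))"
      using j by (intro exI[of _ ?a]) auto
qed (auto simp: lin_0[OF T])

text \<open>T and \<open>eig_map T f\<close> are triangularized along a common flag that starts with
  the line of \<open>v0\<close>, so that \<open>c0\<close> surely occurs in the sum.\<close>

lemma tr_eig_map:
  fixes T :: "'k::field^'n::finite \<Rightarrow> 'k^'n"
  assumes T: "lin T" and ac: "alg_closed TYPE('k)" and v0: "v0 \<noteq> 0" "T v0 = c0 *s v0"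
  shows "\<exists>B c. finite B \<and> v0 \<in> B \<and> c v0 = c0 \<and> tr (\<lambda>v. T (eig_map T f v)) = (\<Sum>b\<in>B. c b * f (c b))"
proof -
  let ?D = "eig_map T f"
  let ?TD = "\<lambda>v. T (?D v)"
  have D: "lin ?D" by (rule lin_eig_map[OF T ac])
  have TD: "lin ?TD" by (rule lin_compose[OF T D])
  let ?good = "\<lambda>W. vec.subspace W \<and> T ` W \<subseteq> W \<and> ?D ` W \<subseteq> W"
  let ?M = "{c * f c | c. True}"
  have "\<exists>B' \<mu>'. {v0} \<subseteq> B' \<and> finite B' \<and> (\<forall>b\<in>{v0}. \<mu>' b = (\<lambda>_. c0 * f c0) b) \<and>
      (\<forall>b\<in>B'. \<mu>' b \<in> ?M) \<and> tr ?TD = sum \<mu>' B'"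
  proof (rule tr_flag[OF TD, of ?good ?M "{v0}" "\<lambda>_. c0 * f c0"])
    fix W assume W: "?good W" "W \<noteq> UNIV"
    have "\<exists>c v. v \<in> gen_eigenspace T c \<and> v \<notin> W"
    proof (rule ccontr)
      assume *: "\<not> ?thesis"
      have "v \<in> W" for v
        by (induction v rule: gen_induct[OF T ac]) (use * W in \<open>auto intro: vec.subspace_add\<close>)
      then show False using W(2) by blast
    qed
    then obtain c v where v: "v \<in> gen_eigenspace T c" "v \<notin> W" by blast
    let ?s = "\<lambda>v. T v - c *s v"
    have "(?s ^^ CARD('n)) v \<in> W" using v(1) W(1) by (simp add: gen_eigenspace_iff[OF T] vec.subspace_0)
    then obtain j where j: "(?s ^^ j) v \<notin> W" "?s ((?s ^^ j) v) \<in> W" using last_nonmember[OF v(2)] by blast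
    define a where "a = (?s ^^ j) v"
    have aW: "a \<notin> W" "T a - c *s a \<in> W" using j unfolding a_def by auto
    have "(?s ^^ CARD('n)) a = 0"
    proof -
      have "(?s ^^ (CARD('n) + j)) v = (?s ^^ (j + CARD('n))) v" by (simp only: add.commute)
      then have "(?s ^^ CARD('n)) a = (?s ^^ j) ((?s ^^ CARD('n)) v)"
        unfolding a_def funpow_add comp_apply .
      then show ?thesis using v(1) by (simp add: gen_eigenspace_iff[OF T] lin_0[OF lin_funpow[OF lin_shift[OF T]]])
    qed
    then have Da: "?D a = f c *s a" by (intro eig_map_gen[OF T ac]) (simp add: gen_eigenspace_iff[OF T])
    have "?TD a - (c * f c) *s a = f c *s (T a - c *s a)"
      by (simp add: Da lin_scale[OF T] vec.scale_right_diff_distrib vector_smult_assoc mult.commute)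
    then have TDa: "?TD a - (c * f c) *s a \<in> W" using aW(2) W(1) vec.subspace_scale by metis
    have "?good (vec.span (insert a W))"
    proof (intro conjI)
      show "T ` vec.span (insert a W) \<subseteq> vec.span (insert a W)"
        by (rule span_insert_invariant[OF T _ _ aW(2)]) (use W(1) in auto)
      have "?D a - f c *s a \<in> W" using Da W(1) by (simp add: vec.subspace_0)
      then show "?D ` vec.span (insert a W) \<subseteq> vec.span (insert a W)"
        using W(1) by (intro span_insert_invariant[OF D]) auto
    qed simp
    then show "\<exists>a c. a \<notin> W \<and> c \<in> ?M \<and> ?TD a - c *s a \<in> W \<and> ?good (vec.span (insert a W))"
      using aW(1) TDa by blast
  next
    have g: "v0 \<in> gen_eigenspace T c0" by (rule eigenvector_in_gen[OF T v0(2)])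
    have Dv: "?D v0 = f c0 *s v0" by (rule eig_map_gen[OF T ac g])
    show "?good (vec.span {v0})"
      by (rule conjI[OF vec.subspace_span]) (auto simp: vec.span_singleton lin_scale[OF T] lin_scale[OF D] v0(2) Dv vector_smult_assoc)
    show ind: "vec.independent {v0}" using v0 by simp
    have "?TD v0 = (c0 * f c0) *s v0" by (simp add: Dv lin_scale[OF T] v0(2) vector_smult_assoc mult.commute)
    then have "vec.representation {v0} (?TD v0) v0 = (c0 * f c0) * vec.representation {v0} v0 v0"
      using vec.representation_scale[OF ind, of v0 "c0 * f c0"] by (simp add: vec.span_base fun_eq_iff)
    then show "\<forall>b\<in>{v0}. vec.representation {v0} (?TD b) b = (\<lambda>_. c0 * f c0) b \<and> (\<lambda>_. c0 * f c0) b \<in> ?M"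
      using vec.representation_basis[OF ind, of v0] by auto
  qed auto
  then obtain B \<mu> where B: "v0 \<in> B" "finite B" "\<mu> v0 = c0 * f c0" "\<forall>b\<in>B. \<exists>c. \<mu> b = c * f c"
    "tr ?TD = sum \<mu> B" by auto
  obtain c where c: "\<forall>b\<in>B. \<mu> b = c b * f (c b)" using bchoice[OF B(4)] by blast
  \<comment> \<open>\<open>c\<close> was chosen from the products alone and may differ from
    \<open>c0\<close> at \<open>v0\<close>; the update keeps the product.\<close>
  let ?c = "c(v0 := c0)"
  have "sum \<mu> B = (\<Sum>b\<in>B. ?c b * f (?c b))" using c B(3) by (intro sum.cong) auto
  then show ?thesis using B by (intro exI[of _ B] exI[of _ ?c]) auto
qed

section \<open>Rational functionals and the trace criterion for nilpotency\<close>

definition rational_functional :: "('k::field_char_0 \<Rightarrow> 'k) \<Rightarrow> bool" where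
  "rational_functional f \<longleftrightarrow> (\<forall>x y. f (x + y) = f x + f y) \<and>
     (\<forall>q x. f (of_rat q * x) = of_rat q * f x) \<and> range f \<subseteq> \<rat>"

text \<open>A nonzero \<open>c\<close> is independent in the field seen as a rational vector space.
  Values are rational but typed in the field, so that f supplies scalars for \<open>eig_map\<close>
  and f(c f(c)) = f(c)^2.\<close>

lemma rational_functional_exists:
  fixes c :: "'k::field_char_0"
  assumes "c \<noteq> 0"
  shows "\<exists>f. rational_functional f \<and> f c = 1"
proof -
  interpret vector_space_pair "\<lambda>(q::rat) (x::'k). of_rat q * x" "(*) :: rat \<Rightarrow> rat \<Rightarrow> rat"
    by unfold_locales (auto simp: algebra_simps of_rat_add of_rat_mult)
  have "vs1.independent {c}" using assms by simp
  from linear_independent_extend[OF this, of "\<lambda>_. 1"] obtain g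
    where g: "Vector_Spaces.linear (\<lambda>q x. of_rat q * x) (*) g" "g c = 1" by auto
  then have "rational_functional (\<lambda>x. of_rat (g x))"
    using linear_add[OF g(1)] linear_scale[OF g(1)]
    by (auto simp: rational_functional_def of_rat_add of_rat_mult)
  then show ?thesis using g(2) by (intro exI[of _ "\<lambda>x. of_rat (g x)"]) simp
qed

lemma rational_functional_sum:
  assumes "rational_functional f"
  shows "f (sum g A) = (\<Sum>a\<in>A. f (g a))"
proof -
  have "f (0 + 0) = f 0 + f 0" using assms unfolding rational_functional_def by blast
  then have "f 0 = 0" by simp
  then show ?thesis using assms
    by (induction A rule: infinite_finite_induct) (auto simp: rational_functional_def)
qed

text \<open>Applying \<open>f\<close> to the trace \<open>\<Sum> c f(c)\<close> turns it into a sum of squares of rationals.\<close>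

lemma nilpotent_if_tr_eig_map_zero:
  fixes T :: "'k::field_char_0^'n::finite \<Rightarrow> 'k^'n"
  assumes T: "lin T" and ac: "alg_closed TYPE('k)"
    and tr0: "\<And>f. rational_functional f \<Longrightarrow> tr (\<lambda>v. T (eig_map T f v)) = 0"
  shows "(T ^^ CARD('n)) v = 0"
proof -
  have c0: "c = 0" if v: "v \<noteq> 0" "T v = c *s v" for v c
  proof (rule ccontr)
    assume "c \<noteq> 0"
    then obtain f where f: "rational_functional f" "f c = 1" using rational_functional_exists by blast
    obtain B d where B: "finite B" "v \<in> B" "d v = c"
      "tr (\<lambda>v. T (eig_map T f v)) = (\<Sum>b\<in>B. d b * f (d b))"
      using tr_eig_map[OF T ac v, of f] by blast
    define q where "q x = (SOME q. f x = of_rat q)" for x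
    have q: "f x = of_rat (q x)" for x
    proof -
      have "f x \<in> range of_rat" using f(1) unfolding rational_functional_def Rats_def by blast
      then have "\<exists>q. f x = of_rat q" by blast
      then show ?thesis unfolding q_def by (rule someI_ex)
    qed
    have "f (0 + 0) = f 0 + f 0" using f(1) unfolding rational_functional_def by blast
    then have "0 = f 0" by simp
    also have "\<dots> = f (\<Sum>b\<in>B. d b * f (d b))" using tr0[OF f(1)] B(4) by simp
    also have "\<dots> = (\<Sum>b\<in>B. f (d b * f (d b)))" by (rule rational_functional_sum[OF f(1)])
    also have "\<dots> = (\<Sum>b\<in>B. of_rat (q (d b) * q (d b)))"
    proof (rule sum.cong)
      fix b
      have "f (d b * f (d b)) = f (of_rat (q (d b)) * d b)" by (simp add: q mult.commute)
      also have "\<dots> = of_rat (q (d b)) * f (d b)" using f(1) unfolding rational_functional_def by blast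
      finally show "f (d b * f (d b)) = of_rat (q (d b) * q (d b))" by (simp add: q of_rat_mult)
    qed simp
    also have "\<dots> = of_rat (\<Sum>b\<in>B. q (d b) * q (d b))" by (simp add: of_rat_sum)
    finally have "(\<Sum>b\<in>B. q (d b) * q (d b)) = 0" by simp
    then have "q (d v) * q (d v) = 0" using sum_nonneg_eq_0_iff[OF B(1), of "\<lambda>b. q (d b) * q (d b)"] B(2) by simp
    then have "f c = 0" using B(3) q by simp
    then show False using f(2) by simp
  qed
  have g0: "v \<in> gen_eigenspace T 0" if v: "v \<in> gen_eigenspace T c" for v c
  proof (cases "v = 0")
    case True then show ?thesis using vec.subspace_0[OF subspace_gen_eigenspace[OF T]] by simp
  next
    case False
    have "((\<lambda>v. T v - c *s v) ^^ CARD('n)) v \<in> {0}" using v by (simp add: gen_eigenspace_iff[OF T])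
    then obtain j where "((\<lambda>v. T v - c *s v) ^^ j) v \<noteq> 0"
      "T (((\<lambda>v. T v - c *s v) ^^ j) v) - c *s (((\<lambda>v. T v - c *s v) ^^ j) v) = 0"
      using last_nonmember[of v "{0}" _ "\<lambda>v. T v - c *s v"] False by auto
    then have "c = 0" using c0 by simp
    then show ?thesis using v by simp
  qed
  have "v \<in> gen_eigenspace T 0"
    by (induction v rule: gen_induct[OF T ac])
      (auto intro: g0 vec.subspace_add[OF subspace_gen_eigenspace[OF T]])
  then show ?thesis by (simp add: gen_eigenspace_iff[OF T])
qed

section \<open>Engel's theorem\<close>

locale lie_alg =
  fixes br :: "('k::field_char_0,'n::finite) bracket"
  assumes lie: "lie_algebra br" and ac: "alg_closed TYPE('k)"
begin

lemma br_add_left: "br (x + y) z = br x z + br y z"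
  and br_add_right: "br x (y + z) = br x y + br x z"
  and br_scale_left: "br (c *s x) y = c *s br x y"
  and br_scale_right: "br x (c *s y) = c *s br x y"
  and br_self: "br x x = 0"
  using lie by (auto simp: lie_algebra_def)

lemma br_swap: "br y x = - br x y"
proof -
  have "br (x + y) (x + y) = 0" by (rule br_self)
  moreover have "br (x + y) (x + y) = br x x + br y x + (br x y + br y y)"
    by (simp only: br_add_left[of x y] br_add_right add_ac)
  ultimately have "br x y + br y x = 0" by (simp add: br_self add.commute)
  then show ?thesis by (simp add: eq_neg_iff_add_eq_0 add.commute)
qed

lemma lin_ad: "lin (br x)"
  by (rule linI) (simp_all add: br_add_right br_scale_right)

lemma lin_ad_left: "lin (\<lambda>x. br x y)"
  by (rule linI) (simp_all add: br_add_left br_scale_left)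

lemma br_0_left [simp]: "br 0 y = 0" and br_0_right [simp]: "br x 0 = 0"
  using lin_0[OF lin_ad] lin_0[OF lin_ad_left] by auto

lemma br_minus_left: "br (- x) y = - br x y" and br_minus_right: "br x (- y) = - br x y"
  using br_scale_left[of "-1" x y] br_scale_right[of x "-1" y] by simp_all

lemma br_diff_left: "br (x - y) z = br x z - br y z"
  and br_diff_right: "br x (y - z) = br x y - br x z"
  using lin_diff[OF lin_ad] lin_diff[OF lin_ad_left] by auto

lemma br_sum_left: "br (\<Sum>i\<in>I. g i) y = (\<Sum>i\<in>I. br (g i) y)"
  and br_sum_right: "br y (\<Sum>i\<in>I. g i) = (\<Sum>i\<in>I. br y (g i))"
  using lin_sum[OF lin_ad] lin_sum[OF lin_ad_left] by auto

lemma jacobi: "br x (br y z) = br (br x y) z + br y (br x z)"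
proof -
  have "br x (br y z) + br y (br z x) + br z (br x y) = 0" using lie by (auto simp: lie_algebra_def)
  moreover have "br y (br z x) = - br y (br x z)" by (subst br_swap[of z x]) (simp add: br_minus_right br_swap[of z x])
  moreover have "br z (br x y) = - br (br x y) z" by (rule br_swap)
  ultimately show ?thesis by (simp add: algebra_simps)
qed

lemma jacobi_left: "br (br x y) z = br x (br y z) - br y (br x z)"
  by (simp add: jacobi[of x y z])

lemma br_comm_0: "br x y = 0 \<longleftrightarrow> br y x = 0"
  using br_swap[of x y] by simp

lemma subalgebraD: "subalgebra br S \<Longrightarrow> vec.subspace S" "subalgebra br S \<Longrightarrow> x \<in> S \<Longrightarrow> y \<in> S \<Longrightarrow> br x y \<in> S"
  by (auto simp: subalgebra_def)

text \<open>The pair \<open>A\<close>, \<open>B\<close> stands for the module \<open>A/(A \<inter> B)\<close>.\<close>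

lemma engel:
  assumes S: "subalgebra br S" and A: "vec.subspace A" "\<forall>x\<in>S. \<forall>a\<in>A. br x a \<in> A"
    and B: "vec.subspace B" "\<forall>x\<in>S. \<forall>b\<in>B. br x b \<in> B" and AB: "\<not> A \<subseteq> B"
    and nil: "\<forall>x\<in>S. \<forall>v\<in>A \<union> S. (br x ^^ N) v = 0"
  shows "\<exists>a\<in>A. a \<notin> B \<and> (\<forall>x\<in>S. br x a \<in> B)"
  using assms
proof (induction "vec.dim S" arbitrary: S A B rule: less_induct)
  case less
  note S = less.prems(1) and A = less.prems(2,3) and B = less.prems(4,5) and AB = less.prems(6) and nil = less.prems(7)
  show ?case
  proof (cases "S = {0}")
    case True
    obtain a where "a \<in> A" "a \<notin> B" using AB by blast
    then show ?thesis using True vec.subspace_0[OF B(1)] by auto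
  next
    case False
    let ?P = "\<lambda>M. subalgebra br M \<and> M \<subset> S"
    have P0: "?P {0}" using False vec.subspace_0[OF subalgebraD(1)[OF S]] by (auto simp: subalgebra_def)
    obtain M where max: "?P M \<and> (\<forall>M'. ?P M' \<longrightarrow> vec.dim M' \<le> vec.dim M)"
      using ex_max_dim[of ?P, OF P0] ..
    have M: "subalgebra br M" "M \<subset> S" using max by (blast, blast)
    have Mmax: "\<forall>M'. ?P M' \<longrightarrow> vec.dim M' \<le> vec.dim M" by (rule conjunct2[OF max])
    have sS: "vec.subspace S" and sM: "vec.subspace M" using S M(1) by (auto simp: subalgebra_def)
    have dim: "vec.dim M < vec.dim S"
      using M(2) sS sM by (metis psubsetE vec.dim_subset vec.subspace_dim_equal le_neq_implies_less order_refl)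
    have MS: "x \<in> S" if "x \<in> M" for x using M(2) that by blast
    \<comment> \<open>Induction for M acting on S/M yields y normalizing M; by maximality M is then
      an ideal of codimension one.\<close>
    have "\<exists>y\<in>S. y \<notin> M \<and> (\<forall>x\<in>M. br x y \<in> M)"
      by (rule less.hyps[OF dim M(1) sS _ sM])
        (use M nil MS subalgebraD(2)[OF S] subalgebraD(2)[OF M(1)] in auto)
    then obtain y where y: "y \<in> S" "y \<notin> M" "\<And>x. x \<in> M \<Longrightarrow> br x y \<in> M" by blast
    have y': "br y x \<in> M" if "x \<in> M" for x
      using vec.subspace_neg[OF sM y(3)[OF that]] br_swap[of y x] by simp
    let ?M' = "vec.span (insert y M)"
    have mem: "x \<in> ?M' \<longleftrightarrow> (\<exists>k. \<exists>m\<in>M. x = m + k *s y)" for x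
    proof -
      have "x \<in> ?M' \<longleftrightarrow> (\<exists>k. x - k *s y \<in> M)"
        using sM by (simp add: vec.span_breakdown_eq vec.span_eq_iff[THEN iffD2, OF sM])
      then show ?thesis by (metis add_diff_cancel diff_add_cancel)
    qed
    have "br x z \<in> ?M'" if xz: "x \<in> ?M'" "z \<in> ?M'" for x z
    proof -
      obtain k m k' m' where e: "x = m + k *s y" "z = m' + k' *s y" "m \<in> M" "m' \<in> M"
        using xz mem by metis
      have "br x z = br m m' + k' *s br m y + k *s br y m'"
        by (simp add: e br_add_left br_add_right br_scale_left br_scale_right br_self)
      also have "\<dots> \<in> M" using e y(3) y' subalgebraD(2)[OF M(1)]
        by (intro vec.subspace_add[OF sM] vec.subspace_scale[OF sM]) auto
      finally show ?thesis by (simp add: vec.span_base)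
    qed
    then have sub: "subalgebra br ?M'" by (simp add: subalgebra_def)
    have M'S: "?M' \<subseteq> S" by (rule vec.span_minimal) (use y(1) MS sS in auto)
    have "?M' = S"
    proof (rule ccontr)
      assume "?M' \<noteq> S"
      then have "vec.dim ?M' \<le> vec.dim M" using Mmax sub M'S by blast
      then have "?M' = M" using vec.subspace_dim_equal[OF sM vec.subspace_span] vec.span_superset[of "insert y M"] by blast
      then show False using y(2) vec.span_base by blast
    qed
    \<comment> \<open>Induction for M acting on A/B shows that \<open>C\<close> is not inside B. As
      y normalizes M it preserves \<open>C\<close>, and being nilpotent it maps some vector of
      \<open>C\<close> outside B into B.\<close>
    define C where "C = {a \<in> A. \<forall>x\<in>M. br x a \<in> B}"
    have "\<exists>c\<in>A. c \<notin> B \<and> (\<forall>x\<in>M. br x c \<in> B)"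
      by (rule less.hyps[OF dim M(1) A(1) _ B(1) _ AB]) (use A(2) B(2) MS nil in auto)
    then obtain c where c: "c \<in> C" "c \<notin> B" unfolding C_def by blast
    have yC: "br y a \<in> C" if "a \<in> C" for a
    proof -
      have "br x (br y a) \<in> B" if x: "x \<in> M" for x
      proof -
        have "br x (br y a) = br (br x y) a + br y (br x a)" by (rule jacobi)
        then show ?thesis using \<open>a \<in> C\<close> y(3)[OF x] x B y(1) unfolding C_def
          by (auto intro!: vec.subspace_add[OF B(1)])
      qed
      then show ?thesis using that A(2) y(1) unfolding C_def by blast
    qed
    have powC: "(br y ^^ j) c \<in> C" for j by (induction j) (auto intro: yC c)
    have "(br y ^^ N) c \<in> B" using nil y(1) c(1) vec.subspace_0[OF B(1)] unfolding C_def by auto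
    then obtain j where j: "(br y ^^ j) c \<notin> B" "br y ((br y ^^ j) c) \<in> B" using last_nonmember[OF c(2)] by blast
    let ?a = "(br y ^^ j) c"
    have "br x ?a \<in> B" if "x \<in> S" for x
    proof -
      obtain k m where "x = m + k *s y" "m \<in> M" using mem \<open>?M' = S\<close> \<open>x \<in> S\<close> by blast
      moreover have "br m ?a \<in> B" using powC[of j] \<open>m \<in> M\<close> unfolding C_def by blast
      ultimately show ?thesis using j(2)
        by (auto simp: br_add_left br_scale_left intro!: vec.subspace_add[OF B(1)] vec.subspace_scale[OF B(1)])
    qed
    then show ?thesis using powC[of j] j(1) unfolding C_def by blast
  qed
qed

section \<open>Generalized eigenspaces of inner derivations\<close>

abbreviation gen :: "'k^'n \<Rightarrow> 'k \<Rightarrow> ('k^'n) set" where "gen x c \<equiv> gen_eigenspace (br x) c"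

abbreviation proj :: "'k^'n \<Rightarrow> 'k \<Rightarrow> 'k^'n \<Rightarrow> 'k^'n" where "proj x \<equiv> gen_proj (br x)"

lemmas gen_subspace = subspace_gen_eigenspace[OF lin_ad] and gen_finite = finite_gen_spectrum[OF lin_ad]
  and gen_power = gen_eigenspace_iff[OF lin_ad] and gen_eigenvector = eigenvector_in_gen[OF lin_ad]
  and gen_invariant = gen_eigenspace_invariant[OF lin_ad] and lin_ad_pow = lin_funpow[OF lin_ad]
  and proj_mem = gen_proj_mem[OF lin_ad ac] and proj_gen = gen_proj_same[OF lin_ad ac]
  and lin_proj = lin_gen_proj[OF lin_ad ac] and proj_invariant = gen_proj_in_invariant[OF lin_ad ac]
  and proj_sum = gen_proj_sum[OF lin_ad ac] and eigder_gen = eig_map_gen[OF lin_ad ac]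

text \<open>ad x - (c + d) obeys a Leibniz rule with ad x - c on the first argument and ad x - d on
  the second; induction on the sum of the two nilpotency exponents.\<close>

lemma br_gen:
  assumes u: "u \<in> gen x c" and v: "v \<in> gen x d"
  shows "br u v \<in> gen x (c + d)"
proof -
  let ?s = "\<lambda>c v. br x v - c *s v"
  have s: "?s (c + d) (br u v) = br (?s c u) v + br u (?s d v)" for u v
    by (simp add: jacobi[of x u v] br_diff_left br_diff_right br_scale_left br_scale_right vec.scale_left_distrib)
  have sub: "vec.subspace (gen x (c + d))" by (rule gen_subspace)
  have "br u v \<in> gen x (c + d)" if "(?s c ^^ k) u = 0" "(?s d ^^ l) v = 0" for k l u v
    using that
  proof (induction "k + l" arbitrary: k l u v rule: less_induct)
    case less
    show ?case
    proof (cases k)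
      case 0 then show ?thesis using less.prems vec.subspace_0[OF sub] by simp
    next
      case (Suc k')
      show ?thesis
      proof (cases l)
        case 0 then show ?thesis using less.prems vec.subspace_0[OF sub] by simp
      next
        case (Suc l')
        have "(?s c ^^ k') (?s c u) = 0" using less.prems(1) unfolding \<open>k = Suc k'\<close> funpow_Suc_right comp_apply .
        then have 1: "br (?s c u) v \<in> gen x (c + d)"
          using less.hyps[of k' l "?s c u" v] less.prems \<open>k = Suc k'\<close> by simp
        have "(?s d ^^ l') (?s d v) = 0" using less.prems(2) unfolding Suc funpow_Suc_right comp_apply .
        then have 2: "br u (?s d v) \<in> gen x (c + d)"
          using less.hyps[of k l' u "?s d v"] less.prems Suc by simp
        have "?s (c + d) (br u v) \<in> gen x (c + d)" unfolding s by (rule vec.subspace_add[OF sub 1 2])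
        then obtain m where "(?s (c + d) ^^ m) (?s (c + d) (br u v)) = 0" unfolding gen_eigenspace_def by blast
        then have "(?s (c + d) ^^ Suc m) (br u v) = 0" unfolding funpow_Suc_right comp_apply .
        then show ?thesis unfolding gen_eigenspace_def by blast
      qed
    qed
  qed
  then show ?thesis using u v unfolding gen_eigenspace_def by blast
qed

definition derivation :: "('k^'n \<Rightarrow> 'k^'n) \<Rightarrow> bool" where
  "derivation D \<longleftrightarrow> lin D \<and> (\<forall>x y. D (br x y) = br (D x) y + br x (D y))"

abbreviation eigder :: "'k^'n \<Rightarrow> ('k \<Rightarrow> 'k) \<Rightarrow> 'k^'n \<Rightarrow> 'k^'n" where
  "eigder x \<equiv> eig_map (br x)"

text \<open>Brackets add eigenvalues, so on generalized eigenvectors the Leibniz rule is the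
  additivity of \<open>f\<close>.\<close>

lemma derivation_eigder:
  assumes f: "\<And>a b. f (a + b) = f a + f b"
  shows "derivation (eigder x f)"
proof -
  let ?D = "eigder x f"
  have D: "lin ?D" by (rule lin_eig_map[OF lin_ad ac])
  have "?D (br u v) = br (?D u) v + br u (?D v)" for u v
  proof (induction u rule: gen_induct[OF lin_ad[of x] ac])
    case (1 c u)
    show ?case
    proof (induction v rule: gen_induct[OF lin_ad[of x] ac])
      case (1 d v)
      have e: "?D w = f a *s w" if "w \<in> gen x a" for w a by (rule eigder_gen[OF that])
      show ?case
        using e[OF br_gen[OF \<open>u \<in> gen x c\<close> 1]] e[OF \<open>u \<in> gen x c\<close>] e[OF 1]
        by (simp add: f br_scale_left br_scale_right vec.scale_left_distrib)
    next
      case (2 v w)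
      then show ?case by (simp add: br_add_right lin_add[OF D])
    qed
  next
    case (2 u w)
    then show ?case by (simp add: br_add_left lin_add[OF D])
  qed
  then show ?thesis using D by (simp add: derivation_def)
qed

section \<open>The Killing form\<close>

definition kap :: "'k^'n \<Rightarrow> 'k^'n \<Rightarrow> 'k" where
  "kap x y = tr (\<lambda>v. br x (br y v))"

lemma kap_sym: "kap x y = kap y x"
  unfolding kap_def by (rule tr_commute[OF lin_ad lin_ad])

lemma kap_add_left: "kap (x + y) z = kap x z + kap y z"
  and kap_scale_left: "kap (c *s x) z = c * kap x z"
  by (simp_all add: kap_def br_add_left br_scale_left tr_add tr_scale)

lemma kap_add_right: "kap z (x + y) = kap z x + kap z y"
  and kap_scale_right: "kap z (c *s x) = c * kap z x"
  using kap_add_left kap_scale_left by (simp_all add: kap_sym[of z])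

lemma kap_0_left [simp]: "kap 0 x = 0" and kap_0_right [simp]: "kap x 0 = 0"
  using kap_scale_left[of 0 0 x] kap_scale_right[of x 0 0] by auto

lemma kap_minus_left: "kap (- x) z = - kap x z" and kap_minus_right: "kap x (- z) = - kap x z"
  using kap_scale_left[of "-1" x z] kap_scale_right[of x "-1" z] by simp_all

lemma kap_sum_right: "kap x (sum g I) = (\<Sum>i\<in>I. kap x (g i))"
  by (induction I rule: infinite_finite_induct) (auto simp: kap_add_right)

text \<open>By cyclicity the left side is tr(ad a (ad b D - D ad b)), and ad b D - D ad b = - ad (D
  b). For inner D this is invariance of the Killing form; for D = \<open>eigder x f\<close> it feeds
  the trace criterion.\<close>

lemma tr_derivation:
  assumes D: "derivation D"
  shows "tr (\<lambda>v. br (br a b) (D v)) = - kap a (D b)"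
proof -
  have l: "lin D" and d: "D (br x y) = br (D x) y + br x (D y)" for x y using D by (auto simp: derivation_def)
  have "tr (\<lambda>v. br (br a b) (D v)) = tr (\<lambda>v. br a (br b (D v)) - br b (br a (D v)))"
    by (simp add: jacobi_left)
  also have "\<dots> = tr (\<lambda>v. br a (br b (D v))) - tr (\<lambda>v. br b (br a (D v)))" by (rule tr_diff)
  also have "tr (\<lambda>v. br b (br a (D v))) = tr (\<lambda>v. br a (D (br b v)))"
    by (rule tr_commute[OF lin_ad lin_compose[OF lin_ad l]])
  also have "\<dots> = tr (\<lambda>v. br a (br (D b) v) + br a (br b (D v)))" by (simp add: d br_add_right)
  also have "\<dots> = kap a (D b) + tr (\<lambda>v. br a (br b (D v)))" by (simp add: tr_add kap_def)
  finally show ?thesis by simp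
qed

lemma derivation_ad: "derivation (br x)"
  by (simp add: derivation_def lin_ad jacobi[of x])

lemma kap_invariant: "kap (br a b) c = kap a (br b c)"
  using tr_derivation[OF derivation_ad, of a b c]
  by (simp add: kap_def[of "br a b"] br_swap[of b c] kap_minus_right)

definition ad_nil :: "'k^'n \<Rightarrow> bool" where
  "ad_nil x \<longleftrightarrow> (\<forall>v. (br x ^^ CARD('n)) v = 0)"

text \<open>ad n and ad y commute, so powers of their product split and the product is
  nilpotent.\<close>

lemma kap_commuting_nil:
  assumes n: "ad_nil n" and c: "br n y = 0"
  shows "kap n y = 0"
proof -
  have comm: "br n (br y v) = br y (br n v)" for v using jacobi[of n y v] c by simp
  have comm': "br n ((br y ^^ k) v) = (br y ^^ k) (br n v)" for k v
    by (induction k) (auto simp: comm)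
  have "((\<lambda>v. br n (br y v)) ^^ k) v = (br y ^^ k) ((br n ^^ k) v)" for k v
    by (induction k) (auto simp: comm comm')
  then have nil: "((\<lambda>v. br n (br y v)) ^^ CARD('n)) v = 0" for v
    using n by (simp add: ad_nil_def lin_0[OF lin_ad_pow])
  show ?thesis unfolding kap_def by (rule tr_nilpotent[OF lin_compose[OF lin_ad lin_ad] nil])
qed

lemma ad_nil_if_tr_zero:
  assumes "\<And>f. rational_functional f \<Longrightarrow> tr (\<lambda>v. br x (eigder x f v)) = 0"
  shows "ad_nil x"
  unfolding ad_nil_def using nilpotent_if_tr_eig_map_zero[OF lin_ad ac] assms by blast

text \<open>The form is that of the whole algebra restricted to \<open>M\<close>, not the Killing
  form of \<open>M\<close> itself.\<close>

definition nondeg_on :: "('k^'n) set \<Rightarrow> bool" where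
  "nondeg_on M \<longleftrightarrow> (\<forall>x\<in>M. (\<forall>y\<in>M. kap x y = 0) \<longrightarrow> x = 0)"

lemma subspace_kap_perp: "vec.subspace {x. \<forall>y\<in>Y. kap x y = 0}"
  by (rule vec.subspaceI) (auto simp: kap_add_left kap_scale_left)

lemma kap_span_zero:
  assumes "\<And>x. x \<in> S \<Longrightarrow> kap x z = 0" "v \<in> vec.span S"
  shows "kap v z = 0"
  using vec.span_minimal[of S "{x. \<forall>y\<in>{z}. kap x y = 0}"] subspace_kap_perp[of "{z}"] assms by blast

end

context lie_alg begin

section \<open>Derived series and Cartan's criterion\<close>

abbreviation brackets :: "('k^'n) set \<Rightarrow> ('k^'n) set \<Rightarrow> ('k^'n) set" where
  "brackets A B \<equiv> {br x y | x y. x \<in> A \<and> y \<in> B}"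

lemma lie_ideal_brackets:
  assumes I: "lie_ideal br L I"
  shows "lie_ideal br L (vec.span (brackets I I))" (is "lie_ideal br L (vec.span ?G)")
proof -
  have sI: "vec.subspace I" and IL: "I \<subseteq> L" and inv: "\<And>x y. x \<in> L \<Longrightarrow> y \<in> I \<Longrightarrow> br x y \<in> I"
    using I by (auto simp: lie_ideal_def)
  have GI: "vec.span ?G \<subseteq> I" by (rule vec.span_minimal[OF _ sI]) (use inv IL in blast)
  have "br z w \<in> vec.span ?G" if z: "z \<in> L" and w: "w \<in> vec.span ?G" for z w
  proof (rule lin_span_mem[OF lin_ad vec.subspace_span _ w])
    fix w assume "w \<in> ?G"
    then obtain x y where xy: "w = br x y" "x \<in> I" "y \<in> I" by blast
    have "br (br z x) y \<in> ?G" "br x (br z y) \<in> ?G" using xy inv[OF z] by blast+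
    then show "br z w \<in> vec.span ?G" unfolding xy(1) jacobi[of z x y] by (intro vec.span_add vec.span_base)
  qed
  then show ?thesis using GI IL by (auto simp: lie_ideal_def)
qed

lemma lie_ideal_derived_series: "lie_ideal br L I \<Longrightarrow> lie_ideal br L (derived_series br I k)"
  by (induction k) (auto intro: lie_ideal_brackets)

lemma lie_ideal_self: "subalgebra br L \<Longrightarrow> lie_ideal br L L"
  by (auto simp: lie_ideal_def subalgebra_def)

lemma lie_ideal_subalgebra: "lie_ideal br L I \<Longrightarrow> subalgebra br I"
  by (auto simp: lie_ideal_def subalgebra_def)

lemma derived_series_Suc_subset: "lie_ideal br L I \<Longrightarrow> derived_series br I (Suc k) \<subseteq> derived_series br I k"
proof -
  assume "lie_ideal br L I"
  then have "subalgebra br (derived_series br I k)"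
    using lie_ideal_derived_series lie_ideal_subalgebra by blast
  then have s: "vec.subspace (derived_series br I k)"
    "\<And>x y. x \<in> derived_series br I k \<Longrightarrow> y \<in> derived_series br I k \<Longrightarrow> br x y \<in> derived_series br I k"
    by (auto simp: subalgebra_def)
  show ?thesis unfolding derived_series.simps by (rule vec.span_minimal[OF _ s(1)]) (use s(2) in blast)
qed

lemma derived_series_subset1: "lie_ideal br L I \<Longrightarrow> derived_series br I (Suc k) \<subseteq> derived_series br I 1"
proof (induction k)
  case (Suc k)
  then show ?case using derived_series_Suc_subset[of L I "Suc k"] by blast
qed simp

text \<open>For a maximal proper submodule M of A, Engel's theorem gives a outside M with [S, a] in
  M. By maximality A is spanned by M and a, so [S, A] lies in M, against
  \<open>perf\<close>.\<close>

lemma engel_perfect: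
  assumes S: "subalgebra br S" and A: "vec.subspace A" "\<forall>x\<in>S. \<forall>a\<in>A. br x a \<in> A"
    and nil: "\<forall>x\<in>S. \<forall>v\<in>A \<union> S. (br x ^^ N) v = 0"
    and perf: "A \<subseteq> vec.span (brackets S A)"
  shows "A = {0}"
proof (rule ccontr)
  assume ne: "A \<noteq> {0}"
  let ?P = "\<lambda>M. vec.subspace M \<and> (\<forall>x\<in>S. \<forall>a\<in>M. br x a \<in> M) \<and> M \<subset> A"
  have P0: "?P {0}" using ne vec.subspace_0[OF A(1)] by auto
  obtain M where max: "?P M \<and> (\<forall>M'. ?P M' \<longrightarrow> vec.dim M' \<le> vec.dim M)"
    using ex_max_dim[of ?P, OF P0] ..
  have M: "?P M" by (rule conjunct1[OF max])
  have Mmax: "\<forall>M'. ?P M' \<longrightarrow> vec.dim M' \<le> vec.dim M" by (rule conjunct2[OF max])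
  have sM: "vec.subspace M" using M by blast
  have "\<exists>a\<in>A. a \<notin> M \<and> (\<forall>x\<in>S. br x a \<in> M)"
    by (rule engel[OF S A sM _ _ nil]) (use M in auto)
  then obtain a where a: "a \<in> A" "a \<notin> M" "\<forall>x\<in>S. br x a \<in> M" by blast
  let ?M' = "vec.span (insert a M)"
  have brM: "br x v \<in> M" if xS: "x \<in> S" and vM: "v \<in> ?M'" for x v
  proof -
    obtain k where k: "v - k *s a \<in> M" using vM sM
      by (auto simp: vec.span_breakdown_eq vec.span_eq_iff[THEN iffD2, OF sM])
    then have "br x (v - k *s a) + k *s br x a \<in> M"
      using a(3) M xS by (intro vec.subspace_add[OF sM] vec.subspace_scale[OF sM]) auto
    then show ?thesis by (simp add: br_diff_right br_scale_right)
  qed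
  have M'A: "?M' \<subseteq> A" by (rule vec.span_minimal[OF _ A(1)]) (use a M in auto)
  have MM': "M \<subseteq> ?M'" using vec.span_superset by blast
  have "?M' = A"
  proof (rule ccontr)
    assume "?M' \<noteq> A"
    then have "?P ?M'" using brM MM' M'A by auto
    then have "vec.dim ?M' \<le> vec.dim M" using Mmax by blast
    then have "M = ?M'" by (intro vec.subspace_dim_equal[OF sM vec.subspace_span MM'])
    then show False using a(2) vec.span_base[of a "insert a M"] by simp
  qed
  then have "vec.span (brackets S A) \<subseteq> M"
    by (intro vec.span_minimal[OF _ sM]) (use brM in blast)
  then show False using perf M by blast
qed

lemma lie_ideal_kap_radical: "lie_ideal br UNIV {x. \<forall>y. kap x y = 0}"
proof -
  have "kap (br x z) y = 0" if "\<forall>y. kap z y = 0" for x y z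
  proof -
    have "kap (br x z) y = - kap (br z x) y" by (subst br_swap) (rule kap_minus_left)
    then show ?thesis using that by (simp add: kap_invariant)
  qed
  then show ?thesis using subspace_kap_perp[of UNIV] by (auto simp: lie_ideal_def)
qed

text \<open>Cartan's criterion. A perfect term P of the derived series consists of nilpotent
  elements: for [a, b] in P the trace against D = \<open>eigder x f\<close> is -kap(a, D b), which
  is 0 because a is in the radical. Then \<open>engel_perfect\<close> gives P = 0.\<close>

lemma kap_radical_solvable: "solvable_lie br {x. \<forall>y. kap x y = 0}" (is "solvable_lie br ?R")
proof -
  have R: "lie_ideal br UNIV ?R" by (rule lie_ideal_kap_radical)
  let ?D = "derived_series br ?R"
  \<comment> \<open>A term of least dimension coincides with its successor.\<close>
  obtain k where k: "\<And>j. vec.dim (?D k) \<le> vec.dim (?D j)"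
    using ex_has_least_nat[of "\<lambda>_. True" 0 "\<lambda>k. vec.dim (?D k)"] by blast
  define P where "P = ?D k"
  have P: "lie_ideal br UNIV P" unfolding P_def by (rule lie_ideal_derived_series[OF R])
  have sP: "vec.subspace P" using P by (simp add: lie_ideal_def)
  have perf: "vec.span (brackets P P) = P"
    unfolding P_def derived_series.simps(2)[symmetric]
    by (rule vec.subspace_dim_equal[OF _ _ derived_series_Suc_subset[OF R] k])
      (use lie_ideal_derived_series[OF R] in \<open>auto simp: lie_ideal_def\<close>)
  have PR: "P \<subseteq> ?R" unfolding P_def
    by (induction k) (use derived_series_Suc_subset[OF R] in \<open>auto simp del: derived_series.simps(2)\<close>)
  have nil: "ad_nil x" if "x \<in> P" for x
  proof (rule ad_nil_if_tr_zero)
    fix f :: "'k \<Rightarrow> 'k" assume f: "rational_functional f"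
    have D: "derivation (eigder x f)" by (rule derivation_eigder) (use f in \<open>auto simp: rational_functional_def\<close>)
    have "tr (\<lambda>v. br w (eigder x f v)) = 0" if "w \<in> vec.span (brackets P P)" for w
      using that
    proof (induction w rule: vec.span_induct)
      case base
      show ?case by (rule vec.subspaceI) (auto simp: br_add_left br_scale_left tr_add tr_scale tr_0)
    next
      case (step w)
      then obtain a b where ab: "w = br a b" "a \<in> P" by blast
      then show ?case using PR by (auto simp: tr_derivation[OF D])
    qed
    then show "tr (\<lambda>v. br x (eigder x f v)) = 0" using that perf by blast
  qed
  have "P = {0}"
    by (rule engel_perfect[where N = "CARD('n)", OF lie_ideal_subalgebra[OF P] sP])
      (use nil perf lie_ideal_subalgebra[OF P] in \<open>auto simp: ad_nil_def subalgebra_def\<close>)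
  then show ?thesis unfolding solvable_lie_def P_def by blast
qed

end

locale semisimple_alg = lie_alg br for br :: "('k::field_char_0,'n::finite) bracket" +
  assumes ss: "semisimple_lie br UNIV"
begin

section \<open>Functionals and derivations represented by elements\<close>

lemma kap_nondeg: "(\<And>y. kap x y = 0) \<Longrightarrow> x = 0"
proof -
  assume x: "\<And>y. kap x y = 0"
  have "{x. \<forall>y. kap x y = 0} = {0}"
    using ss lie_ideal_kap_radical kap_radical_solvable unfolding semisimple_lie_def by blast
  then show ?thesis using x by blast
qed

lemma center_trivial: "(\<And>y. br x y = 0) \<Longrightarrow> x = 0"
  by (rule kap_nondeg) (simp add: kap_def tr_0)

lemma kap_represents:
  assumes add: "\<And>x y. \<phi> (x + y) = \<phi> x + \<phi> y" and scale: "\<And>c x. \<phi> (c *s x) = c * \<phi> x"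
  shows "\<exists>z. \<forall>y. \<phi> y = kap z y"
proof -
  define F where "F z = (\<chi> i. kap z (axis i 1))" for z
  have F: "lin F" by (rule linI) (auto simp: F_def vec_eq_iff kap_add_left kap_scale_left)
  have ex: "y = (\<Sum>i\<in>UNIV. y $ i *s axis i 1)" for y :: "'k^'n" by (simp add: basis_expansion)
  have kF: "kap z y = (\<Sum>i\<in>UNIV. y $ i * F z $ i)" for z y
    by (subst ex[of y]) (simp add: kap_sum_right kap_scale_right F_def)
  have "inj F"
    unfolding vec.linear_inj_iff_eq_0[OF F] by (auto intro!: kap_nondeg simp: kF)
  then have "surj F" using vec.linear_inj_imp_surj[OF F] by blast
  then obtain z where z: "F z = (\<chi> i. \<phi> (axis i 1))" by (metis surjD)
  have "\<phi> y = kap z y" for y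
  proof -
    have \<phi>0: "\<phi> 0 = 0" using scale[of 0 0] by simp
    have "\<phi> (\<Sum>i\<in>I. g i) = (\<Sum>i\<in>I. \<phi> (g i))" for g :: "'n \<Rightarrow> 'k^'n" and I
      by (induction I rule: infinite_finite_induct) (auto simp: add \<phi>0)
    then have "\<phi> y = (\<Sum>i\<in>UNIV. y $ i * \<phi> (axis i 1))" by (subst ex[of y]) (simp add: scale)
    then show ?thesis by (simp add: kF z)
  qed
  then show ?thesis by blast
qed

text \<open>If z represents the functional sending y to tr(ad y D), then D' = D - ad z has tr(ad y
  D') = 0 for all y, and \<open>tr_derivation\<close> makes every D' b orthogonal to the whole
  algebra.\<close>

lemma derivation_inner:
  assumes D: "derivation D"
  shows "\<exists>z. \<forall>v. D v = br z v"
proof -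
  have l: "lin D" and d: "\<And>x y. D (br x y) = br (D x) y + br x (D y)" using D by (auto simp: derivation_def)
  obtain z where z: "\<And>y. tr (\<lambda>v. br y (D v)) = kap z y"
    using kap_represents[of "\<lambda>y. tr (\<lambda>v. br y (D v))"]
    by (auto simp: br_add_left br_scale_left tr_add tr_scale)
  define D' where "D' v = D v - br z v" for v
  have D': "derivation D'"
    unfolding derivation_def D'_def
    by (auto intro!: linI simp: lin_add[OF l] lin_scale[OF l] br_add_right br_scale_right d jacobi[of z]
        br_diff_left br_diff_right vec.scale_right_diff_distrib algebra_simps)
  have tr0: "tr (\<lambda>v. br y (D' v)) = 0" for y
  proof -
    have "tr (\<lambda>v. br y (D' v)) = tr (\<lambda>v. br y (D v)) - kap y z"
      by (simp add: D'_def br_diff_right tr_diff kap_def)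
    then show ?thesis by (simp add: z kap_sym)
  qed
  have "kap a (D' b) = 0" for a b using tr_derivation[OF D', of a b] tr0 by simp
  then have "D' b = 0" for b by (intro kap_nondeg) (simp add: kap_sym)
  then show ?thesis by (auto simp: D'_def)
qed

section \<open>Jordan decomposition\<close>

definition eigpart :: "'k^'n \<Rightarrow> ('k \<Rightarrow> 'k) \<Rightarrow> 'k^'n" where
  "eigpart x f = (SOME z. \<forall>v. eigder x f v = br z v)"

lemma br_eigpart:
  assumes "\<And>a b. f (a + b) = f a + f b"
  shows "br (eigpart x f) v = eigder x f v"
proof -
  have "\<forall>v. eigder x f v = br (eigpart x f) v"
    unfolding eigpart_def by (rule someI_ex) (rule derivation_inner[OF derivation_eigder[OF assms]])
  then show ?thesis by simp
qed

lemma rational_functional_add: "rational_functional f \<Longrightarrow> f (a + b) = f a + f b"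
  unfolding rational_functional_def by blast

text \<open>ad y preserves the generalized eigenspaces of ad x, on which \<open>eigder x f\<close>
  is scalar, so the two maps commute; the center is trivial.\<close>

lemma eigpart_commute:
  assumes f: "\<And>a b. f (a + b) = f a + f b" and y: "br y x = 0"
  shows "br y (eigpart x f) = 0"
proof (rule center_trivial)
  fix v
  let ?D = "eigder x f"
  have D: "lin ?D" by (rule lin_eig_map[OF lin_ad ac])
  have comm: "br y (br x u) = br x (br y u)" for u using jacobi[of y x u] y by simp
  have "?D (br y v) = br y (?D v)"
  proof (induction v rule: gen_induct[OF lin_ad[of x] ac])
    case (1 c v)
    have g: "br y v \<in> gen x c" by (rule gen_eigenspace_commute[OF lin_ad lin_ad comm 1])
    show ?case
      by (simp only: eigder_gen[OF g] eigder_gen[OF 1] br_scale_right)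
  next
    case (2 v w) then show ?case by (simp add: br_add_right lin_add[OF D])
  qed
  then show "br (br y (eigpart x f)) v = 0" by (simp add: jacobi_left br_eigpart[OF f])
qed

text \<open>Semisimplicity as equality of generalized and ordinary eigenspaces;
  \<open>diag_iff_semisimple\<close> is the link with the spanning condition.\<close>

definition diag :: "'k^'n \<Rightarrow> bool" where
  "diag x \<longleftrightarrow> (\<forall>c v. v \<in> gen x c \<longrightarrow> br x v = c *s v)"

lemma diag_gen: "diag x \<Longrightarrow> v \<in> gen x c \<longleftrightarrow> br x v = c *s v"
  unfolding diag_def using gen_eigenvector[of x v c] by blast

lemma diag_iff_semisimple: "diag x \<longleftrightarrow> semisimple_elt br UNIV x"
proof
  assume x: "diag x"
  have "v \<in> vec.span {v. \<exists>c. br x v = c *s v}" for v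
  proof (induction v rule: gen_induct[OF lin_ad[of x] ac])
    case (1 c v)
    then have "v \<in> {v. \<exists>c. br x v = c *s v}" using diag_gen[OF x] by blast
    then show ?case by (rule vec.span_base)
  qed (rule vec.span_add)
  then show "semisimple_elt br UNIV x" by (auto simp: semisimple_elt_def)
next
  assume "semisimple_elt br UNIV x"
  then have sp: "v \<in> vec.span {v. \<exists>c. br x v = c *s v}" for v by (auto simp: semisimple_elt_def)
  have P: "br x (proj x c v) = c *s proj x c v" for c v
    using sp[of v]
  proof (induction v rule: vec.span_induct)
    case base
    show ?case
      by (rule vec.subspaceI)
        (auto simp: lin_0[OF lin_proj] lin_add[OF lin_proj]
          lin_scale[OF lin_proj] br_add_right br_scale_right vec.scale_right_distrib
          vector_smult_assoc mult.commute)
  next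
    case (step v)
    then obtain d where d: "br x v = d *s v" by blast
    show ?case using proj_gen[OF gen_eigenvector[OF d], of c] d by simp
  qed
  show "diag x" unfolding diag_def using P proj_gen by metis
qed

lemma diagI:
  assumes "\<And>v. v \<in> vec.span {v. \<exists>c. br x v = c *s v}"
  shows "diag x"
  unfolding diag_iff_semisimple semisimple_elt_def using assms by auto

definition spart :: "'k^'n \<Rightarrow> 'k^'n" where "spart x = eigpart x (\<lambda>c. c)"

lemma spart_gen: "v \<in> gen x c \<Longrightarrow> br (spart x) v = c *s v"
  by (simp add: spart_def br_eigpart eigder_gen)

lemma spart_commute: "br y x = 0 \<Longrightarrow> br y (spart x) = 0"
  unfolding spart_def by (rule eigpart_commute) auto

lemma diag_spart: "diag (spart x)"
proof (rule diagI)
  fix v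
  show "v \<in> vec.span {v. \<exists>c. br (spart x) v = c *s v}"
  proof (induction v rule: gen_induct[OF lin_ad[of x] ac])
    case (1 c v)
    then have "v \<in> {v. \<exists>c. br (spart x) v = c *s v}" using spart_gen by blast
    then show ?case by (rule vec.span_base)
  qed (rule vec.span_add)
qed

text \<open>On the generalized eigenspace of c this element acts as ad x - c.\<close>

lemma ad_nil_npart: "ad_nil (x - spart x)"
proof -
  have "(br (x - spart x) ^^ CARD('n)) v = 0" for v
  proof (induction v rule: gen_induct[OF lin_ad[of x] ac])
    case (1 c v)
    have "(br (x - spart x) ^^ k) v = ((\<lambda>v. br x v - c *s v) ^^ k) v \<and>
        ((\<lambda>v. br x v - c *s v) ^^ k) v \<in> gen x c" for k
    proof (induction k)
      case (Suc k)
      let ?w = "((\<lambda>v. br x v - c *s v) ^^ k) v"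
      have w: "?w \<in> gen x c" using Suc by blast
      have "br x ?w - c *s ?w \<in> gen x c"
        by (intro vec.subspace_diff[OF gen_subspace]
            vec.subspace_scale[OF gen_subspace] w gen_invariant)
      then show ?case using Suc by (simp add: br_diff_left spart_gen[OF w])
    qed (simp add: 1)
    then show ?case using 1 by (simp add: gen_power)
  next
    case (2 v w) then show ?case by (simp add: lin_add[OF lin_ad_pow])
  qed
  then show ?thesis by (simp add: ad_nil_def)
qed

section \<open>Subalgebras on which the Killing form is nondegenerate\<close>

text \<open>\<open>eigpart z f\<close> commutes with all that commutes with z, in particular with M,
  so invariance makes it orthogonal to [M, M], which contains z. Hence z is nilpotent by the trace
  criterion, and a nilpotent element commuting with M is orthogonal to M.\<close>

lemma center_inter_brackets:
  assumes M: "nondeg_on M" and z: "z \<in> M" "\<And>y. y \<in> M \<Longrightarrow> br z y = 0"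
    and zb: "z \<in> vec.span (brackets M M)"
  shows "z = 0"
proof -
  have "ad_nil z"
  proof (rule ad_nil_if_tr_zero)
    fix f :: "'k \<Rightarrow> 'k" assume f: "rational_functional f"
    let ?z = "eigpart z f"
    have "kap z ?z = 0"
    proof (rule kap_span_zero[OF _ zb])
      fix w assume "w \<in> brackets M M"
      then obtain a b where ab: "w = br a b" "a \<in> M" "b \<in> M" by blast
      have "br b z = 0" using z(2)[OF ab(3)] br_comm_0 by blast
      then have "br b ?z = 0" by (rule eigpart_commute[OF rational_functional_add[OF f]])
      then show "kap w ?z = 0" by (simp add: ab(1) kap_invariant)
    qed
    then show "tr (\<lambda>v. br z (eigder z f v)) = 0"
      by (simp add: kap_def br_eigpart[OF rational_functional_add[OF f]])
  qed
  then have "kap z y = 0" if "y \<in> M" for y using kap_commuting_nil z(2)[OF that] by blast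
  then show ?thesis using M z(1) by (auto simp: nondeg_on_def)
qed

text \<open>ad b ad y is strictly triangular along a flag stable under B and y: the vectors that B
  maps into a proper member W are not all in W (Engel) and are preserved by y, and an eigenvector of
  y modulo W among them is sent into W.\<close>

lemma kap_nil_ideal:
  assumes B: "subalgebra br B" and nil: "\<And>x. x \<in> B \<Longrightarrow> ad_nil x"
    and y: "\<And>x. x \<in> B \<Longrightarrow> br x y \<in> B" and b: "b \<in> B"
  shows "kap b y = 0"
proof -
  let ?T = "\<lambda>v. br b (br y v)"
  let ?good = "\<lambda>W. vec.subspace W \<and> (\<forall>x\<in>insert y B. \<forall>w\<in>W. br x w \<in> W)"
  have "tr ?T = 0"
  proof (rule tr_flag_zero[OF lin_compose[OF lin_ad[of b] lin_ad[of y]], of ?good])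
    fix W assume W: "?good W" "W \<noteq> UNIV"
    have sW: "vec.subspace W" using W by blast
    define C where "C = {v. \<forall>x\<in>B. br x v \<in> W}"
    have sC: "vec.subspace C" unfolding C_def
      by (rule vec.subspaceI) (auto simp: br_add_right br_scale_right
          intro: vec.subspace_0[OF sW] vec.subspace_add[OF sW] vec.subspace_scale[OF sW])
    have "\<exists>a\<in>UNIV. a \<notin> W \<and> (\<forall>x\<in>B. br x a \<in> W)"
      by (rule engel[where N = "CARD('n)", OF B _ _ sW]) (use W nil in \<open>auto simp: ad_nil_def\<close>)
    then obtain v where v: "v \<in> C" "v \<notin> W" unfolding C_def by blast
    have yC: "br y ` C \<subseteq> C"
    proof (intro image_subsetI)
      fix u assume u: "u \<in> C"
      have "br x (br y u) \<in> W" if x: "x \<in> B" for x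
        unfolding jacobi[of x y u] using u y[OF x] x W(1) unfolding C_def
        by (auto intro!: vec.subspace_add[OF sW])
      then show "br y u \<in> C" unfolding C_def by blast
    qed
    obtain a c where a: "a \<in> C" "a \<notin> W" "br y a - c *s a \<in> W"
      using eigenvector_mod_subspace[OF ac lin_ad yC sC sW v] by blast
    have "br b (br y a) = br b (br y a - c *s a) + c *s br b a" by (simp add: br_diff_right br_scale_right)
    also have "\<dots> \<in> W" using a W(1) b unfolding C_def
      by (intro vec.subspace_add[OF sW] vec.subspace_scale[OF sW]) auto
    finally have Ta: "?T a \<in> W" .
    have "br x ` vec.span (insert a W) \<subseteq> vec.span (insert a W)" if x: "x \<in> insert y B" for x
    proof -
      have "br x a - (if x = y then c else 0) *s a \<in> W" using x a unfolding C_def by auto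
      then show ?thesis using W(1) x by (intro span_insert_invariant[OF lin_ad sW]) auto
    qed
    then show "\<exists>a. a \<notin> W \<and> ?T a \<in> W \<and> ?good (vec.span (insert a W))"
      using a Ta by (intro exI[of _ a]) auto
  qed (use b in auto)
  then show ?thesis unfolding kap_def .
qed

text \<open>B = [M, A] consists of nilpotent elements by the trace criterion, because A is abelian,
  and is then orthogonal to M by \<open>kap_nil_ideal\<close>.\<close>

lemma abelian_ideal_central:
  assumes M: "nondeg_on M" and A: "lie_ideal br M A" and ab: "\<And>a b. a \<in> A \<Longrightarrow> b \<in> A \<Longrightarrow> br a b = 0"
    and "a \<in> A" "y \<in> M"
  shows "br y a = 0"
proof -
  have sA: "vec.subspace A" and AM: "A \<subseteq> M" and inv: "\<And>x y. x \<in> M \<Longrightarrow> y \<in> A \<Longrightarrow> br x y \<in> A"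
    using A by (auto simp: lie_ideal_def)
  let ?G = "brackets M A"
  define B where "B = vec.span ?G"
  have BA: "B \<subseteq> A" unfolding B_def by (rule vec.span_minimal[OF _ sA]) (use inv in blast)
  have nil: "ad_nil b" if b: "b \<in> B" for b
  proof (rule ad_nil_if_tr_zero)
    fix f :: "'k \<Rightarrow> 'k" assume f: "rational_functional f"
    let ?z = "eigpart b f"
    have "kap b ?z = 0"
    proof (rule kap_span_zero[OF _ b[unfolded B_def]])
      fix w assume "w \<in> ?G"
      then obtain y a where ya: "w = br y a" "y \<in> M" "a \<in> A" by blast
      have "br a b = 0" using ab ya(3) b BA by blast
      then have "br a ?z = 0" by (rule eigpart_commute[OF rational_functional_add[OF f]])
      then show "kap w ?z = 0" by (simp add: ya(1) kap_invariant)
    qed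
    then show "tr (\<lambda>v. br b (eigder b f v)) = 0"
      by (simp add: kap_def br_eigpart[OF rational_functional_add[OF f]])
  qed
  have sub: "subalgebra br B"
  proof -
    have "br x z \<in> B" if "x \<in> B" "z \<in> B" for x z
    proof -
      have "br x z = 0" by (rule ab) (use that BA in blast)+
      then show ?thesis by (simp add: B_def vec.span_zero)
    qed
    then show ?thesis by (auto simp: subalgebra_def B_def)
  qed
  have zero: "b = 0" if b: "b \<in> B" for b
  proof -
    have "kap b y = 0" if y: "y \<in> M" for y
    proof (rule kap_nil_ideal[OF sub nil _ b])
      fix x assume "x \<in> B"
      then have "br y x \<in> ?G" using BA y by blast
      then have "br y x \<in> B" unfolding B_def by (rule vec.span_base)
      then have "- br y x \<in> B" unfolding B_def by (rule vec.span_neg)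
      then show "br x y \<in> B" using br_swap[of x y] by simp
    qed
    then show ?thesis using M b BA AM by (auto simp: nondeg_on_def)
  qed
  have "br y a \<in> B" unfolding B_def by (rule vec.span_base) (use assms in blast)
  then show ?thesis by (rule zero)
qed

lemma derived_series_abelian:
  assumes "derived_series br I (Suc k) \<subseteq> {0}" "a \<in> derived_series br I k" "b \<in> derived_series br I k"
  shows "br a b = 0"
proof -
  have "br a b \<in> derived_series br I (Suc k)" using assms by (auto intro!: vec.span_base)
  then show ?thesis using assms(1) by blast
qed

text \<open>The last nonzero term of the derived series is an abelian ideal, hence central, and
  inside [M, M] a central element is 0. The descent therefore stops at [M, M], not at M.\<close>

lemma solvable_nondeg_abelian:
  assumes M: "subalgebra br M" "nondeg_on M" and sol: "solvable_lie br M" and "a \<in> M" "b \<in> M"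
  shows "br a b = 0"
proof -
  have I: "lie_ideal br M M" by (rule lie_ideal_self[OF M(1)])
  have step: "derived_series br M (Suc k) \<subseteq> {0}" if d: "derived_series br M (Suc (Suc k)) \<subseteq> {0}" for k
  proof
    fix z assume z: "z \<in> derived_series br M (Suc k)"
    have id: "lie_ideal br M (derived_series br M (Suc k))" by (rule lie_ideal_derived_series[OF I])
    have "br y z = 0" if "y \<in> M" for y
      by (rule abelian_ideal_central[OF M(2) id derived_series_abelian[OF d] z that])
    then have "br z y = 0" if "y \<in> M" for y using that br_comm_0 by blast
    moreover have "z \<in> M" using z id by (auto simp: lie_ideal_def)
    moreover have "z \<in> vec.span (brackets M M)" using derived_series_subset1[OF I] z by auto
    ultimately show "z \<in> {0}" using center_inter_brackets[OF M(2)] by blast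
  qed
  obtain k where k: "derived_series br M k \<subseteq> {0}" using sol by (auto simp: solvable_lie_def)
  have "derived_series br M (Suc k) \<subseteq> {0}"
    using derived_series_Suc_subset[OF I, of k] k by blast
  then have "derived_series br M (Suc 0) \<subseteq> {0}"
    by (induction k) (use step in blast)+
  then show ?thesis by (rule derived_series_abelian) (use assms in auto)
qed

lemma semisimple_if_nondeg_centerless:
  assumes M: "subalgebra br M" "nondeg_on M" and Z: "\<And>z. z \<in> M \<Longrightarrow> (\<And>y. y \<in> M \<Longrightarrow> br z y = 0) \<Longrightarrow> z = 0"
  shows "semisimple_lie br M"
  unfolding semisimple_lie_def
proof (intro conjI allI impI M(1))
  fix I assume I: "lie_ideal br M I \<and> solvable_lie br I"
  have id: "lie_ideal br M (derived_series br I k)" for k using lie_ideal_derived_series I by blast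
  have step: "derived_series br I k \<subseteq> {0}" if d: "derived_series br I (Suc k) \<subseteq> {0}" for k
  proof
    fix z assume z: "z \<in> derived_series br I k"
    have "br y z = 0" if "y \<in> M" for y
      by (rule abelian_ideal_central[OF M(2) id derived_series_abelian[OF d] z that])
    then have "br z y = 0" if "y \<in> M" for y using that br_comm_0 by blast
    moreover have "z \<in> M" using z id[of k] by (auto simp: lie_ideal_def)
    ultimately show "z \<in> {0}" using Z by blast
  qed
  obtain k where "derived_series br I k \<subseteq> {0}" using I by (auto simp: solvable_lie_def)
  then have "derived_series br I 0 \<subseteq> {0}" by (induction k) (use step in blast)+
  then show "I = {0}" using I vec.subspace_0 by (fastforce simp: lie_ideal_def)
qed

lemma kap_eigenvectors:
  assumes "br x y = 0" "br x v = c *s v" "c \<noteq> 0"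
  shows "kap y v = 0"
proof -
  have "c * kap y v = kap y (br x v)" by (simp add: assms kap_scale_right)
  also have "\<dots> = kap (br y x) v" by (simp add: kap_invariant)
  also have "\<dots> = 0" by (simp add: br_comm_0[THEN iffD1, OF assms(1)])
  finally show ?thesis using assms(3) by simp
qed

text \<open>The centralizer of x is orthogonal to every eigenspace of ad x with nonzero eigenvalue,
  and M is the sum of its intersections with the eigenspaces.\<close>

lemma nondeg_on_centralizer:
  assumes M: "vec.subspace M" "nondeg_on M" and x: "diag x" "\<And>y. y \<in> M \<Longrightarrow> br x y \<in> M"
  shows "nondeg_on {y \<in> M. br x y = 0}"
  unfolding nondeg_on_def
proof (intro ballI impI)
  fix y assume y: "y \<in> {y \<in> M. br x y = 0}" and k: "\<forall>v\<in>{y \<in> M. br x y = 0}. kap y v = 0"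
  have "kap y v = 0" if v: "v \<in> M" for v
  proof -
    have "kap y (proj x c v) = 0" for c
    proof -
      have "proj x c v \<in> M"
        by (rule proj_invariant[OF M(1) _ v]) (use x(2) in blast)
      moreover have "br x (proj x c v) = c *s proj x c v"
        using x(1) proj_mem by (auto simp: diag_def)
      ultimately show ?thesis
        using k kap_eigenvectors[of x y "proj x c v" c] y by (cases "c = 0") auto
    qed
    then have "kap y (\<Sum>c\<in>spectrum (br x). proj x c v) = 0" by (simp add: kap_sum_right)
    then show ?thesis by (simp only: proj_sum[symmetric])
  qed
  then show "y = 0" using M(2) y by (auto simp: nondeg_on_def)
qed

lemma diag_combination:
  assumes x: "diag x" and y: "diag y" and xy: "br x y = 0"
  shows "\<exists>s. diag (x + s *s y) \<and> (\<forall>v. br (x + s *s y) v = 0 \<longrightarrow> br x v = 0 \<and> br y v = 0)"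
proof -
  have fin: "finite (spectrum (br x))" for x by (rule gen_finite)
  \<comment> \<open>Avoiding these quotients makes c + s d = 0 possible on joint eigenspaces only
    for c = d = 0. For d = 0 the quotient is 0, which merely excludes s = 0.\<close>
  let ?bad = "(\<lambda>(c, d). - c / d) ` (spectrum (br x) \<times> spectrum (br y))"
  have "finite ?bad" using fin by blast
  then obtain s where s: "s \<notin> ?bad" using ex_new_if_finite[OF infinite_UNIV_char_0] by blast
  let ?z = "x + s *s y"
  let ?p = "\<lambda>c d v. proj x c (proj y d v)"
  have comm: "br y (br x u) = br x (br y u)" for u using jacobi[of x y u] xy by simp
  have brx: "br x (?p c d v) = c *s ?p c d v" for c d v
    using x proj_mem by (auto simp: diag_def)
  have bry: "br y (?p c d v) = d *s ?p c d v" for c d v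
  proof -
    have "br y (?p c d v) = proj x c (br y (proj y d v))"
      by (rule gen_proj_commute[OF lin_ad ac lin_ad gen_eigenspace_commute[OF lin_ad lin_ad comm], symmetric])
    also have "br y (proj y d v) = d *s proj y d v"
      using y proj_mem by (auto simp: diag_def)
    finally show ?thesis by (simp add: lin_scale[OF lin_proj])
  qed
  have brz: "br ?z (?p c d v) = (c + s * d) *s ?p c d v" for c d v
    by (simp add: br_add_left br_scale_left brx bry vec.scale_left_distrib vector_smult_assoc)
  have sum: "v = (\<Sum>d\<in>spectrum (br y). \<Sum>c\<in>spectrum (br x). ?p c d v)" for v
    unfolding proj_sum[symmetric] ..
  have "diag ?z"
  proof (rule diagI)
    fix v
    have "(\<Sum>d\<in>spectrum (br y). \<Sum>c\<in>spectrum (br x). ?p c d v) \<in> vec.span {v. \<exists>c. br ?z v = c *s v}"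
      by (intro vec.span_sum vec.span_base) (use brz in blast)
    then show "v \<in> vec.span {v. \<exists>c. br ?z v = c *s v}" by (simp only: sum[symmetric])
  qed
  moreover have "br x v = 0 \<and> br y v = 0" if v: "br ?z v = 0" for v
  proof -
    have commz: "br x (br ?z u) = br ?z (br x u)" "br y (br ?z u) = br ?z (br y u)" for u
      by (simp_all add: br_add_left br_scale_left br_add_right br_scale_right comm)
    have "br ?z (proj y d v) = 0" for d
      using gen_proj_commute[OF lin_ad[of y] ac lin_ad[of ?z] gen_eigenspace_commute[OF lin_ad lin_ad commz(2)[symmetric]], of d v]
        v lin_0[OF lin_proj] by simp
    then have pz: "br ?z (?p c d v) = 0" for c d
      using gen_proj_commute[OF lin_ad[of x] ac lin_ad[of ?z] gen_eigenspace_commute[OF lin_ad lin_ad commz(1)[symmetric]], of c "proj y d v"]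
        lin_0[OF lin_proj] by simp
    have "(c + s * d) *s ?p c d v = 0" for c d unfolding brz[of c d v, symmetric] by (rule pz)
    then have z: "c + s * d = 0 \<or> ?p c d v = 0" for c d unfolding vec.scale_eq_0_iff .
    have cd: "c *s ?p c d v = 0 \<and> d *s ?p c d v = 0" if "gen x c \<noteq> {0}" "gen y d \<noteq> {0}" for c d
    proof (cases "?p c d v = 0")
      case False
      then have e: "c + s * d = 0" using z by blast
      have "d = 0"
      proof (rule ccontr)
        assume "d \<noteq> 0"
        then have "s = - c / d" using e by (simp add: field_simps eq_neg_iff_add_eq_0)
        then show False using s that by auto
      qed
      then show ?thesis using e by simp
    qed simp
    have "br x (\<Sum>d\<in>spectrum (br y). \<Sum>c\<in>spectrum (br x). ?p c d v) = 0"
      unfolding br_sum_right brx by (intro sum.neutral ballI) (use cd in blast)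
    moreover have "br y (\<Sum>d\<in>spectrum (br y). \<Sum>c\<in>spectrum (br x). ?p c d v) = 0"
      unfolding br_sum_right bry by (intro sum.neutral ballI) (use cd in blast)
    ultimately show ?thesis by (simp only: sum[symmetric])
  qed
  ultimately show ?thesis by blast
qed

text \<open>A functional vanishing on the image of ad e but not at c (a coordinate of
  \<open>g\<close>) is represented by some z; invariance puts z in the kernel of ad e, against the
  hypothesis on c.\<close>

lemma im_ad_perp:
  assumes "\<And>y. br e y = 0 \<Longrightarrow> kap c y = 0"
  shows "\<exists>w. c = br e w"
proof (rule ccontr)
  assume no: "\<nexists>w. c = br e w"
  let ?S = "range (br e)"
  have sS: "vec.subspace ?S" using vec.linear_subspace_image[OF lin_ad vec.subspace_UNIV] .
  have c: "c \<notin> ?S" using no by blast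
  obtain B where B: "B \<subseteq> ?S" "vec.independent B" "?S \<subseteq> vec.span B" "card B = vec.dim ?S"
    by (rule vec.basis_exists[of ?S])
  have spB: "vec.span B = ?S" by (rule antisym[OF vec.span_minimal[OF B(1) sS] B(3)])
  have "vec.independent (insert c B)" using vec.independent_insertI B(2) c spB by blast
  then obtain g where g: "lin g" "\<forall>b\<in>insert c B. g b = (if b = c then c else 0)"
    using vec.linear_independent_extend[of "insert c B" "\<lambda>b. if b = c then c else 0"] by blast
  have c0: "c \<noteq> 0" using c vec.subspace_0[OF sS] by metis
  then obtain i where i: "c $ i \<noteq> 0" by (auto simp: vec_eq_iff)
  obtain z where z: "\<And>y. g y $ i = kap z y"
    using kap_represents[of "\<lambda>y. g y $ i"] by (auto simp: lin_add[OF g(1)] lin_scale[OF g(1)])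
  have gS: "g y = 0" if "y \<in> ?S" for y
  proof -
    have "g b \<in> {0}" if "b \<in> B" for b using g(2) c B(1) that by auto
    then have "g y \<in> {0}" using lin_span_mem[OF g(1) vec.subspace_single_0] that spB by blast
    then show ?thesis by simp
  qed
  have "br e z = 0"
  proof (rule kap_nondeg)
    fix w
    have "kap (br e z) w = - kap (br z e) w" by (simp add: br_swap[of e z] kap_minus_left)
    also have "\<dots> = - kap z (br e w)" by (simp add: kap_invariant)
    also have "\<dots> = 0" using z[of "br e w"] gS[of "br e w"] by simp
    finally show "kap (br e z) w = 0" .
  qed
  then have "kap c z = 0" by (rule assms)
  then have "g c $ i = 0" by (simp add: z kap_sym)
  then show False using g(2) i by simp
qed

end

section \<open>Kreknin's theorem\<close>

context lie_alg begin

definition generated :: "('k^'n) set \<Rightarrow> ('k^'n) set" where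
  "generated X = \<Inter>{S. subalgebra br S \<and> X \<subseteq> S}"

lemma subalgebra_generated: "subalgebra br (generated X)"
  unfolding generated_def subalgebra_def by (auto intro!: vec.subspace_Inter)

lemma generated_superset: "X \<subseteq> generated X"
  by (auto simp: generated_def)

lemma generated_least: "subalgebra br S \<Longrightarrow> X \<subseteq> S \<Longrightarrow> generated X \<subseteq> S"
  by (auto simp: generated_def)

lemma derived_series_add: "derived_series br I (s + t) = derived_series br (derived_series br I s) t"
  by (induction t) simp_all

end

locale cyclic_grading = lie_alg br for br :: "('k::field_char_0,'n::finite) bracket" +
  fixes m :: nat and hom :: "nat \<Rightarrow> 'k^'n \<Rightarrow> 'k^'n"
  assumes m: "m > 0" and lin_hom: "lin (hom i)"
    and hom_sum: "(\<Sum>i<m. hom i v) = v"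
    and hom_hom: "hom i (hom j v) = (if i = j then hom i v else 0)"
    and br_hom: "i < m \<Longrightarrow> j < m \<Longrightarrow> br (hom i u) (hom j v) = hom ((i + j) mod m) (br (hom i u) (hom j v))"
begin

definition graded :: "('k^'n) set \<Rightarrow> bool" where
  "graded L \<longleftrightarrow> subalgebra br L \<and> (\<forall>v\<in>L. \<forall>i<m. hom i v \<in> L)"

text \<open>Degrees are compared as numbers below m, an order that addition modulo m does not
  respect; the wrap-around drives \<open>kreknin_step\<close>.\<close>

abbreviation above :: "('k^'n) set \<Rightarrow> nat \<Rightarrow> ('k^'n) set" where
  "above L k \<equiv> {v \<in> L. \<exists>i>k. i < m \<and> hom i v = v}"

lemma hom_br_hom:
  assumes "i < m" "j < m"
  shows "hom l (br (hom i u) (hom j v)) = (if l = (i + j) mod m then br (hom i u) (hom j v) else 0)"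
proof -
  have w: "hom ((i + j) mod m) (br (hom i u) (hom j v)) = br (hom i u) (hom j v)"
    by (rule br_hom[OF assms, symmetric])
  show ?thesis using hom_hom[of l "(i + j) mod m" "br (hom i u) (hom j v)"] unfolding w
    by (auto simp: w)
qed

lemma br_expand: "br u v = (\<Sum>i<m. \<Sum>j<m. br (hom i u) (hom j v))"
proof -
  have "br u v = br (\<Sum>i<m. hom i u) (\<Sum>j<m. hom j v)" by (simp only: hom_sum)
  also have "\<dots> = (\<Sum>i<m. \<Sum>j<m. br (hom i u) (hom j v))" by (simp only: br_sum_left) (simp only: br_sum_right)
  finally show ?thesis .
qed

lemma graded_brackets:
  assumes L: "graded L"
  shows "graded (vec.span (brackets L L))" (is "graded (vec.span ?G)")
  unfolding graded_def
proof (intro conjI ballI allI impI)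
  have sub: "subalgebra br L" using L by (simp add: graded_def)
  show "subalgebra br (vec.span ?G)"
    by (rule lie_ideal_subalgebra[OF lie_ideal_brackets[OF lie_ideal_self[OF sub]]])
  fix v i assume v: "v \<in> vec.span ?G" and "i < m"
  show "hom i v \<in> vec.span ?G"
  proof (rule lin_span_mem[OF lin_hom vec.subspace_span _ v])
    fix v assume "v \<in> ?G"
    then obtain x y where xy: "v = br x y" "x \<in> L" "y \<in> L" by blast
    have "hom i (br x y) = (\<Sum>a<m. \<Sum>b<m. hom i (br (hom a x) (hom b y)))"
      by (subst br_expand) (simp only: lin_sum[OF lin_hom])
    also have "\<dots> \<in> vec.span ?G"
    proof (intro vec.span_sum)
      fix a b assume ab: "a \<in> {..<m}" "b \<in> {..<m}"
      have "br (hom a x) (hom b y) \<in> ?G" using ab xy L unfolding graded_def by blast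
      then have "br (hom a x) (hom b y) \<in> vec.span ?G" by (rule vec.span_base)
      then show "hom i (br (hom a x) (hom b y)) \<in> vec.span ?G"
        using ab by (simp add: hom_br_hom vec.span_zero)
    qed
    finally show "hom i v \<in> vec.span ?G" unfolding xy(1) .
  qed
qed

lemma graded_derived_series: "graded L \<Longrightarrow> graded (derived_series br L s)"
  by (induction s) (simp_all add: graded_brackets)

text \<open>In the inductive step, \<open>X\<close> is a subalgebra by the Jacobi identity and contains every component of
  degree above \<open>k\<close>; there the vanishing of the component of degree 0 enters.\<close>

lemma kreknin_step:
  assumes "k < m" "graded L" "\<And>v. v \<in> L \<Longrightarrow> hom 0 v = 0"
  shows "\<exists>s. derived_series br L s \<subseteq> generated (above L k)"
  using assms
proof (induction k arbitrary: L)
  case 0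
  have sub: "subalgebra br L" using "0.prems"(2) by (simp add: graded_def)
  have "v \<in> generated (above L 0)" if v: "v \<in> L" for v
  proof -
    have s: "vec.subspace (generated (above L 0))" using subalgebra_generated by (simp add: subalgebra_def)
    have "hom i v \<in> generated (above L 0)" if "i < m" for i
    proof (cases "i = 0")
      case True then show ?thesis using "0.prems"(3) v vec.subspace_0[OF s] by simp
    next
      case False
      then have "hom i v \<in> above L 0" using that v "0.prems"(2) by (auto simp: graded_def hom_hom)
      then show ?thesis by (rule subsetD[OF generated_superset])
    qed
    then have "(\<Sum>i<m. hom i v) \<in> generated (above L 0)" by (intro vec.subspace_sum[OF s]) auto
    then show ?thesis by (simp only: hom_sum)
  qed
  then have "derived_series br L 0 \<subseteq> generated (above L 0)" by auto
  then show ?case by blast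
next
  case (Suc k)
  let ?K = "Suc k"
  have K: "?K < m" and L: "graded L" and L0: "\<And>v. v \<in> L \<Longrightarrow> hom 0 v = 0" using Suc.prems by auto
  have subL: "subalgebra br L" using L by (simp add: graded_def)
  have sL: "vec.subspace L" using subL by (simp add: subalgebra_def)
  define H where "H = generated (above L ?K)"
  have subH: "subalgebra br H" unfolding H_def by (rule subalgebra_generated)
  have sH: "vec.subspace H" using subH by (simp add: subalgebra_def)
  have aboveH: "v \<in> H" if "v \<in> L" "hom i v = v" "?K < i" "i < m" for v i
    unfolding H_def by (rule subsetD[OF generated_superset]) (use that in blast)
  define X where "X = {a \<in> L. \<forall>y\<in>L. hom ?K (br y a) \<in> H}"
  have subX: "subalgebra br X"
    unfolding subalgebra_def
  proof (intro conjI ballI)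
    show "vec.subspace X" unfolding X_def
      by (rule vec.subspaceI)
        (auto simp: br_add_right br_scale_right lin_0[OF lin_hom] lin_add[OF lin_hom] lin_scale[OF lin_hom]
          intro: vec.subspace_0[OF sL] vec.subspace_add[OF sL] vec.subspace_scale[OF sL]
            vec.subspace_0[OF sH] vec.subspace_add[OF sH] vec.subspace_scale[OF sH])
    fix a b assume ab: "a \<in> X" "b \<in> X"
    have inL: "br x y \<in> L" if "x \<in> L" "y \<in> L" for x y using subL that by (auto simp: subalgebra_def)
    have "hom ?K (br y (br a b)) \<in> H" if y: "y \<in> L" for y
    proof -
      have e: "br y (br a b) = br (br y a) b - br (br y b) a"
        by (simp add: jacobi[of y a b] br_swap[of a "br y b"])
      have "hom ?K (br (br y a) b) \<in> H" "hom ?K (br (br y b) a) \<in> H"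
        using ab y inL unfolding X_def by auto
      then show ?thesis unfolding e lin_diff[OF lin_hom] by (rule vec.subspace_diff[OF sH])
    qed
    then show "br a b \<in> X" using ab inL unfolding X_def by auto
  qed
  have "above L k \<subseteq> X"
  proof
    fix a assume "a \<in> above L k"
    then obtain l where l: "a \<in> L" "k < l" "l < m" "hom l a = a" by auto
    have "hom ?K (br y a) \<in> H" if y: "y \<in> L" for y
    proof -
      have "hom ?K (br y a) = hom ?K (br (\<Sum>j<m. hom j y) a)" by (simp only: hom_sum)
      also have "\<dots> = (\<Sum>j<m. hom ?K (br (hom j y) (hom l a)))"
        by (simp only: br_sum_left lin_sum[OF lin_hom] l(4))
      also have "\<dots> \<in> H"
      proof (rule vec.subspace_sum[OF sH])
        fix j assume "j \<in> {..<m}"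
        then have j: "j < m" by simp
        show "hom ?K (br (hom j y) (hom l a)) \<in> H"
        proof (cases "?K = (j + l) mod m \<and> j \<noteq> 0")
          case True
          \<comment> \<open>Without wrap-around, j + l = k + 1 and l > k would leave only j = 0,
            which is excluded. With it, j + l = k + 1 + m, so j and l both exceed k + 1 and both
            factors lie in \<open>H\<close>.\<close>
          have "j + l \<ge> m"
          proof (rule ccontr)
            assume "\<not> j + l \<ge> m"
            then have "(j + l) mod m = j + l" by simp
            then show False using True l(2) by simp
          qed
          then have "(j + l) mod m = j + l - m" using j l(3) by (simp add: mod_if)
          then have jl: "?K < j" "?K < l" using True j l \<open>m \<le> j + l\<close> by linarith+
          have "hom j y \<in> H" using aboveH[of "hom j y" j] jl(1) j y L by (auto simp: graded_def hom_hom)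
          moreover have "hom l a \<in> H" using aboveH[of a l] jl(2) l by simp
          ultimately have "br (hom j y) (hom l a) \<in> H" using subH by (simp add: subalgebra_def)
          then show ?thesis using True by (simp add: hom_br_hom j l(3))
        next
          case False
          then show ?thesis using L0[OF y] vec.subspace_0[OF sH]
            by (cases "j = 0") (auto simp: hom_br_hom j l(3) lin_0[OF lin_hom])
        qed
      qed
      finally show ?thesis .
    qed
    then show "a \<in> X" using l(1) unfolding X_def by blast
  qed
  then have HX: "generated (above L k) \<subseteq> X" by (rule generated_least[OF subX])
  obtain s where s: "derived_series br L s \<subseteq> generated (above L k)"
    using Suc.IH[of L] K L L0 by auto
  \<comment> \<open>Elements of N are sums of brackets of elements of X, so their components of
    degree k + 1 lie in \<open>H\<close>. Hence a second use of the induction hypothesis, for N, has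
    all its generators in \<open>H\<close>.\<close>
  let ?N = "derived_series br L (Suc s)"
  have N: "graded ?N" by (rule graded_derived_series[OF L])
  have NL: "?N \<subseteq> L"
    using lie_ideal_derived_series[OF lie_ideal_self[OF subL], of "Suc s"] unfolding lie_ideal_def by blast
  have homN: "hom ?K v \<in> H" if "v \<in> ?N" for v
  proof (rule lin_span_mem[OF lin_hom sH _ that[unfolded derived_series.simps]])
    fix v assume "v \<in> brackets (derived_series br L s) (derived_series br L s)"
    then obtain x y where "v = br x y" "x \<in> X" "y \<in> X" using s HX by blast
    then show "hom ?K v \<in> H" unfolding X_def by blast
  qed
  have N0: "hom 0 v = 0" if "v \<in> ?N" for v using L0 NL that by blast
  obtain t where t: "derived_series br ?N t \<subseteq> generated (above ?N k)"
    using Suc.IH[OF _ N N0] K by auto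
  have "above ?N k \<subseteq> H"
  proof
    fix v assume "v \<in> above ?N k"
    then obtain i where i: "v \<in> ?N" "k < i" "i < m" "hom i v = v" by blast
    show "v \<in> H"
    proof (cases "i = ?K")
      case True then show ?thesis using homN[OF i(1)] i(4) by simp
    next
      case False then show ?thesis using aboveH[of v i] i NL by auto
    qed
  qed
  then have "generated (above ?N k) \<subseteq> H" by (rule generated_least[OF subH])
  then have "derived_series br L (Suc s + t) \<subseteq> H" using t unfolding derived_series_add by blast
  then show ?case unfolding H_def by blast
qed

theorem kreknin:
  assumes L: "graded L" "\<And>v. v \<in> L \<Longrightarrow> hom 0 v = 0"
  shows "solvable_lie br L"
proof -
  obtain s where s: "derived_series br L s \<subseteq> generated (above L (m - 1))"
    using kreknin_step[of "m - 1" L] L m by auto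
  \<comment> \<open>No degree exceeds m - 1, so the generating set is empty.\<close>
  have "generated (above L (m - 1)) \<subseteq> {0}" by (rule generated_least) (use m in \<open>auto simp: subalgebra_def\<close>)
  then show ?thesis using s unfolding solvable_lie_def by blast
qed

end

section \<open>The grading defined by an sl2-triple\<close>

context semisimple_alg begin

text \<open>ad x moves the eigenvalue c of ad z to c + a, c + 2a, ..., all distinct in
  characteristic 0, while the spectrum is finite.\<close>

lemma ad_nil_gen:
  assumes x: "x \<in> gen z a" and a: "a \<noteq> 0"
  shows "ad_nil x"
proof -
  have "(br x ^^ CARD('n)) v = 0" for v
  proof (induction v rule: gen_induct[OF lin_ad[of z] ac])
    case (1 c v)
    have pow: "(br x ^^ k) v \<in> gen z (c + of_nat k * a)" for k
    proof (induction k)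
      case (Suc k)
      have "br x ((br x ^^ k) v) \<in> gen z (a + (c + of_nat k * a))" by (rule br_gen[OF x Suc])
      then show ?case by (simp add: algebra_simps)
    qed (simp add: 1)
    have "inj (\<lambda>k::nat. c + of_nat k * a)" using a by (auto simp: inj_on_def)
    then have "infinite (range (\<lambda>k::nat. c + of_nat k * a))" using finite_imageD by blast
    then have "\<not> range (\<lambda>k::nat. c + of_nat k * a) \<subseteq> spectrum (br z)"
      using gen_finite finite_subset by blast
    then obtain k :: nat where "gen z (c + of_nat k * a) = {0}" by blast
    then have "(br x ^^ k) v = 0" using pow[of k] by simp
    then show ?case by (rule funpow_vanish_dim[OF lin_ad]) simp
  next
    case (2 v w) then show ?case by (simp add: lin_add[OF lin_ad_pow])
  qed
  then show ?thesis by (simp add: ad_nil_def)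
qed

lemma gen_proj_shift:
  assumes x: "x \<in> gen z a"
  shows "proj z (c + a) (br x w) = br x (proj z c w)"
proof (induction w rule: gen_induct[OF lin_ad[of z] ac])
  case (1 d w)
  have "br x w \<in> gen z (a + d)" by (rule br_gen[OF x 1])
  then show ?case
    by (simp add: proj_gen[OF 1] proj_gen add.commute)
next
  case (2 v w) then show ?case by (simp add: br_add_right lin_add[OF lin_proj])
qed

lemma gen_inter: "v \<in> gen z a \<Longrightarrow> v \<in> gen z b \<Longrightarrow> a \<noteq> b \<Longrightarrow> v = 0"
  using proj_gen[of v z a a] proj_gen[of v z b a] by simp

end

locale sl2_alg = semisimple_alg br for br :: "('k::field_char_0,'n::finite) bracket" +
  fixes e h f :: "'k^'n"
  assumes triple: "sl2_triple br e h f" and e0: "e \<noteq> 0"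
begin

lemma br_he: "br h e = 2 *s e" and br_hf: "br h f = (-2) *s f" and br_ef: "br e f = h"
  using triple by (auto simp: sl2_triple_def)

lemma e_gen: "e \<in> gen h 2" and f_gen: "f \<in> gen h (-2)"
  by (rule gen_eigenvector[OF br_he], rule gen_eigenvector[OF br_hf])

lemma e_nil: "(br e ^^ CARD('n)) v = 0" and f_nil: "(br f ^^ CARD('n)) v = 0"
  using ad_nil_gen[OF e_gen] ad_nil_gen[OF f_gen] by (auto simp: ad_nil_def)

lemma h_e: "br h (br e v) = br e (br h v) + 2 *s br e v"
  and h_f: "br h (br f v) = br f (br h v) - 2 *s br f v"
  and e_f: "br e (br f v) = br f (br e v) + br h v"
  using br_scale_left[of "-2" f v]
  by (simp_all add: jacobi[of h] jacobi[of e f] br_he br_hf br_ef br_scale_left)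

lemma h_fpow: "br h ((br f ^^ k) y) = (br f ^^ k) (br h y) - (2 * of_nat k) *s (br f ^^ k) y"
proof (induction k)
  case (Suc k)
  show ?case
    by (simp add: h_f Suc br_diff_right br_scale_right vec.scale_left_distrib algebra_simps)
qed simp

text \<open>The usual sl2 relation, with \<open>br h y\<close> left unevaluated because a vector
  killed by e is not yet known to split into weight vectors.\<close>

lemma e_fpow:
  assumes "br e y = 0"
  shows "br e ((br f ^^ Suc k) y) = of_nat (Suc k) *s (br f ^^ k) (br h y - of_nat k *s y)"
proof (induction k)
  case 0 then show ?case by (simp add: e_f assms)
next
  case (Suc k)
  let ?F = "\<lambda>k. br f ^^ k"
  have l: "lin (?F k)" for k by (rule lin_ad_pow)
  have "br e ((?F (Suc (Suc k))) y) = br f (br e ((?F (Suc k)) y)) + br h ((?F (Suc k)) y)"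
    by (simp only: funpow.simps comp_apply e_f)
  also have "br f (br e ((?F (Suc k)) y)) = of_nat (Suc k) *s ((?F (Suc k)) (br h y) - of_nat k *s (?F (Suc k)) y)"
    unfolding Suc by (simp add: br_scale_right br_diff_right br_add_right lin_diff[OF l] lin_scale[OF l])
  also have "br h ((?F (Suc k)) y) = (?F (Suc k)) (br h y) - (2 * of_nat (Suc k)) *s (?F (Suc k)) y"
    by (rule h_fpow)
  finally have "br e ((?F (Suc (Suc k))) y) = of_nat (Suc k) *s ((?F (Suc k)) (br h y) - of_nat k *s (?F (Suc k)) y)
      + ((?F (Suc k)) (br h y) - (2 * of_nat (Suc k)) *s (?F (Suc k)) y)" .
  also have "\<dots> = of_nat (Suc (Suc k)) *s ((?F (Suc k)) (br h y) - of_nat (Suc k) *s (?F (Suc k)) y)"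
    by (simp add: vec_eq_iff algebra_simps)
  finally show ?case by (simp only: lin_diff[OF l] lin_scale[OF l])
qed

text \<open>If f^(p+1) y = 0, then by \<open>e_fpow\<close> f^p kills (h - p) y, which by induction
  has weight c. Hence (h - c) y has weight p and also generalized weight c, so it is 0 unless c =
  p.\<close>

lemma ker_e_weight:
  assumes "br e y = 0" "y \<in> gen h c"
  shows "br h y = c *s y"
proof -
  have "br h y = c *s y" if "br e y = 0" "y \<in> gen h c" "(br f ^^ p) y = 0" for p y
    using that
  proof (induction p arbitrary: y)
    case (Suc p)
    have sc: "vec.subspace (gen h c)" by (rule gen_subspace)
    have shift: "br e (br h y - a *s y) = 0" "br h y - a *s y \<in> gen h c" for a
    proof -
      have "br e (br h y) = 0" using h_e[of y] Suc.prems(1) by simp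
      then show "br e (br h y - a *s y) = 0" by (simp add: br_diff_right br_scale_right Suc.prems(1))
      show "br h y - a *s y \<in> gen h c"
        by (intro vec.subspace_diff[OF sc] vec.subspace_scale[OF sc] gen_invariant Suc.prems)
    qed
    let ?y1 = "br h y - of_nat p *s y" and ?y2 = "br h y - c *s y"
    have "of_nat (Suc p) *s (br f ^^ p) ?y1 = 0"
      using e_fpow[OF Suc.prems(1), of p] Suc.prems(3) by simp
    then have y1: "(br f ^^ p) ?y1 = 0" by (simp only: vec.scale_eq_0_iff of_nat_eq_0_iff) simp
    have "br h ?y1 = c *s ?y1" by (rule Suc.IH[OF shift y1])
    then have hy2: "br h ?y2 = of_nat p *s ?y2"
      by (simp add: br_diff_right br_scale_right vec_eq_iff algebra_simps)
    have "?y2 = 0"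
    proof (cases "c = of_nat p")
      case False
      then show ?thesis using gen_inter[OF shift(2)[of c] gen_eigenvector[OF hy2]] by blast
    next
      case True
      \<comment> \<open>Now \<open>?y2\<close> equals \<open>?y1\<close>, so f^p kills it. Applying
        e lowers the power, the factor (j + 1)(p - j) being nonzero for j < p.\<close>
      have "?y2 = 0" if "j \<le> p" "(br f ^^ j) ?y2 = 0" for j
        using that
      proof (induction j)
        case (Suc j)
        have "0 = br e ((br f ^^ Suc j) ?y2)" using Suc.prems(2) by simp
        also have "\<dots> = of_nat (Suc j) *s (br f ^^ j) (br h ?y2 - of_nat j *s ?y2)"
          by (rule e_fpow[OF shift(1)])
        also have "br h ?y2 - of_nat j *s ?y2 = (of_nat p - of_nat j) *s ?y2"
          unfolding hy2 by (simp only: vec.scale_left_diff_distrib)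
        finally have "(of_nat (Suc j) * (of_nat p - of_nat j)) *s (br f ^^ j) ?y2 = 0"
          by (simp only: lin_scale[OF lin_ad_pow] vector_smult_assoc)
        moreover have "of_nat (Suc j) * (of_nat p - of_nat j) \<noteq> (0::'k)"
          using Suc.prems(1) by (simp add: of_nat_eq_iff del: of_nat_Suc)
        ultimately have "(br f ^^ j) ?y2 = 0" by (simp only: vec.scale_eq_0_iff) simp
        then show ?case using Suc by simp
      qed simp
      then show ?thesis using y1 True by blast
    qed
    then show ?case by simp
  qed simp
  then show ?thesis using assms f_nil by blast
qed

text \<open>For the last nonzero f^p y, \<open>e_fpow\<close> gives (p + 1)(c - p) = 0.\<close>

lemma ker_e_natural:
  assumes "br e y = 0" "br h y = c *s y" "y \<noteq> 0"
  shows "\<exists>n::nat. c = of_nat n"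
proof -
  obtain p where p: "(br f ^^ p) y \<noteq> 0" "br f ((br f ^^ p) y) = 0"
    using last_nonmember[of y "{0}" "CARD('n)" "br f"] f_nil assms(3) by auto
  have "0 = br e ((br f ^^ Suc p) y)" using p(2) by simp
  also have "\<dots> = of_nat (Suc p) *s (br f ^^ p) (br h y - of_nat p *s y)" by (rule e_fpow[OF assms(1)])
  also have "br h y - of_nat p *s y = (c - of_nat p) *s y"
    unfolding assms(2) by (simp only: vec.scale_left_diff_distrib)
  finally have "(of_nat (Suc p) * (c - of_nat p)) *s (br f ^^ p) y = 0"
    by (simp only: lin_scale[OF lin_ad_pow] vector_smult_assoc)
  then have "of_nat (Suc p) * (c - of_nat p) = 0" using p(1) by (simp only: vec.scale_eq_0_iff) simp
  then have "c = of_nat p" by (simp del: of_nat_Suc)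
  then show ?thesis by blast
qed

lemma fpow_e:
  "(br f ^^ Suc k) (br e w) = br e ((br f ^^ Suc k) w)
    - of_nat (Suc k) *s (br h ((br f ^^ k) w) + of_nat k *s (br f ^^ k) w)"
proof (induction k)
  case 0 then show ?case by (simp add: e_f)
next
  case (Suc k)
  let ?w = "(br f ^^ k) w"
  have "(br f ^^ Suc (Suc k)) (br e w) = br f ((br f ^^ Suc k) (br e w))" by simp
  also have "\<dots> = br f (br e (br f ?w)) - of_nat (Suc k) *s (br f (br h ?w) + of_nat k *s br f ?w)"
    unfolding Suc by (simp add: br_diff_right br_add_right br_scale_right)
  also have "br f (br e (br f ?w)) = br e (br f (br f ?w)) - br h (br f ?w)" by (simp add: e_f[of "br f ?w"])
  also have "br f (br h ?w) = br h (br f ?w) + 2 *s br f ?w" by (simp add: h_f)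
  finally show ?case by (simp add: vec_eq_iff algebra_simps)
qed

text \<open>The nilpotent part n of h commutes with e, f and h. By \<open>ker_e_weight\<close> it
  kills the kernel of e, so it is orthogonal to it and n = [e, w] with w of generalized weight -2.
  As [f, n] = 0, the last nonzero f^m w would have weight -m by \<open>fpow_e\<close>, but its
  degree is -2 - 2m.\<close>

lemma diag_h: "diag h"
proof -
  define n where "n = h - spart h"
  have nil: "ad_nil n" unfolding n_def by (rule ad_nil_npart)
  have ne: "br n e = 0" and nf: "br n f = 0"
    by (simp_all add: n_def br_diff_left br_he br_hf spart_gen[OF e_gen] spart_gen[OF f_gen])
  have hn: "br h n = 0" by (simp add: n_def br_diff_right br_self spart_commute[OF br_self])
  have "kap n y = 0" if y: "br e y = 0" for y
  proof (rule kap_commuting_nil[OF nil])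
    have sub: "vec.subspace {y. br e y = 0}" by (rule vec.linear_subspace_kernel[OF lin_ad])
    have inv: "br h ` {y. br e y = 0} \<subseteq> {y. br e y = 0}"
    proof safe
      fix y assume "br e y = 0"
      then show "br e (br h y) = 0" using h_e[of y] by simp
    qed
    have "br n (proj h c y) = 0" for c
    proof -
      have g: "proj h c y \<in> gen h c" by (rule proj_mem)
      have "proj h c y \<in> {y. br e y = 0}"
        by (rule proj_invariant[OF sub inv]) (simp add: y)
      then have "br h (proj h c y) = c *s proj h c y" using ker_e_weight g by blast
      then show ?thesis by (simp add: n_def br_diff_left spart_gen[OF g])
    qed
    then have "br n (\<Sum>c\<in>spectrum (br h). proj h c y) = 0" by (simp add: br_sum_right)
    then show "br n y = 0" by (simp only: proj_sum[symmetric])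
  qed
  then obtain w0 where w0: "n = br e w0" using im_ad_perp by blast
  define w where "w = proj h (-2) w0"
  have wg: "w \<in> gen h (-2)" unfolding w_def by (rule proj_mem)
  have "proj h (-2 + 2) (br e w0) = br e w" unfolding w_def by (rule gen_proj_shift[OF e_gen])
  moreover have "n \<in> gen h 0" by (rule gen_eigenvector) (simp add: hn)
  ultimately have ew: "n = br e w" using proj_gen[of n h 0 0] w0 by simp
  have fe: "br f (br e w) = 0" using nf br_comm_0 ew by blast
  have "w = 0"
  proof (rule ccontr)
    assume "w \<noteq> 0"
    then obtain m where m: "(br f ^^ m) w \<noteq> 0" "br f ((br f ^^ m) w) = 0"
      using last_nonmember[of w "{0}" "CARD('n)" "br f"] f_nil by auto
    let ?z = "(br f ^^ m) w"
    have z: "(br f ^^ k) w \<in> gen h (- 2 - 2 * of_nat k)" for k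
    proof (induction k)
      case (Suc k)
      have "br f ((br f ^^ k) w) \<in> gen h (- 2 + (- 2 - 2 * of_nat k))" by (rule br_gen[OF f_gen Suc])
      then show ?case by (simp add: algebra_simps)
    qed (simp add: wg)
    have "(br f ^^ Suc m) (br e w) = (br f ^^ m) (br f (br e w))" by (simp only: funpow_Suc_right comp_apply)
    then have "(br f ^^ Suc m) (br e w) = 0" by (simp add: fe lin_0[OF lin_ad_pow])
    moreover have "(br f ^^ Suc m) w = 0" using m(2) by simp
    ultimately have "0 = br e 0 - of_nat (Suc m) *s (br h ?z + of_nat m *s ?z)"
      using fpow_e[of m w] by (simp only:)
    then have "0 = of_nat (Suc m) *s (br h ?z + of_nat m *s ?z)"
      by (simp only: br_0_right diff_0 neg_0_equal_iff_equal)
    then have "of_nat (Suc m) *s (br h ?z + of_nat m *s ?z) = 0" by (rule sym)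
    then have "br h ?z + of_nat m *s ?z = 0" by (simp only: vec.scale_eq_0_iff of_nat_eq_0_iff) simp
    then have "br h ?z = (- of_nat m) *s ?z" by (simp add: eq_neg_iff_add_eq_0)
    then have "?z \<in> gen h (- of_nat m)" by (rule gen_eigenvector)
    then have "- of_nat m = (- 2 - 2 * of_nat m :: 'k)" using gen_inter[OF _ z[of m]] m(1) by blast
    then have "of_nat (m + 2) = (0 :: 'k)" by (simp add: algebra_simps)
    then show False by (simp only: of_nat_eq_0_iff)
  qed
  then have "n = 0" using ew by simp
  then have "h = spart h" by (simp add: n_def)
  then show ?thesis using diag_spart by metis
qed

text \<open>Raising by e ends in the kernel of e, where weights are natural numbers.\<close>

lemma eigenvalue_h_int:
  assumes "gen h c \<noteq> {0}"
  shows "\<exists>j::int. c = of_int j"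
proof -
  obtain v where v: "v \<in> gen h c" "v \<noteq> 0"
    using assms vec.subspace_0[OF gen_subspace] by blast
  then obtain k where k: "(br e ^^ k) v \<noteq> 0" "br e ((br e ^^ k) v) = 0"
    using last_nonmember[of v "{0}" "CARD('n)" "br e"] e_nil by auto
  have g: "(br e ^^ k) v \<in> gen h (c + 2 * of_nat k)" for k
  proof (induction k)
    case (Suc k)
    have "br e ((br e ^^ k) v) \<in> gen h (2 + (c + 2 * of_nat k))" by (rule br_gen[OF e_gen Suc])
    then show ?case by (simp add: algebra_simps)
  qed (simp add: v)
  obtain n :: nat where "c + 2 * of_nat k = of_nat n"
    using ker_e_natural[OF k(2) ker_e_weight[OF k(2) g] k(1)] by blast
  then have "c = of_int (int n - 2 * int k)" by (simp add: algebra_simps)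
  then show ?thesis by blast
qed

section \<open>Weight spaces, their projections and the depth\<close>

abbreviation G :: "int \<Rightarrow> ('k^'n) set" where "G j \<equiv> eigsp br UNIV h j"

lemma G_iff: "v \<in> G j \<longleftrightarrow> br h v = of_int j *s v"
  by (simp add: eigsp_def)

lemma G_gen: "G j = gen h (of_int j)"
  using diag_gen[OF diag_h] by (auto simp: G_iff)

lemma subspace_G: "vec.subspace (G j)"
  unfolding G_gen by (rule gen_subspace)

lemma br_G: "u \<in> G i \<Longrightarrow> v \<in> G j \<Longrightarrow> br u v \<in> G (i + j)"
  using br_gen[of u h "of_int i" v "of_int j"] by (simp add: G_gen)

lemma G_induct:
  assumes "\<And>j x. x \<in> G j \<Longrightarrow> P x" "\<And>x y. P x \<Longrightarrow> P y \<Longrightarrow> P (x + y)"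
  shows "P v"
proof (induction v rule: gen_induct[OF lin_ad[of h] ac])
  case (1 c v)
  show ?case
  proof (cases "gen h c = {0}")
    case True
    then have "v \<in> G 0" using 1 vec.subspace_0[OF subspace_G] by simp
    then show ?thesis by (rule assms(1))
  next
    case False
    then obtain j where "c = of_int j" using eigenvalue_h_int by blast
    then show ?thesis using 1 assms(1)[of v j] by (simp add: G_gen)
  qed
qed (rule assms(2))

definition pr :: "int \<Rightarrow> 'k^'n \<Rightarrow> 'k^'n" where
  "pr j = proj h (of_int j)"

lemma lin_pr: "lin (pr j)" unfolding pr_def by (rule lin_proj)

lemma pr_mem: "pr j v \<in> G j" unfolding pr_def G_gen by (rule proj_mem)

lemma pr_G: "v \<in> G i \<Longrightarrow> pr j v = (if j = i then v else 0)"
  unfolding pr_def G_gen by (subst proj_gen) auto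

lemma pr_br: "x \<in> G i \<Longrightarrow> pr j (br x v) = br x (pr (j - i) v)"
  using gen_proj_shift[of x h "of_int i" "of_int (j - i)" v] by (simp add: pr_def G_gen)

lemma pr_in_invariant:
  assumes "vec.subspace M" "\<And>x. x \<in> M \<Longrightarrow> br h x \<in> M" "v \<in> M"
  shows "pr j v \<in> M"
  unfolding pr_def by (rule proj_invariant[OF assms(1) _ assms(3)]) (use assms(2) in blast)

lemma e_G: "e \<in> G 2"
  by (simp add: G_iff br_he)

lemma kap_G: "u \<in> G i \<Longrightarrow> v \<in> G j \<Longrightarrow> i + j \<noteq> 0 \<Longrightarrow> kap u v = 0"
proof -
  assume u: "u \<in> G i" and v: "v \<in> G j" and ij: "i + j \<noteq> 0"
  have "of_int i * kap u v = kap (br h u) v" using u by (simp add: G_iff kap_scale_left)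
  also have "\<dots> = - kap (br u h) v" by (subst br_swap) (rule kap_minus_left)
  also have "\<dots> = - (of_int j * kap u v)" using v by (simp add: kap_invariant G_iff kap_scale_right)
  finally have "of_int (i + j) * kap u v = 0" by (simp add: algebra_simps)
  then show ?thesis using ij by (simp only: mult_eq_0_iff of_int_eq_0_iff) simp
qed

lemma kap_pr: "u \<in> G i \<Longrightarrow> kap u v = kap u (pr (- i) v)"
proof (induction v rule: G_induct)
  case (1 j v)
  then show ?case using kap_G[OF 1(2,1)] by (cases "j = - i") (auto simp: pr_G)
next
  case (2 v w) then show ?case by (simp add: kap_add_right lin_add[OF lin_pr])
qed

abbreviation d :: int where "d \<equiv> depth br UNIV h"

lemma finite_weights: "finite {j. G j \<noteq> {0}}"
proof -
  have "finite ((of_int :: int \<Rightarrow> 'k) ` {j. G j \<noteq> {0}})"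
    by (rule finite_subset[OF _ finite_gen_spectrum[OF lin_ad[of h]]]) (auto simp: G_gen)
  then show ?thesis by (rule finite_imageD) (auto simp: inj_on_def)
qed

lemma G_le_depth: "G j \<noteq> {0} \<Longrightarrow> j \<le> d"
  unfolding depth_def using finite_weights by (intro Max_ge) auto

lemma two_le_depth: "2 \<le> d"
  using e_G e0 by (intro G_le_depth) blast

text \<open>The Killing form pairs weight j only with weight -j.\<close>

lemma G_neg: "G j = {0}" if "G (- j) = {0}"
proof -
  have "u = 0" if u: "u \<in> G j" for u
  proof (rule kap_nondeg)
    fix v
    show "kap u v = 0" using kap_pr[OF u, of v] pr_mem[of "- j" v] \<open>G (- j) = {0}\<close> by simp
  qed
  then show ?thesis using vec.subspace_0[OF subspace_G] by auto
qed

lemma G_zero: "d < j \<or> j < - d \<Longrightarrow> G j = {0}"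
  using G_le_depth[of j] G_le_depth[of "- j"] G_neg[of j] by force

lemma pr_out: "d < j \<or> j < - d \<Longrightarrow> pr j v = 0"
  using G_zero[of j] pr_mem[of j v] by auto

text \<open>[x, f] is killed by e and has weight -2, which is not a natural number.\<close>

lemma centralizes_triple:
  assumes x: "x \<in> G 0" "br x e = 0"
  shows "br x h = 0" "br x f = 0"
proof -
  show xh: "br x h = 0" using x(1) br_comm_0 by (simp add: G_iff)
  have ex: "br e x = 0" using x(2) br_comm_0 by blast
  have "br e (br x f) = br (br e x) f + br x (br e f)" by (rule jacobi)
  then have z: "br e (br x f) = 0" by (simp add: ex br_ef xh)
  have "br h (br x f) = br (br h x) f + br x (br h f)" by (rule jacobi)
  then have w: "br h (br x f) = (- 2) *s br x f"
    using x(1) br_scale_right[of x "-2" f] by (simp add: G_iff br_hf)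
  show "br x f = 0"
  proof (rule ccontr)
    assume "br x f \<noteq> 0"
    then obtain n :: nat where "(- 2 :: 'k) = of_nat n" using ker_e_natural[OF z w] by blast
    then have "of_nat (n + 2) = (0 :: 'k)" by (metis add.left_inverse add.commute of_nat_add of_nat_numeral)
    then show False by (simp only: of_nat_eq_0_iff)
  qed
qed

end

section \<open>Polynomial functions and curves\<close>

lemma polyfun_sum: "(\<And>i. i \<in> I \<Longrightarrow> p i \<in> polyfun) \<Longrightarrow> (\<lambda>x. \<Sum>i\<in>I. p i x) \<in> polyfun"
  by (induction I rule: infinite_finite_induct) (auto intro: polyfun.intros)

lemma polyfun_prod: "(\<And>i. i \<in> I \<Longrightarrow> p i \<in> polyfun) \<Longrightarrow> (\<lambda>x. \<Prod>i\<in>I. p i x) \<in> polyfun"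
  by (induction I rule: infinite_finite_induct) (auto intro: polyfun.intros)

lemma polyfun_lin:
  assumes f: "lin f" and p: "\<And>i. (\<lambda>x. p x $ i) \<in> polyfun"
  shows "(\<lambda>x. f (p x) $ i) \<in> polyfun"
proof -
  have eq: "(\<lambda>x. f (p x) $ i) = (\<lambda>x. \<Sum>j\<in>UNIV. p x $ j * f (axis j 1) $ i)"
    by (rule ext) (rule linear_componentwise[OF f])
  show ?thesis by (subst eq) (rule polyfun_sum, rule polyfun.pmult[OF p polyfun.pconst])
qed

lemma polyfun_det:
  assumes "\<And>i j. (\<lambda>x. M x $ i $ j) \<in> polyfun"
  shows "(\<lambda>x. det (M x)) \<in> polyfun"
  unfolding det_def
  by (rule polyfun_sum) (rule polyfun.pmult[OF polyfun.pconst polyfun_prod[OF assms]])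

lemma polyfun_vec_add:
  "(\<And>i. (\<lambda>x. p x $ i) \<in> polyfun) \<Longrightarrow> (\<And>i. (\<lambda>x. q x $ i) \<in> polyfun) \<Longrightarrow> (\<lambda>x. (p x + q x) $ i) \<in> polyfun"
  by (simp add: polyfun.padd)

lemma lin_projection:
  fixes W :: "('k::field^'n::finite) set"
  assumes W: "vec.subspace W"
  shows "\<exists>P. lin P \<and> (\<forall>w\<in>W. P w = w) \<and> range P \<subseteq> W"
proof -
  obtain B where B: "B \<subseteq> W" "vec.independent B" "W \<subseteq> vec.span B" "card B = vec.dim W"
    by (rule vec.basis_exists[of W])
  have sp: "vec.span B = W" by (rule antisym[OF vec.span_minimal[OF B(1) W] B(3)])
  let ?P = "vec.construct B (\<lambda>b. b)"
  have l: "lin ?P" by (rule vec.linear_construct[OF B(2)])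
  have l': "lin (\<lambda>v. ?P v - 1 *s v)" by (rule lin_shift[OF l])
  have id: "?P w = w" if "w \<in> vec.span B" for w
  proof -
    have "?P w - 1 *s w \<in> {0}"
      by (rule lin_span_mem[OF l' vec.subspace_single_0 _ that]) (simp add: vec.construct_basis[OF B(2)])
    then show ?thesis by simp
  qed
  have "?P v \<in> vec.span B" for v
    using vec.construct_in_span[OF B(2), of "\<lambda>b. b" v] by simp
  then show ?thesis using l id sp by (intro exI[of _ ?P]) auto
qed

text \<open>Compressing \<open>A x\<close> by a left inverse of \<open>A F\<close> gives an endomorphism whose determinant is the
  required polynomial.\<close>

lemma injective_open:
  fixes A :: "'k::field^'n::finite \<Rightarrow> 'k^'n \<Rightarrow> 'k^'n"
  assumes W: "vec.subspace W" and A: "\<And>x. lin (A x)" and pA: "\<And>v i. (\<lambda>x. A x v $ i) \<in> polyfun"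
    and inj: "\<And>w. w \<in> W \<Longrightarrow> A F w = 0 \<Longrightarrow> w = 0"
  shows "\<exists>p\<in>polyfun. p F \<noteq> 0 \<and> (\<forall>x. p x \<noteq> 0 \<longrightarrow> (\<forall>w\<in>W. A x w = 0 \<longrightarrow> w = 0))"
proof -
  obtain P where P0: "lin P \<and> (\<forall>w\<in>W. P w = w) \<and> range P \<subseteq> W"
    using lin_projection[OF W] ..
  then have P: "lin P" "\<And>w. w \<in> W \<Longrightarrow> P w = w" "\<And>v. P v \<in> W" by auto
  have "inj_on (A F) W"
  proof (rule inj_onI)
    fix x y assume xy: "x \<in> W" "y \<in> W" "A F x = A F y"
    have "x - y \<in> W" using xy vec.subspace_diff[OF W] by blast
    then have "x - y = 0" by (rule inj) (simp add: lin_diff[OF A] xy(3))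
    then show "x = y" by simp
  qed
  then obtain g where g: "lin g" "\<And>w. w \<in> W \<Longrightarrow> g (A F w) = w"
    using vec.linear_exists_left_inverse_on[OF A W, of F] by auto
  \<comment> \<open>The summand v - P v makes \<open>N F\<close> the identity on the whole space, so
    an ordinary determinant applies.\<close>
  define N where "N x v = P (g (A x (P v))) + (v - P v)" for x v
  have lN: "lin (N x)" for x unfolding N_def
    by (rule linI) (simp_all add: lin_add[OF P(1)] lin_add[OF g(1)] lin_add[OF A]
        lin_scale[OF P(1)] lin_scale[OF g(1)] lin_scale[OF A] vec.scale_right_distrib
        vec.scale_right_diff_distrib algebra_simps)
  have "N F = id" by (rule ext) (simp add: N_def P g)
  then have F1: "det (matrix (N F)) = 1" by (simp add: matrix_id_mat_1)
  let ?p = "\<lambda>x. det (matrix (N x))"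
  have "?p \<in> polyfun"
  proof (rule polyfun_det)
    fix i j
    have "(\<lambda>x. N x (axis j 1) $ i) \<in> polyfun" unfolding N_def
      by (rule polyfun_vec_add[OF polyfun_lin[OF P(1) polyfun_lin[OF g(1) pA]] polyfun.pconst])
    then show "(\<lambda>x. matrix (N x) $ i $ j) \<in> polyfun" by (simp add: matrix_def)
  qed
  moreover have "w = 0" if "?p x \<noteq> 0" "w \<in> W" "A x w = 0" for x w
  proof -
    have "matrix (N x) *v w = 0"
      using that by (simp add: matrix_works[OF lN]) (simp add: N_def P lin_0[OF P(1)] lin_0[OF g(1)])
    moreover have "\<exists>B. B ** matrix (N x) = mat 1"
      using that(1) by (metis invertible_det_nz invertible_left_inverse)
    ultimately show ?thesis using matrix_left_invertible_ker by blast
  qed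
  ultimately show ?thesis using F1 by (intro bexI[of _ ?p]) auto
qed

section \<open>Polynomial curves and vanishing along them\<close>

definition polycurve :: "('k::field \<Rightarrow> 'k^'n::finite) \<Rightarrow> bool" where
  "polycurve w \<longleftrightarrow> (\<forall>i. \<exists>P. \<forall>s. w s $ i = poly P s)"

lemma polycurve_const: "polycurve (\<lambda>s. v)"
  unfolding polycurve_def by (metis poly_0 poly_pCons mult_zero_right add.right_neutral)

lemma polycurve_add: "polycurve v \<Longrightarrow> polycurve w \<Longrightarrow> polycurve (\<lambda>s. v s + w s)"
  unfolding polycurve_def by (metis poly_add vector_add_component)

lemma polycurve_scale: "polycurve w \<Longrightarrow> polycurve (\<lambda>s. poly P s *s w s)"
  unfolding polycurve_def by (metis poly_mult vector_smult_component)

lemma polycurve_sum: "(\<And>i. i \<in> I \<Longrightarrow> polycurve (w i)) \<Longrightarrow> polycurve (\<lambda>s. \<Sum>i\<in>I. w i s)"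
  by (induction I rule: infinite_finite_induct) (simp_all add: polycurve_const polycurve_add)

lemma polycurve_lin:
  assumes f: "lin f" and w: "polycurve w"
  shows "polycurve (\<lambda>s. f (w s))"
  unfolding polycurve_def
proof
  fix i
  obtain P where P: "\<And>j s. w s $ j = poly (P j) s" using w unfolding polycurve_def by metis
  have "f (w s) $ i = poly (\<Sum>j\<in>UNIV. P j * [:f (axis j 1) $ i:]) s" for s
    by (subst linear_componentwise[OF f]) (simp add: P poly_sum mult.commute)
  then show "\<exists>P. \<forall>s. f (w s) $ i = poly P s" by blast
qed

lemma polyfun_polycurve:
  assumes "p \<in> polyfun" "polycurve w"
  shows "\<exists>P. \<forall>s. p (w s) = poly P s"
  using assms(1)
proof induction
  case (pconst c) then show ?case by (intro exI[of _ "[:c:]"]) simp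
next
  case (pcoord i) then show ?case using assms(2) by (auto simp: polycurve_def)
next
  case (padd p q)
  then obtain P Q where "\<forall>s. p (w s) = poly P s" "\<forall>s. q (w s) = poly Q s" by blast
  then show ?case by (intro exI[of _ "P + Q"]) simp
next
  case (pmult p q)
  then obtain P Q where "\<forall>s. p (w s) = poly P s" "\<forall>s. q (w s) = poly Q s" by blast
  then show ?case by (intro exI[of _ "P * Q"]) simp
qed

lemma polycurve_line: "polycurve (\<lambda>s. F + s *s v)"
  using polycurve_add[OF polycurve_const polycurve_scale[OF polycurve_const, of "[:0, 1:]"], of F v] by simp

lemma poly_zero_if_cofinite:
  fixes P :: "'k::field_char_0 poly"
  assumes "\<And>s. s \<noteq> 0 \<Longrightarrow> poly P s = 0"
  shows "P = 0"
proof (rule ccontr)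
  assume "P \<noteq> 0"
  then have "finite {s. poly P s = 0}" by (rule poly_roots_finite)
  then have "finite (insert 0 {s. poly P s = 0})" by simp
  moreover have "insert 0 {s. poly P s = 0} = UNIV" using assms by auto
  ultimately show False using infinite_UNIV_char_0 by metis
qed

lemma polyfun_nonzero_on_line:
  fixes F v :: "'k::field_char_0^'n::finite"
  assumes "p \<in> polyfun" "p F \<noteq> 0"
  shows "\<exists>s. s \<noteq> 0 \<and> p (F + s *s v) \<noteq> 0"
proof (rule ccontr)
  assume no: "\<not> ?thesis"
  obtain P where P: "\<And>s. p (F + s *s v) = poly P s"
    using polyfun_polycurve[OF assms(1) polycurve_line[of F v]] by blast
  have "P = 0" by (rule poly_zero_if_cofinite) (use no P in metis)
  then show False using P[of 0] assms(2) by simp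
qed

text \<open>Taylor expansion at F in direction u. The degree bound is uniform in u, so that all
  expansions are sums over one range.\<close>

lemma polyfun_expansion:
  fixes F :: "'k::field_char_0^'n::finite"
  assumes "p \<in> polyfun"
  shows "\<exists>Q N. (\<forall>u s. p (F + s *s u) = poly (Q u) s) \<and> (\<forall>u. degree (Q u) \<le> N) \<and>
      (\<forall>j. (\<lambda>u. coeff (Q u) j) \<in> polyfun)"
  using assms
proof induction
  case (pconst c)
  show ?case
    by (intro exI[of _ "\<lambda>u. [:c:]"] exI[of _ 0]) (auto intro: polyfun.pconst)
next
  case (pcoord i)
  have "(\<lambda>u. coeff [:F $ i, u $ i:] j) \<in> polyfun" for j
  proof (cases j)
    case (Suc j')
    then show ?thesis by (cases j') (auto intro: polyfun.intros)
  qed (auto intro: polyfun.intros)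
  then show ?case
    by (intro exI[of _ "\<lambda>u. [:F $ i, u $ i:]"] exI[of _ 1]) auto
next
  case (padd p q)
  then obtain P M Q N where
    "\<And>u s. p (F + s *s u) = poly (P u) s" "\<And>u. degree (P u) \<le> M" "\<And>j. (\<lambda>u. coeff (P u) j) \<in> polyfun"
    "\<And>u s. q (F + s *s u) = poly (Q u) s" "\<And>u. degree (Q u) \<le> N" "\<And>j. (\<lambda>u. coeff (Q u) j) \<in> polyfun"
    by metis
  moreover have "degree (P u + Q u) \<le> max M N" for u
    by (rule degree_add_le) (use \<open>degree (P u) \<le> M\<close> \<open>degree (Q u) \<le> N\<close> in auto)
  ultimately show ?case
    by (intro exI[of _ "\<lambda>u. P u + Q u"] exI[of _ "max M N"]) (auto intro: polyfun.padd)
next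
  case (pmult p q)
  then obtain P M Q N where PQ:
    "\<And>u s. p (F + s *s u) = poly (P u) s" "\<And>u. degree (P u) \<le> M" "\<And>j. (\<lambda>u. coeff (P u) j) \<in> polyfun"
    "\<And>u s. q (F + s *s u) = poly (Q u) s" "\<And>u. degree (Q u) \<le> N" "\<And>j. (\<lambda>u. coeff (Q u) j) \<in> polyfun"
    by metis
  have "degree (P u * Q u) \<le> M + N" for u
    using degree_mult_le[of "P u" "Q u"] PQ(2)[of u] PQ(5)[of u] by linarith
  moreover have "(\<lambda>u. coeff (P u * Q u) j) \<in> polyfun" for j
    unfolding coeff_mult by (rule polyfun_sum) (rule polyfun.pmult[OF PQ(3) PQ(6)])
  ultimately show ?case
    using PQ(1,4) by (intro exI[of _ "\<lambda>u. P u * Q u"] exI[of _ "M + N"]) simp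
qed

text \<open>The lowest nonvanishing homogeneous part of \<open>p\<close> at \<open>F\<close> would have to vanish in every direction
  \<open>v\<close>.\<close>

lemma polyfun_vanishing_on_curves:
  fixes F :: "'k::field_char_0^'n::finite"
  assumes p: "p \<in> polyfun" "\<And>x. x \<in> A \<Longrightarrow> p x = 0"
    and curves: "\<And>v. v \<in> V \<Longrightarrow> \<exists>w. polycurve w \<and> w 0 = v \<and> (\<forall>s. w s \<in> V \<and> F + s *s w s \<in> A)"
    and u: "u \<in> V"
  shows "p (F + u) = 0"
proof -
  obtain Q N where Q: "\<And>u s. p (F + s *s u) = poly (Q u) s" "\<And>u. degree (Q u) \<le> N"
    "\<And>j. (\<lambda>u. coeff (Q u) j) \<in> polyfun" using polyfun_expansion[OF p(1), of F] by metis
  have Qsum: "poly (Q u) s = (\<Sum>i\<le>N. coeff (Q u) i * s ^ i)" for u s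
  proof -
    have "(\<Sum>i\<le>degree (Q u). coeff (Q u) i * s ^ i) = (\<Sum>i\<le>N. coeff (Q u) i * s ^ i)"
      by (rule sum.mono_neutral_left) (use Q(2)[of u] in \<open>auto simp: coeff_eq_0\<close>)
    then show ?thesis by (simp add: poly_altdef)
  qed
  have "coeff (Q v) j = 0" if "v \<in> V" for v j
    using that
  proof (induction j arbitrary: v rule: less_induct)
    case (less j)
    show ?case
    proof (cases "j \<le> N")
      case False
      then show ?thesis using Q(2)[of v] by (intro coeff_eq_0) linarith
    next
      case jN: True
      obtain w where w: "polycurve w" "w 0 = v" "\<And>s. w s \<in> V" "\<And>s. F + s *s w s \<in> A"
        using curves[OF less.prems] by blast
      have "\<forall>i. \<exists>C. \<forall>s. coeff (Q (w s)) i = poly C s" using polyfun_polycurve[OF Q(3) w(1)] by blast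
      then obtain C where C: "\<And>i s. coeff (Q (w s)) i = poly (C i) s" by metis
      \<comment> \<open>The curve w stays in V, so by induction the coefficients below j vanish
        along it. \<open>R\<close> is the remaining expansion divided by s^j; its value at 0 is the
        j-th coefficient at w(0) = v.\<close>
      define R where "R = (\<Sum>i\<in>{j..N}. C i * monom 1 (i - j))"
      have "poly R s = 0" if s: "s \<noteq> 0" for s
      proof -
        have "0 = p (F + s *s w s)" using p(2)[OF w(4)] by simp
        also have "\<dots> = (\<Sum>i\<le>N. coeff (Q (w s)) i * s ^ i)" by (simp only: Q(1) Qsum)
        also have "\<dots> = (\<Sum>i\<in>{j..N}. coeff (Q (w s)) i * s ^ i)"
        proof (rule sum.mono_neutral_right)
          show "\<forall>i\<in>{..N} - {j..N}. coeff (Q (w s)) i * s ^ i = 0"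
          proof
            fix i assume "i \<in> {..N} - {j..N}"
            then have "i < j" by auto
            then show "coeff (Q (w s)) i * s ^ i = 0" using less.IH[OF _ w(3)] by simp
          qed
        qed auto
        also have "\<dots> = (\<Sum>i\<in>{j..N}. s ^ j * (poly (C i) s * s ^ (i - j)))"
        proof (rule sum.cong)
          fix i assume "i \<in> {j..N}"
          then have "s ^ i = s ^ j * s ^ (i - j)" by (simp flip: power_add)
          then show "coeff (Q (w s)) i * s ^ i = s ^ j * (poly (C i) s * s ^ (i - j))" by (simp add: C)
        qed simp
        also have "\<dots> = s ^ j * poly R s" by (simp add: R_def poly_sum poly_monom sum_distrib_left)
        finally show ?thesis using s by simp
      qed
      then have "R = 0" by (rule poly_zero_if_cofinite)
      then have "0 = poly R 0" by simp
      also have "\<dots> = (\<Sum>i\<in>{j..N}. if i = j then poly (C j) 0 else 0)"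
        unfolding R_def poly_sum by (rule sum.cong) (auto simp: poly_monom power_0_left)
      also have "\<dots> = poly (C j) 0" using jN by simp
      finally show ?thesis using C[of 0 j] w(2) by simp
    qed
  qed
  then have "poly (Q u) 1 = 0" using u by (simp add: Qsum)
  then show ?thesis using Q(1)[of 1 u] by simp
qed

section \<open>Exponentials of nilpotent inner derivations\<close>

context lie_alg begin

lemma ad_nilpotent_iff: "ad_nilpotent br UNIV x \<longleftrightarrow> ad_nil x"
proof
  assume "ad_nilpotent br UNIV x"
  then obtain k where "\<And>y. (br x ^^ k) y = 0" by (auto simp: ad_nilpotent_def)
  then show "ad_nil x" unfolding ad_nil_def using funpow_vanish_dim[OF lin_ad] by blast
qed (auto simp: ad_nilpotent_def ad_nil_def)

lemma lin_exp_ad: "lin (exp_ad br x)"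
  unfolding exp_ad_def
  by (rule linI) (simp_all add: lin_add[OF lin_ad_pow] lin_scale[OF lin_ad_pow]
      vec.scale_right_distrib sum.distrib vec.scale_sum_right vector_smult_assoc mult.commute)

text \<open>Divided powers absorb the binomial coefficients. The inductive step multiplies by k + 1
  and splits this as i + (k + 1 - i).\<close>

lemma leibniz:
  "inverse (fact k) *s (br x ^^ k) (br u v) =
    (\<Sum>i\<le>k. br (inverse (fact i) *s (br x ^^ i) u) (inverse (fact (k - i)) *s (br x ^^ (k - i)) v))"
proof (induction k)
  case (Suc k)
  let ?u = "\<lambda>i. inverse (fact i) *s (br x ^^ i) u" and ?v = "\<lambda>i. inverse (fact i) *s (br x ^^ i) v"
  have step: "br x (inverse (fact i) *s (br x ^^ i) w) = of_nat (Suc i) *s (inverse (fact (Suc i)) *s (br x ^^ Suc i) w)"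
    for i w
  proof -
    have "of_nat (Suc i) * inverse (fact (Suc i)) = (inverse (fact i) :: 'k)"
      by (simp add: divide_simps del: of_nat_Suc)
    then show ?thesis by (simp only: br_scale_right vector_smult_assoc funpow.simps comp_apply)
  qed
  have "of_nat (Suc k) *s (inverse (fact (Suc k)) *s (br x ^^ Suc k) (br u v))
      = br x (inverse (fact k) *s (br x ^^ k) (br u v))" by (rule step[symmetric])
  also have "\<dots> = (\<Sum>i\<le>k. br x (br (?u i) (?v (k - i))))" by (simp only: Suc br_sum_right)
  also have "\<dots> = (\<Sum>i\<le>k. of_nat (Suc i) *s br (?u (Suc i)) (?v (k - i))
      + of_nat (Suc (k - i)) *s br (?u i) (?v (Suc (k - i))))"
    by (simp only: jacobi[of x] step br_scale_left[of "of_nat _"] br_scale_right[of _ "of_nat _"])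
  also have "\<dots> = (\<Sum>i\<le>k. of_nat (Suc i) *s br (?u (Suc i)) (?v (Suc k - Suc i)))
      + (\<Sum>i\<le>k. of_nat (Suc k - i) *s br (?u i) (?v (Suc k - i)))"
    unfolding sum.distrib by (intro arg_cong2[where f = "(+)"] sum.cong) (auto simp: Suc_diff_le)
  also have "(\<Sum>i\<le>k. of_nat (Suc i) *s br (?u (Suc i)) (?v (Suc k - Suc i)))
      = (\<Sum>i\<le>Suc k. of_nat i *s br (?u i) (?v (Suc k - i)))"
    unfolding sum.atMost_Suc_shift by simp
  also have "(\<Sum>i\<le>k. of_nat (Suc k - i) *s br (?u i) (?v (Suc k - i)))
      = (\<Sum>i\<le>Suc k. of_nat (Suc k - i) *s br (?u i) (?v (Suc k - i)))" by simp
  also have "(\<Sum>i\<le>Suc k. of_nat i *s br (?u i) (?v (Suc k - i)))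
      + (\<Sum>i\<le>Suc k. of_nat (Suc k - i) *s br (?u i) (?v (Suc k - i)))
      = (\<Sum>i\<le>Suc k. of_nat (Suc k) *s br (?u i) (?v (Suc k - i)))"
    unfolding sum.distrib[symmetric]
    by (rule sum.cong) (auto simp: vec.scale_left_distrib[symmetric] of_nat_add[symmetric] simp del: of_nat_add of_nat_Suc)
  also have "\<dots> = of_nat (Suc k) *s (\<Sum>i\<le>Suc k. br (?u i) (?v (Suc k - i)))"
    by (simp only: vec.scale_sum_right)
  finally show ?case by (simp only: vec.scale_cancel_left of_nat_eq_0_iff) simp
qed simp

lemma exp_ad_br:
  assumes x: "ad_nil x"
  shows "exp_ad br x (br u v) = br (exp_ad br x u) (exp_ad br x v)"
proof -
  let ?N = "CARD('n)"
  let ?D = "\<lambda>k w. inverse (fact k) *s (br x ^^ k) w"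
  have z: "(br x ^^ k) w = 0" if "?N \<le> k" for k w
    using funpow_vanish_dim[OF lin_ad _ that] x unfolding ad_nil_def by blast
  \<comment> \<open>With the bound doubled, the triangle of index pairs contains the full square of
    the product of two exponentials; outside the square one factor vanishes.\<close>
  have "exp_ad br x (br u v) = (\<Sum>k\<le>2 * ?N. ?D k (br u v))"
    unfolding exp_ad_def by (rule sum.mono_neutral_left) (auto simp: z)
  also have "\<dots> = (\<Sum>k\<le>2 * ?N. \<Sum>i\<le>k. br (?D i u) (?D (k - i) v))" by (simp only: leibniz)
  also have "\<dots> = (\<Sum>(i,j)\<in>{(i,j). i + j \<le> 2 * ?N}. br (?D i u) (?D j v))"
    by (rule sum.triangle_reindex_eq[symmetric])
  also have "\<dots> = (\<Sum>(i,j)\<in>{..?N} \<times> {..?N}. br (?D i u) (?D j v))"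
  proof (rule sum.mono_neutral_right)
    have "{(i,j). i + j \<le> 2 * ?N} \<subseteq> {..2 * ?N} \<times> {..2 * ?N}" by auto
    then show "finite {(i,j). i + j \<le> 2 * ?N}" by (rule finite_subset) simp
    show "\<forall>ij\<in>{(i,j). i + j \<le> 2 * ?N} - {..?N} \<times> {..?N}. (case ij of (i,j) \<Rightarrow> br (?D i u) (?D j v)) = 0"
    proof
      fix ij assume *: "ij \<in> {(i,j). i + j \<le> 2 * ?N} - {..?N} \<times> {..?N}"
      obtain i j where ij: "ij = (i, j)" by (cases ij)
      have "?N \<le> i \<or> ?N \<le> j" using * unfolding ij by auto
      then show "(case ij of (i,j) \<Rightarrow> br (?D i u) (?D j v)) = 0"
        unfolding ij by (elim disjE) (simp_all add: z)
    qed
  qed auto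
  also have "\<dots> = br (exp_ad br x u) (exp_ad br x v)"
    unfolding exp_ad_def br_sum_left by (simp only: br_sum_right sum.cartesian_product)
  finally show ?thesis .
qed

lemma adjoint_group_br:
  assumes "\<phi> \<in> adjoint_group br"
  shows "lin \<phi> \<and> (\<forall>u v. \<phi> (br u v) = br (\<phi> u) (\<phi> v))"
  using assms
proof induction
  case ag_id then show ?case by (auto intro: linI)
next
  case (ag_step \<phi> x)
  have l: "lin \<phi>" using ag_step by blast
  have "lin (exp_ad br x \<circ> \<phi>)" using lin_compose[OF lin_exp_ad l] by (simp add: comp_def)
  moreover have "(exp_ad br x \<circ> \<phi>) (br u v) = br ((exp_ad br x \<circ> \<phi>) u) ((exp_ad br x \<circ> \<phi>) v)" for u v
    using ag_step by (simp add: exp_ad_br ad_nilpotent_iff)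
  ultimately show ?case by blast
qed

lemma ad_nil_scale: "ad_nil x \<Longrightarrow> ad_nil (s *s x)"
proof -
  assume x: "ad_nil x"
  have "(br (s *s x) ^^ k) v = s ^ k *s (br x ^^ k) v" for k v
    by (induction k) (auto simp: br_scale_left br_scale_right vector_smult_assoc mult.commute)
  then show ?thesis using x by (simp add: ad_nil_def)
qed

lemma exp_ad_fix:
  assumes "br x v = 0"
  shows "exp_ad br x v = v"
proof -
  have "(br x ^^ k) v = (if k = 0 then v else 0)" for k
    by (induction k) (auto simp: assms)
  then have "exp_ad br x v = (\<Sum>k\<le>CARD('n). if k = 0 then v else 0)"
    unfolding exp_ad_def by (intro sum.cong) auto
  then show ?thesis by simp
qed

text \<open>The factor exp(s x) adds [x, F] to the velocity at s = 0. The new \<open>w'\<close> is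
  (exp(s x)(F + s w(s)) - F)/s, which is polynomial in s.\<close>

lemma exp_ad_curve:
  fixes x F :: "'k^'n"
  assumes w: "polycurve w" and V: "vec.subspace V" "\<And>v. v \<in> V \<Longrightarrow> br x v \<in> V" "F \<in> V" "\<And>s. w s \<in> V"
  shows "\<exists>w'. polycurve w' \<and> w' 0 = w 0 + br x F \<and>
      (\<forall>s. w' s \<in> V \<and> exp_ad br (s *s x) (F + s *s w s) = F + s *s w' s)"
proof -
  let ?N = "CARD('n)"
  define w' where "w' s = w s + (\<Sum>k<?N. poly (monom (inverse (fact (Suc k))) k) s *s (br x ^^ Suc k) (F + s *s w s))" for s
  have Fw: "polycurve (\<lambda>s. F + s *s w s)"
    using polycurve_add[OF polycurve_const polycurve_scale[OF w, of "[:0, 1:]"], of F] by simp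
  have "polycurve w'" unfolding w'_def
    by (intro polycurve_add w polycurve_sum polycurve_scale polycurve_lin[OF lin_ad_pow Fw])
  moreover have "w' 0 = w 0 + br x F"
  proof -
    have "(\<Sum>k<?N. poly (monom (inverse (fact (Suc k))) k) 0 *s (br x ^^ Suc k) (F + 0 *s w 0))
        = (\<Sum>k<?N. if k = 0 then br x F else 0)"
      by (rule sum.cong) (auto simp: poly_monom power_0_left)
    also have "\<dots> = br x F" by simp
    finally show ?thesis by (simp add: w'_def)
  qed
  moreover have "w' s \<in> V" for s
  proof -
    have pw: "(br x ^^ k) v \<in> V" if "v \<in> V" for k v using that V(2) by (induction k) auto
    show ?thesis unfolding w'_def
      by (intro pw vec.subspace_add[OF V(1)] vec.subspace_sum[OF V(1)] vec.subspace_scale[OF V(1)] V)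
  qed
  moreover have "exp_ad br (s *s x) (F + s *s w s) = F + s *s w' s" for s
  proof -
    let ?v = "F + s *s w s"
    have pow: "(br (s *s x) ^^ k) v = s ^ k *s (br x ^^ k) v" for k v
      by (induction k) (auto simp: br_scale_left br_scale_right vector_smult_assoc mult.commute)
    have "exp_ad br (s *s x) ?v = (\<Sum>k\<le>?N. (inverse (fact k) * s ^ k) *s (br x ^^ k) ?v)"
      unfolding exp_ad_def pow vector_smult_assoc ..
    also have "\<dots> = ?v + (\<Sum>k<?N. (inverse (fact (Suc k)) * s ^ Suc k) *s (br x ^^ Suc k) ?v)"
      by (subst sum.atMost_shift) simp
    also have "(\<Sum>k<?N. (inverse (fact (Suc k)) * s ^ Suc k) *s (br x ^^ Suc k) ?v)
        = s *s (\<Sum>k<?N. poly (monom (inverse (fact (Suc k))) k) s *s (br x ^^ Suc k) ?v)"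
      unfolding vec.scale_sum_right vector_smult_assoc
      by (rule sum.cong) (simp_all add: poly_monom mult_ac)
    finally show ?thesis by (simp only: w'_def vec.scale_right_distrib add.assoc)
  qed
  ultimately show ?thesis by blast
qed

end

section \<open>The reducing subalgebra\<close>

context semisimple_alg begin

lemma diag_0: "diag 0"
  by (rule diagI, rule vec.span_base) (auto intro: exI[of _ 0])

text \<open>Kernel and image of a semisimple ad x meet only in 0.\<close>

lemma diag_square: "diag x \<Longrightarrow> br x (br x u) = 0 \<Longrightarrow> br x u = 0"
proof -
  assume x: "diag x" and "br x (br x u) = 0"
  then have "((\<lambda>v. br x v - 0 *s v) ^^ 2) u = 0" by (simp add: numeral_2_eq_2)
  then have "u \<in> gen x 0" unfolding gen_eigenspace_def by blast
  then show ?thesis using diag_gen[OF x] by simp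
qed

lemma diag_split:
  assumes x: "diag x"
  shows "\<exists>c y. u = c + br x y \<and> br x c = 0"
proof (induction u rule: gen_induct[OF lin_ad[of x] ac])
  case (1 c u)
  then have u: "br x u = c *s u" using diag_gen[OF x] by blast
  show ?case
  proof (cases "c = 0")
    case True
    then have "u = u + br x 0 \<and> br x u = 0" using u by simp
    then show ?thesis by blast
  next
    case False
    then have "u = 0 + br x (inverse c *s u) \<and> br x 0 = 0"
      by (simp add: br_scale_right u inverse_scale)
    then show ?thesis by blast
  qed
next
  case (2 u v)
  then obtain c y c' y' where "u = c + br x y" "br x c = 0" "v = c' + br x y'" "br x c' = 0" by blast
  then have "u + v = (c + c') + br x (y + y') \<and> br x (c + c') = 0" by (simp add: br_add_right)
  then show ?case by blast
qed

lemma nondeg_on_UNIV: "nondeg_on UNIV"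
  using kap_nondeg by (auto simp: nondeg_on_def)

lemma subalgebra_centralizer: "subalgebra br {v. br x v = 0}"
proof -
  have "br x (br u v) = 0" if "br x u = 0" "br x v = 0" for u v
    using jacobi[of x u v] that by simp
  then show ?thesis using vec.linear_subspace_kernel[OF lin_ad] by (simp add: subalgebra_def)
qed

lemma nondeg_on_full_centralizer: "diag x \<Longrightarrow> nondeg_on {v. br x v = 0}"
  using nondeg_on_centralizer[OF vec.subspace_UNIV nondeg_on_UNIV] by simp

end

locale semisimple_type_alg = sl2_alg br e h f
  for br :: "('k::field_char_0,'n::finite) bracket" and e h f +
  fixes U
  assumes U_open: "zariski_open_in (eigsp br UNIV h (- depth br UNIV h)) U" and U_ne: "U \<noteq> {}"
    and U_ss: "\<And>F. F \<in> U \<Longrightarrow> semisimple_elt br UNIV (e + F)"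
begin

section \<open>The lowest component and its stabilizers\<close>

abbreviation V :: "('k^'n) set" where "V \<equiv> G (- d)"

lemma U_V: "F \<in> U \<Longrightarrow> F \<in> V"
  using U_open by (auto simp: zariski_open_in_def)

lemma U_poly:
  assumes "F \<in> U"
  shows "\<exists>p\<in>polyfun. p F \<noteq> 0 \<and> (\<forall>x\<in>V. p x \<noteq> 0 \<longrightarrow> x \<in> U)"
proof -
  obtain S where S: "S \<subseteq> polyfun" "V - U = {x \<in> V. \<forall>p\<in>S. p x = 0}"
    using U_open by (auto simp: zariski_open_in_def zariski_closed_in_def)
  have "F \<notin> V - U" using assms by blast
  then have "\<not> (\<forall>p\<in>S. p F = 0)" using U_V[OF assms] unfolding S(2) by blast
  then obtain p where p: "p \<in> S" "p F \<noteq> 0" by blast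
  have "x \<in> U" if "x \<in> V" "p x \<noteq> 0" for x
  proof (rule ccontr)
    assume "x \<notin> U"
    then have "x \<in> V - U" using that by blast
    then show False using that p(1) unfolding S(2) by blast
  qed
  then show ?thesis using p S(1) by blast
qed

lemma U_diag: "F \<in> U \<Longrightarrow> diag (e + F)"
  using U_ss diag_iff_semisimple by blast

text \<open>Otherwise e itself, which is nilpotent, would be semisimple.\<close>

lemma U_nonzero: "F \<in> U \<Longrightarrow> F \<noteq> 0"
proof
  assume "F \<in> U" "F = 0"
  then have de: "diag e" using U_diag[of F] by simp
  have "br e v = 0" for v
  proof -
    have "v \<in> gen e 0" by (simp add: gen_power e_nil)
    then show ?thesis using diag_gen[OF de] by simp
  qed
  then have "e = 0" by (rule center_trivial)
  then show False using e0 by blast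
qed

text \<open>By \<open>centralizes_triple\<close> this is the centralizer of the whole
  triple.\<close>

definition r :: "('k^'n) set" where "r = {x \<in> G 0. br x e = 0}"

definition kF :: "'k^'n \<Rightarrow> ('k^'n) set" where "kF F = {x \<in> r. br x F = 0}"

lemma subalgebra_G0: "subalgebra br (G 0)"
  using subspace_G br_G[of _ 0 _ 0] by (auto simp: subalgebra_def)

lemma subalgebra_r: "subalgebra br r"
proof -
  have "r = G 0 \<inter> {x. br e x = 0}" using br_comm_0 by (auto simp: r_def)
  then show ?thesis using subalgebra_G0 subalgebra_centralizer[of e]
    by (auto simp: subalgebra_def vec.subspace_inter)
qed

lemma subalgebra_kF: "subalgebra br (kF F)"
proof -
  have "kF F = r \<inter> {x. br F x = 0}" using br_comm_0 by (auto simp: kF_def)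
  then show ?thesis using subalgebra_r subalgebra_centralizer[of F]
    by (auto simp: subalgebra_def vec.subspace_inter)
qed

lemma subspace_r: "vec.subspace r" and subspace_kF: "vec.subspace (kF F)"
  using subalgebra_r subalgebra_kF by (auto simp: subalgebra_def)

lemma r_V: "x \<in> r \<Longrightarrow> v \<in> V \<Longrightarrow> br x v \<in> V"
  using br_G[of x 0 v "- d"] by (simp add: r_def)

lemma br_r_e: "x \<in> r \<Longrightarrow> br x e = 0" by (simp add: r_def)

lemma pr_br_E:
  assumes F: "F \<in> V"
  shows "pr j (br (e + F) v) = br e (pr (j - 2) v) + br F (pr (j + d) v)"
  using pr_br[OF e_G, of j v] pr_br[OF F, of j v] by (simp add: br_add_left lin_add[OF lin_pr])

text \<open>The degree 2 part of [E, v] is [e, v_0] and its degree -d part is [F, v_0]: the other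
  contributions would come from degrees d + 2 and -d - 2.\<close>

lemma pr0_centralizer:
  assumes F: "F \<in> V" and v: "br (e + F) v = 0"
  shows "pr 0 v \<in> kF F"
proof -
  have "br e (pr 0 v) = 0"
    using pr_br_E[OF F, of 2 v] pr_out[of "2 + d" v] by (simp add: v lin_0[OF lin_pr])
  moreover have "br F (pr 0 v) = 0"
    using pr_br_E[OF F, of "- d" v] pr_out[of "- d - 2" v] by (simp add: v lin_0[OF lin_pr])
  ultimately show ?thesis using pr_mem[of 0 v] br_comm_0 by (auto simp: kF_def r_def)
qed

text \<open>x has degree 0, so its pairing with v in z(E) sees only the degree 0 part of v, which
  lies in \<open>kF F\<close>; on z(E) the form is nondegenerate.\<close>

lemma nondeg_kF:
  assumes F: "F \<in> V" "diag (e + F)"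
  shows "nondeg_on (kF F)"
  unfolding nondeg_on_def
proof (intro ballI impI)
  fix x assume x: "x \<in> kF F" and k: "\<forall>y\<in>kF F. kap x y = 0"
  have x0: "x \<in> G 0" using x by (simp add: kF_def r_def)
  have "br x (e + F) = 0" using x by (simp add: kF_def r_def br_add_right)
  then have xE: "br (e + F) x = 0" using br_comm_0 by blast
  have "kap x v = 0" if "br (e + F) v = 0" for v
    using kap_pr[OF x0, of v] pr0_centralizer[OF F(1) that] k by simp
  then show "x = 0" using nondeg_on_full_centralizer[OF F(2)] xE unfolding nondeg_on_def by blast
qed

text \<open>Injectivity gives dim W at most dim [r, F], with equality for a complement of the
  stabilizer of F in r, so the largest slices realize the largest [r, F].\<close>

definition slice :: "('k^'n) set \<Rightarrow> bool" where
  "slice W \<longleftrightarrow> vec.subspace W \<and> W \<subseteq> r \<and> (\<exists>F\<in>U. \<forall>w\<in>W. br w F = 0 \<longrightarrow> w = 0)"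

text \<open>Maximality of [r, F] in the form in which \<open>V_tangent\<close> uses it.\<close>

definition generic :: "'k^'n \<Rightarrow> bool" where
  "generic F \<longleftrightarrow> F \<in> U \<and> (\<forall>x\<in>kF F. \<forall>v\<in>V. \<exists>w\<in>r. br x v = br w F)"

lemma polyfun_ad: "(\<lambda>F. br a F $ i) \<in> polyfun"
  by (rule polyfun_lin[OF lin_ad polyfun.pcoord])

text \<open>If \<open>[x, v] \<notin> [W, F]\<close>, then \<open>W + kx\<close> would act injectively on \<open>F + s v\<close> for almost all \<open>s\<close>,
  contradicting the maximality of \<open>W\<close>.\<close>

lemma generic_exists: "\<exists>F. generic F"
proof -
  obtain F0 where "F0 \<in> U" using U_ne by blast
  then have P0: "slice {0}" unfolding slice_def using vec.subspace_0[OF subspace_r] by auto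
  obtain W where W: "slice W \<and> (\<forall>W'. slice W' \<longrightarrow> vec.dim W' \<le> vec.dim W)"
    using ex_max_dim[of slice, OF P0] ..
  then obtain F where F: "F \<in> U" "\<And>w. w \<in> W \<Longrightarrow> br w F = 0 \<Longrightarrow> w = 0"
    and sW: "vec.subspace W" and Wr: "W \<subseteq> r" unfolding slice_def by blast
  have "\<exists>w\<in>W. br x v = br w F" if x: "x \<in> kF F" and v: "v \<in> V" for x v
  proof (rule ccontr)
    assume no: "\<not> ?thesis"
    have xr: "x \<in> r" and xF: "br x F = 0" using x by (auto simp: kF_def)
    have xW: "x \<notin> W"
    proof
      assume "x \<in> W"
      then have "x = 0" using F(2) xF by blast
      then have "br x v = br 0 F" by simp
      then show False using no vec.subspace_0[OF sW] by blast
    qed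
    let ?W' = "vec.span (insert x W)"
    obtain B where B: "B \<subseteq> W" "vec.independent B" "W \<subseteq> vec.span B" "card B = vec.dim W"
      by (rule vec.basis_exists[of W])
    have spB: "vec.span B = W" by (rule antisym[OF vec.span_minimal[OF B(1) sW] B(3)])
    have "vec.independent (insert x B)" using vec.independent_insertI[of x B] B(2) xW spB by simp
    \<comment> \<open>\<open>L\<close> projects the span of W and x onto the line of x along
      W.\<close>
    from vec.linear_independent_extend[OF this, of "\<lambda>b. if b = x then x else 0"]
    obtain L where L0: "lin L \<and> (\<forall>b\<in>insert x B. L b = (if b = x then x else 0))" ..
    have L: "lin L" and Lx: "L x = x" using L0 by auto
    have LW: "L w = 0" if "w \<in> W" for w
    proof -
      have "L b \<in> {0}" if b: "b \<in> B" for b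
      proof -
        have "b \<noteq> x" using B(1) b xW by blast
        then show ?thesis using L0 b by simp
      qed
      then have "L w \<in> {0}" using lin_span_mem[OF L vec.subspace_single_0] that spB by blast
      then show ?thesis by simp
    qed
    have W': "\<exists>w \<mu>. w \<in> W \<and> y = w + \<mu> *s x" if y: "y \<in> ?W'" for y
    proof -
      obtain \<mu> where "y - \<mu> *s x \<in> W" using y mem_span_insert[OF sW] by blast
      then have "y - \<mu> *s x \<in> W \<and> y = (y - \<mu> *s x) + \<mu> *s x" by simp
      then show ?thesis by blast
    qed
    \<comment> \<open>As [x, F] = 0, w + mu x sends F + s v to [w, F + s v] + s mu [x, v].
      \<open>A\<close> drops this factor s: at s = 0 it is injective because [x, v] is not in
      [W, F], and this spreads to almost all s.\<close>
    define A where "A F' y = br (y - L y) F' + br (L y) v" for F' y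
    have lA: "lin (A F')" for F' unfolding A_def
      by (rule linI) (simp_all add: lin_add[OF L] lin_scale[OF L] br_add_left br_diff_left br_scale_left
          vec.scale_right_distrib vec.scale_right_diff_distrib algebra_simps)
    have Ay: "A F' (w + \<mu> *s x) = br w F' + \<mu> *s br x v" if "w \<in> W" for F' w \<mu>
      using LW[OF that] Lx by (simp add: A_def lin_add[OF L] lin_scale[OF L] br_scale_left)
    have pA: "(\<lambda>F'. A F' y $ i) \<in> polyfun" for y i
      unfolding A_def vector_add_component by (rule polyfun.padd[OF polyfun_ad polyfun.pconst])
    have zero: "w = 0 \<and> \<mu> = 0" if w: "w \<in> W" and e0: "w + \<mu> *s x = 0" for w \<mu>
    proof -
      have "\<mu> = 0"
      proof (rule ccontr)
        assume \<mu>: "\<mu> \<noteq> 0"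
        have "\<mu> *s x = - w" using e0 by (simp add: eq_neg_iff_add_eq_0 add.commute)
        then have "\<mu> *s x \<in> W" using vec.subspace_neg[OF sW w] by simp
        then show False using subspace_scale_cancel[OF sW \<mu>] xW by blast
      qed
      then show ?thesis using e0 by simp
    qed
    have inj: "y = 0" if y: "y \<in> ?W'" and Ay0: "A F y = 0" for y
    proof -
      obtain w \<mu> where w: "w \<in> W" "y = w + \<mu> *s x" using W'[OF y] by blast
      have eq: "br w F + \<mu> *s br x v = 0" using Ay0 Ay[OF w(1)] w(2) by simp
      have "\<mu> = 0"
      proof (rule ccontr)
        assume \<mu>: "\<mu> \<noteq> 0"
        have "\<mu> *s br x v = br (- w) F" using eq by (simp add: br_minus_left eq_neg_iff_add_eq_0 add.commute)
        then have "br x v = inverse \<mu> *s br (- w) F" using inverse_scale[OF \<mu>, of "br x v"] by simp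
        then have "br x v = br (inverse \<mu> *s (- w)) F" by (simp only: br_scale_left)
        moreover have "inverse \<mu> *s (- w) \<in> W" by (intro vec.subspace_scale[OF sW] vec.subspace_neg[OF sW] w)
        ultimately show False using no by blast
      qed
      then show ?thesis using eq w F(2) by simp
    qed
    obtain p where p: "p \<in> polyfun" "p F \<noteq> 0" "\<And>F' y. p F' \<noteq> 0 \<Longrightarrow> y \<in> ?W' \<Longrightarrow> A F' y = 0 \<Longrightarrow> y = 0"
      using injective_open[of ?W' A F, OF vec.subspace_span lA pA inj] by blast
    obtain p' where p': "p' \<in> polyfun" "p' F \<noteq> 0" "\<And>F'. F' \<in> V \<Longrightarrow> p' F' \<noteq> 0 \<Longrightarrow> F' \<in> U"
      using U_poly[OF F(1)] by blast
    have "(\<lambda>x. p x * p' x) \<in> polyfun" "p F * p' F \<noteq> 0" using p p' by (auto intro: polyfun.pmult)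
    from polyfun_nonzero_on_line[OF this, of v] obtain s where
      s: "s \<noteq> 0" "p (F + s *s v) \<noteq> 0" "p' (F + s *s v) \<noteq> 0" by auto
    let ?F = "F + s *s v"
    have "?F \<in> V" by (intro vec.subspace_add[OF subspace_G] vec.subspace_scale[OF subspace_G] v U_V[OF F(1)])
    then have FU: "?F \<in> U" using p'(3) s(3) by blast
    have "y = 0" if y: "y \<in> ?W'" and y0: "br y ?F = 0" for y
    proof -
      obtain w \<mu> where w: "w \<in> W" "y = w + \<mu> *s x" using W'[OF y] by blast
      have "br y ?F = br w ?F + (\<mu> * s) *s br x v"
        by (simp add: w(2) br_add_left br_scale_left br_add_right[of x] br_scale_right xF vector_smult_assoc)
      then have "A ?F (w + (\<mu> * s) *s x) = 0" using Ay[OF w(1)] y0 by simp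
      moreover have "w + (\<mu> * s) *s x \<in> ?W'"
        by (intro vec.span_add vec.span_scale vec.span_base) (use w in auto)
      ultimately have "w + (\<mu> * s) *s x = 0" using p(3)[OF s(2)] by blast
      then have "w = 0 \<and> \<mu> * s = 0" using zero[OF w(1)] by blast
      then show ?thesis using w(2) s(1) by simp
    qed
    moreover have "?W' \<subseteq> r" by (rule vec.span_minimal[OF _ subspace_r]) (use xr Wr in auto)
    ultimately have "slice ?W'" using FU unfolding slice_def by blast
    then have "vec.dim ?W' \<le> vec.dim W" using W by blast
    then have "W = ?W'" by (intro vec.subspace_dim_equal[OF sW vec.subspace_span])
      (use vec.span_superset[of "insert x W"] in blast)+
    then show False using xW vec.span_base[of x "insert x W"] by simp
  qed
  then have "generic F" unfolding generic_def using F(1) Wr by blast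
  then show ?thesis ..
qed

section \<open>Semisimple elements with smallest centralizer\<close>

definition toral_min :: "'k^'n \<Rightarrow> 'k^'n \<Rightarrow> bool" where
  "toral_min F x0 \<longleftrightarrow> x0 \<in> kF F \<and> diag x0 \<and>
     (\<forall>y\<in>kF F. diag y \<longrightarrow> br x0 y = 0 \<longrightarrow> (\<forall>v. br x0 v = 0 \<longrightarrow> br y v = 0))"

text \<open>If z(x0) has least dimension and y commutes with x0, some x0 + s y has as centralizer
  the intersection of z(x0) and z(y); minimality forces it to be z(x0).\<close>

lemma toral_min_exists: "\<exists>x0. toral_min F x0"
proof -
  let ?P = "\<lambda>x. x \<in> kF F \<and> diag x"
  let ?dim = "\<lambda>x. vec.dim {v. br x v = 0}"
  have P0: "?P 0" using diag_0 vec.subspace_0[OF subspace_kF] by blast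
  obtain x0 where x0: "?P x0 \<and> (\<forall>y. ?P y \<longrightarrow> ?dim x0 \<le> ?dim y)"
    using ex_has_least_nat[of ?P 0 ?dim, OF P0] ..
  have "br y v = 0" if y: "y \<in> kF F" "diag y" "br x0 y = 0" and v: "br x0 v = 0" for y v
  proof -
    obtain s where s: "diag (x0 + s *s y)"
      "\<And>v. br (x0 + s *s y) v = 0 \<Longrightarrow> br x0 v = 0 \<and> br y v = 0"
      using diag_combination[OF _ y(2,3)] x0 by blast
    let ?z = "x0 + s *s y"
    have "?z \<in> kF F" using x0 y(1) by (intro vec.subspace_add[OF subspace_kF] vec.subspace_scale[OF subspace_kF]) auto
    then have dim: "?dim x0 \<le> ?dim ?z" using x0 s(1) by blast
    have "{v. br ?z v = 0} = {v. br x0 v = 0}"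
      by (rule vec.subspace_dim_equal[OF _ _ _ dim]) (use s(2) vec.linear_subspace_kernel[OF lin_ad] in auto)
    then have "br ?z v = 0" using v by blast
    then show ?thesis using s(2) by blast
  qed
  then show ?thesis using x0 unfolding toral_min_def by blast
qed

end

locale reduction = semisimple_type_alg br e h f U
  for br :: "('k::field_char_0,'n::finite) bracket" and e h f U +
  fixes F x0 :: "'k^'n"
  assumes gF: "generic F" and tx: "toral_min F x0"
begin

lemma F_U: "F \<in> U" and F_V: "F \<in> V" and diag_E: "diag (e + F)"
  using gF U_V U_diag by (auto simp: generic_def)

lemma x0_kF: "x0 \<in> kF F" and diag_x0: "diag x0"
  using tx by (auto simp: toral_min_def)

lemma x0_r: "x0 \<in> r" and x0_F: "br x0 F = 0" and x0_e: "br x0 e = 0" and x0_G: "x0 \<in> G 0"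
  using x0_kF by (auto simp: kF_def r_def)

lemma x0_h: "br x0 h = 0" and x0_f: "br x0 f = 0"
  using centralizes_triple[OF x0_G x0_e] by auto

section \<open>The centralizer of the minimal semisimple element\<close>

definition Z :: "('k^'n) set" where "Z = {v. br x0 v = 0}"

lemma subalgebra_Z: "subalgebra br Z" unfolding Z_def by (rule subalgebra_centralizer)

lemma subspace_Z: "vec.subspace Z" using subalgebra_Z by (simp add: subalgebra_def)

lemma nondeg_Z: "nondeg_on Z" unfolding Z_def by (rule nondeg_on_full_centralizer[OF diag_x0])

lemma triple_in_Z: "e \<in> Z" "h \<in> Z" "f \<in> Z" "F \<in> Z"
  by (simp_all add: Z_def x0_e x0_h x0_f x0_F)

definition tor :: "('k^'n) set" where "tor = kF F \<inter> Z"

lemma subalgebra_tor: "subalgebra br tor"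
  using subalgebra_kF subalgebra_Z by (auto simp: tor_def subalgebra_def vec.subspace_inter)

lemma nondeg_tor: "nondeg_on tor"
proof -
  have "nondeg_on {y \<in> kF F. br x0 y = 0}"
    by (rule nondeg_on_centralizer[OF subspace_kF nondeg_kF[OF F_V diag_E] diag_x0])
      (use subalgebra_kF x0_kF in \<open>auto simp: subalgebra_def\<close>)
  moreover have "{y \<in> kF F. br x0 y = 0} = tor" by (auto simp: tor_def Z_def)
  ultimately show ?thesis by simp
qed

lemma spart_tor:
  assumes "x \<in> tor"
  shows "spart x \<in> tor"
proof -
  have x: "br h x = 0" "br e x = 0" "br F x = 0" "br x0 x = 0"
    using assms br_comm_0 by (auto simp: tor_def kF_def r_def Z_def G_iff)
  have "br h (spart x) = 0" "br e (spart x) = 0" "br F (spart x) = 0" "br x0 (spart x) = 0"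
    using x by (simp_all add: spart_commute)
  then show ?thesis using br_comm_0 by (auto simp: tor_def kF_def r_def Z_def G_iff)
qed

lemma diag_tor_central:
  assumes "x \<in> tor" "diag x" "v \<in> Z"
  shows "br x v = 0"
  using tx assms by (auto simp: toral_min_def tor_def Z_def)

text \<open>The semisimple part of x lies in \<open>tor\<close> and kills Z, so x acts on Z through
  its nilpotent part.\<close>

lemma tor_acts_nilpotently:
  assumes x: "x \<in> tor" and v: "v \<in> Z"
  shows "(br x ^^ CARD('n)) v = 0"
proof -
  let ?n = "x - spart x"
  have "(br x ^^ k) v = (br ?n ^^ k) v \<and> (br x ^^ k) v \<in> Z" for k
  proof (induction k)
    case (Suc k)
    have "br x ((br x ^^ k) v) \<in> Z" using subalgebra_Z x Suc by (auto simp: tor_def subalgebra_def)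
    moreover have "br (spart x) ((br x ^^ k) v) = 0"
      using Suc by (intro diag_tor_central spart_tor x diag_spart) auto
    ultimately show ?case using Suc by (auto simp: br_diff_left)
  qed (simp add: v)
  then show ?thesis using ad_nil_npart[of x] by (simp add: ad_nil_def)
qed

text \<open>\<open>tor\<close> acts nilpotently on itself, so if [tor, tor] were nonzero, Engel's
  theorem would find in it a nonzero element central in \<open>tor\<close>, which
  \<open>center_inter_brackets\<close> excludes.\<close>

lemma tor_abelian:
  assumes "x \<in> tor" "y \<in> tor"
  shows "br x y = 0"
proof (rule ccontr)
  assume ne: "br x y \<noteq> 0"
  let ?A = "vec.span (brackets tor tor)"
  have I: "lie_ideal br tor ?A" by (rule lie_ideal_brackets[OF lie_ideal_self[OF subalgebra_tor]])
  have At: "?A \<subseteq> tor" using I by (simp add: lie_ideal_def)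
  have torZ: "v \<in> Z" if "v \<in> tor" for v using that by (simp add: tor_def)
  have "br x y \<in> ?A" using assms by (intro vec.span_base) blast
  then have nA: "\<not> ?A \<subseteq> {0}" using ne by blast
  have "\<exists>a\<in>?A. a \<notin> {0} \<and> (\<forall>x\<in>tor. br x a \<in> {0})"
  proof (rule engel[where N = "CARD('n)", OF subalgebra_tor vec.subspace_span _ vec.subspace_single_0 _ nA])
    show "\<forall>x\<in>tor. \<forall>a\<in>?A. br x a \<in> ?A" using I by (auto simp: lie_ideal_def)
    show "\<forall>x\<in>tor. \<forall>v\<in>?A \<union> tor. (br x ^^ CARD('n)) v = 0"
      using tor_acts_nilpotently torZ At by blast
  qed simp
  then obtain a where a: "a \<in> ?A" "a \<noteq> 0" "\<And>x. x \<in> tor \<Longrightarrow> br x a = 0" by blast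
  have "a = 0"
    by (rule center_inter_brackets[OF nondeg_tor _ _ a(1)]) (use a At br_comm_0 in blast)+
  then show False using a(2) by blast
qed

text \<open>The nilpotent part of x lies in the abelian \<open>tor\<close>, hence is orthogonal to
  it and 0. So x is semisimple and \<open>diag_tor_central\<close> applies.\<close>

lemma tor_central:
  assumes x: "x \<in> tor" and v: "v \<in> Z"
  shows "br x v = 0"
proof -
  let ?n = "x - spart x"
  have st: "vec.subspace tor" using subalgebra_tor by (simp add: subalgebra_def)
  have n: "?n \<in> tor" by (rule vec.subspace_diff[OF st x spart_tor[OF x]])
  have "kap ?n y = 0" if "y \<in> tor" for y
    by (rule kap_commuting_nil[OF ad_nil_npart tor_abelian[OF n that]])
  then have "?n = 0" using nondeg_tor n by (auto simp: nondeg_on_def)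
  then have "diag x" using diag_spart[of x] by simp
  then show ?thesis by (rule diag_tor_central[OF x _ v])
qed

section \<open>The derived algebra of the centralizer\<close>

definition q :: "('k^'n) set" where "q = vec.span (brackets Z Z)"

lemma q_ideal: "lie_ideal br Z q"
  unfolding q_def by (rule lie_ideal_brackets[OF lie_ideal_self[OF subalgebra_Z]])

lemma q_Z: "q \<subseteq> Z" and br_Z_q: "x \<in> Z \<Longrightarrow> y \<in> q \<Longrightarrow> br x y \<in> q" and subspace_q: "vec.subspace q"
  using q_ideal by (auto simp: lie_ideal_def)

lemma subalgebra_q: "subalgebra br q" by (rule lie_ideal_subalgebra[OF q_ideal])

lemma br_q: "x \<in> Z \<Longrightarrow> y \<in> Z \<Longrightarrow> br x y \<in> q"
  unfolding q_def by (rule vec.span_base) blast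

lemma q_central_zero:
  assumes "z \<in> q" "\<And>y. y \<in> Z \<Longrightarrow> br z y = 0"
  shows "z = 0"
  using center_inter_brackets[OF nondeg_Z _ assms(2)] assms(1) q_Z unfolding q_def by blast

text \<open>If x is orthogonal to [Z, Z], then each [x, a] with a in Z is orthogonal to Z, so x is
  central in Z.\<close>

lemma nondeg_q: "nondeg_on q"
  unfolding nondeg_on_def
proof (intro ballI impI)
  fix x assume x: "x \<in> q" and k: "\<forall>y\<in>q. kap x y = 0"
  have "br x a = 0" if a: "a \<in> Z" for a
  proof -
    have xa: "br x a \<in> Z" using subalgebra_Z x a q_Z by (auto simp: subalgebra_def)
    have "kap (br x a) b = 0" if "b \<in> Z" for b
      using k br_q[OF a that] by (simp add: kap_invariant)
    then show ?thesis using nondeg_Z xa by (auto simp: nondeg_on_def)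
  qed
  then show "x = 0" by (rule q_central_zero[OF x])
qed

text \<open>An element z central in q is central in Z, since [a, z] lies in q and is orthogonal to
  q.\<close>

lemma q_centerless:
  assumes z: "z \<in> q" "\<And>y. y \<in> q \<Longrightarrow> br z y = 0"
  shows "z = 0"
proof (rule q_central_zero[OF z(1)])
  fix a assume a: "a \<in> Z"
  have az: "br a z \<in> q" by (rule br_Z_q[OF a z(1)])
  have "kap (br a z) y = 0" if "y \<in> q" for y by (simp add: kap_invariant z(2)[OF that])
  then have "br a z = 0" using nondeg_q az by (auto simp: nondeg_on_def)
  then show "br z a = 0" using br_comm_0 by blast
qed

lemma semisimple_q: "semisimple_lie br q"
  by (rule semisimple_if_nondeg_centerless[OF subalgebra_q nondeg_q q_centerless])

lemma two_nonzero: "(2::'k) \<noteq> 0" "(- 2::'k) \<noteq> 0" by simp_all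

lemma triple_in_q: "e \<in> q" "h \<in> q" "f \<in> q"
proof -
  have "2 *s e \<in> q" using br_q[OF triple_in_Z(2,1)] by (simp add: br_he)
  then show "e \<in> q" by (rule subspace_scale_cancel[OF subspace_q two_nonzero(1)])
  show "h \<in> q" using br_q[OF triple_in_Z(1,3)] by (simp add: br_ef)
  have "(- 2) *s f \<in> q" using br_q[OF triple_in_Z(2,3)] by (simp only: br_hf)
  then show "f \<in> q" by (rule subspace_scale_cancel[OF subspace_q two_nonzero(2)])
qed

text \<open>h lies in Z and acts on V by the nonzero scalar -d, so a vector of V in Z is a multiple
  of its bracket with h.\<close>

lemma V_Z_q: "q \<inter> V = V \<inter> Z"
proof -
  have "v \<in> q" if v: "v \<in> V" "v \<in> Z" for v
  proof -
    have "of_int (- d) *s v \<in> q" using br_q[OF triple_in_Z(2) v(2)] v(1) unfolding G_iff by simp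
    moreover have "of_int (- d) \<noteq> (0::'k)" using two_le_depth unfolding of_int_eq_0_iff by linarith
    ultimately show ?thesis using subspace_scale_cancel[OF subspace_q] by blast
  qed
  then show ?thesis using q_Z by blast
qed

section \<open>Density of the orbits of the reducing slice\<close>

text \<open>Velocities at F of the curves built in \<open>swept_curve\<close>; the list records the
  successive factors exp(s x).\<close>

definition tangent :: "('k^'n) set" where
  "tangent = {v. \<exists>w xs. w \<in> V \<inter> Z \<and> (\<forall>x\<in>set xs. x \<in> r \<and> ad_nil x) \<and> v = w + (\<Sum>x\<leftarrow>xs. br x F)}"

lemma tangent_add: "u \<in> tangent \<Longrightarrow> v \<in> tangent \<Longrightarrow> u + v \<in> tangent"
proof -
  assume "u \<in> tangent" "v \<in> tangent"
  then obtain w xs w' xs' where *: "w \<in> V \<inter> Z" "\<forall>x\<in>set xs. x \<in> r \<and> ad_nil x" "u = w + (\<Sum>x\<leftarrow>xs. br x F)"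
    "w' \<in> V \<inter> Z" "\<forall>x\<in>set xs'. x \<in> r \<and> ad_nil x" "v = w' + (\<Sum>x\<leftarrow>xs'. br x F)"
    unfolding tangent_def by blast
  have "w + w' \<in> V \<inter> Z" using * vec.subspace_add[OF subspace_G] vec.subspace_add[OF subspace_Z] by blast
  moreover have "\<forall>x\<in>set (xs @ xs'). x \<in> r \<and> ad_nil x" using * by auto
  moreover have "u + v = (w + w') + (\<Sum>x\<leftarrow>xs @ xs'. br x F)" using * by simp
  ultimately show ?thesis unfolding tangent_def by blast
qed

lemma tangent_slice: "w \<in> V \<inter> Z \<Longrightarrow> w \<in> tangent"
  unfolding tangent_def by (rule CollectI, rule exI[of _ w], rule exI[of _ "[]"]) simp

lemma tangent_nil: "x \<in> r \<Longrightarrow> ad_nil x \<Longrightarrow> br x F \<in> tangent"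
  unfolding tangent_def
  by (rule CollectI, rule exI[of _ 0], rule exI[of _ "[x]"])
    (simp add: vec.subspace_0[OF subspace_G] vec.subspace_0[OF subspace_Z])

text \<open>Split y into eigenvectors of ad x0. The one of eigenvalue 0 gives a bracket with F
  inside V and Z; the others are nilpotent.\<close>

lemma tangent_r:
  assumes y: "y \<in> r"
  shows "br y F \<in> tangent"
proof -
  let ?p = "\<lambda>c. proj x0 c y"
  have inv: "br x0 ` r \<subseteq> r" using subalgebra_r x0_r by (auto simp: subalgebra_def)
  have pr: "?p c \<in> r" for c by (rule proj_invariant[OF subspace_r inv y])
  have one: "br (?p c) F \<in> tangent" for c
  proof (cases "c = 0")
    case True
    have "br x0 (?p c) = 0"
      using proj_mem[of x0 c y] diag_gen[OF diag_x0] True by simp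
    then have "br x0 (br (?p c) F) = 0" by (simp add: jacobi[of x0] x0_F)
    then show ?thesis using r_V[OF pr F_V] by (intro tangent_slice) (simp add: Z_def)
  next
    case False
    then show ?thesis by (intro tangent_nil pr ad_nil_gen[OF proj_mem])
  qed
  have "br (\<Sum>c\<in>C. ?p c) F \<in> tangent" if "finite C" for C
    using that
  proof (induction C rule: finite_induct)
    case empty
    show ?case using vec.subspace_0[OF subspace_G] vec.subspace_0[OF subspace_Z] by (simp add: tangent_slice)
  next
    case (insert c C)
    then show ?case by (simp add: br_add_left tangent_add one)
  qed
  then have "br (\<Sum>c\<in>spectrum (br x0). ?p c) F \<in> tangent" using gen_finite by blast
  then show ?thesis by (simp only: proj_sum[symmetric])
qed

lemma V_tangent:
  assumes v: "v \<in> V"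
  shows "v \<in> tangent"
proof -
  let ?E = "e + F"
  obtain c y where cy: "v = c + br ?E y" "br ?E c = 0" using diag_split[OF diag_E] by blast
  \<comment> \<open>Among the degrees -d, ..., d only -d and 2 are congruent to -d modulo d + 2, so
    v involves just these components of c and the degree 0 component of y.\<close>
  define a b y0 where "a = pr 2 c" and "b = pr (- d) c" and "y0 = pr 0 y"
  have d2: "2 \<le> d" by (rule two_le_depth)
  have aG: "a \<in> G 2" and bG: "b \<in> V" and yG: "y0 \<in> G 0" by (simp_all add: a_def b_def y0_def pr_mem)
  have comp: "pr j v = pr j c + (br e (pr (j - 2) y) + br F (pr (j + d) y))" for j
    unfolding cy(1) lin_add[OF lin_pr] pr_br_E[OF F_V] ..
  have a: "a + br e y0 = 0"
    using comp[of 2] pr_G[OF v, of 2] pr_out[of "2 + d" y] d2 by (simp add: a_def y0_def)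
  have b: "v = b + br F y0"
    using comp[of "- d"] pr_G[OF v, of "- d"] pr_out[of "- d - 2" y] by (simp add: b_def y0_def)
  have zero: "br e (pr (j - 2) c) + br F (pr (j + d) c) = 0" for j
    using pr_br_E[OF F_V, of j c] by (simp add: cy(2) lin_0[OF lin_pr])
  have "br e a = 0" using zero[of 4] pr_out[of "4 + d" c] by (simp add: a_def)
  moreover have "br e b + br F a = 0" using zero[of "2 - d"] by (simp add: a_def b_def)
  moreover have "br F b = 0" using zero[of "- 2 * d"] pr_out[of "- 2 * d - 2" c] d2 by (simp add: b_def)
  ultimately have Eab: "br ?E (a + b) = 0" by (simp add: br_add_left br_add_right algebra_simps)
  have vE: "v = (a + b) + br ?E y0" using a b by (simp add: br_add_left algebra_simps)
  obtain w where w: "w \<in> r" "br x0 v = br w F" using gF x0_kF v unfolding generic_def by blast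
  have x0E: "br x0 ?E = 0" by (simp add: br_add_right x0_e x0_F)
  have comm: "br x0 (br ?E u) = br ?E (br x0 u)" for u using jacobi[of x0 ?E u] x0E by simp
  have "br w F = br x0 (a + b) + br ?E (br x0 y0)"
    using w(2) by (simp only: vE br_add_right[of x0 "a + b"] comm)
  moreover have "br w F = br w ?E" using w(1) by (simp add: br_add_right br_r_e)
  moreover have "br w ?E = br ?E (- w)" by (simp only: br_minus_right br_swap[of w ?E] minus_minus)
  ultimately have im: "br x0 (a + b) = br ?E (- w - br x0 y0)"
    by (simp add: br_diff_right algebra_simps)
  \<comment> \<open>[x0, a + b] lies in the kernel of ad E and, by genericity, in its image.\<close>
  have "br ?E (br ?E (- w - br x0 y0)) = 0"
    unfolding im[symmetric] comm[symmetric] Eab by simp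
  then have ab0: "br x0 (a + b) = 0" unfolding im by (rule diag_square[OF diag_E])
  have xa: "br x0 a \<in> G 2" and xb: "br x0 b \<in> V" using br_G[OF x0_G aG] br_G[OF x0_G bG] by simp_all
  have "pr 2 (br x0 (a + b)) = br x0 a"
    using pr_G[OF xa, of 2] pr_G[OF xb, of 2] d2 by (simp add: br_add_right lin_add[OF lin_pr])
  then have x0a: "br x0 a = 0" by (simp add: ab0 lin_0[OF lin_pr])
  then have x0b: "br x0 b = 0" using ab0 by (simp add: br_add_right)
  \<comment> \<open>The x0-invariant part of y0 has the same bracket with e, since [e, y0] = -a
    commutes with x0. So y1 - y0 lies in r, while b + [F, y1] lies in V and Z.\<close>
  define y1 where "y1 = proj x0 0 y0"
  have inv: "br x0 ` G 0 \<subseteq> G 0" using subalgebra_G0 x0_G by (auto simp: subalgebra_def)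
  have y1G: "y1 \<in> G 0" unfolding y1_def by (rule proj_invariant[OF subspace_G inv yG])
  have y1Z: "br x0 y1 = 0"
    using proj_mem[of x0 0 y0] diag_gen[OF diag_x0] by (simp add: y1_def)
  have comme: "br e (br x0 u) = br x0 (br e u)" for u using jacobi[of x0 e u] x0_e by simp
  have "br e y1 = proj x0 0 (br e y0)"
    unfolding y1_def
    by (rule gen_proj_commute[OF lin_ad ac lin_ad gen_eigenspace_commute[OF lin_ad lin_ad comme], symmetric])
  also have "br e y0 = - a" using a by (simp add: eq_neg_iff_add_eq_0 add.commute)
  also have "proj x0 0 (- a) = - a"
  proof -
    have "- a \<in> gen x0 0" using x0a by (intro gen_eigenvector) (simp add: br_minus_right)
    then show ?thesis using proj_gen by simp
  qed
  finally have ey1: "br e y1 = br e y0" using \<open>br e y0 = - a\<close> by simp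
  define y2 where "y2 = y1 - y0"
  have "br e y2 = 0" by (simp add: y2_def br_diff_right ey1)
  then have "br y2 e = 0" using br_comm_0 by blast
  then have y2r: "y2 \<in> r" using vec.subspace_diff[OF subspace_G y1G yG] by (simp add: r_def y2_def)
  have "v = (b + br F y1) + br y2 F"
    by (simp add: b y2_def br_diff_left br_swap[of F])
  moreover have "b + br F y1 \<in> V \<inter> Z"
  proof
    show "b + br F y1 \<in> V" using br_G[OF F_V y1G] bG by (intro vec.subspace_add[OF subspace_G]) simp_all
    show "b + br F y1 \<in> Z" by (simp add: Z_def br_add_right x0b jacobi[of x0 F] x0_F y1Z)
  qed
  ultimately show ?thesis using tangent_add[OF tangent_slice tangent_r[OF y2r]] by simp
qed

definition swept :: "('k^'n) set" where "swept = (\<Union>\<phi>\<in>Z_sl2 br e h f. \<phi> ` (q \<inter> V))"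

lemma swept_V: "swept \<subseteq> V"
proof -
  have "\<phi> v \<in> V" if \<phi>: "\<phi> \<in> Z_sl2 br e h f" and v: "v \<in> V" for \<phi> v
  proof -
    have l: "lin \<phi>" and br: "\<And>u v. \<phi> (br u v) = br (\<phi> u) (\<phi> v)" and h: "\<phi> h = h"
      using \<phi> adjoint_group_br[of \<phi>] by (auto simp: Z_sl2_def)
    have "br h (\<phi> v) = \<phi> (br h v)" by (simp add: br h)
    also have "\<dots> = of_int (- d) *s \<phi> v" using v unfolding G_iff by (simp only: lin_scale[OF l])
    finally show ?thesis unfolding G_iff .
  qed
  then show ?thesis unfolding swept_def by blast
qed

lemma swept_exp:
  assumes x: "x \<in> r" "ad_nil x" and v: "v \<in> swept"
  shows "exp_ad br (s *s x) v \<in> swept"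
proof -
  obtain \<phi> u where \<phi>: "\<phi> \<in> Z_sl2 br e h f" "u \<in> q \<inter> V" "v = \<phi> u" using v unfolding swept_def by blast
  have "br x e = 0" "br x h = 0" "br x f = 0" using x(1) centralizes_triple[of x] by (auto simp: r_def)
  then have fixed: "exp_ad br (s *s x) e = e" "exp_ad br (s *s x) h = h" "exp_ad br (s *s x) f = f"
    by (simp_all add: exp_ad_fix br_scale_left)
  have "exp_ad br (s *s x) \<circ> \<phi> \<in> adjoint_group br"
    using \<phi>(1) ad_nil_scale[OF x(2)] by (intro ag_step) (auto simp: Z_sl2_def ad_nilpotent_iff)
  then have "exp_ad br (s *s x) \<circ> \<phi> \<in> Z_sl2 br e h f" using \<phi>(1) fixed by (auto simp: Z_sl2_def)
  moreover have "exp_ad br (s *s x) v = (exp_ad br (s *s x) \<circ> \<phi>) u" by (simp add: \<phi>(3))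
  ultimately show ?thesis unfolding swept_def using \<phi>(2) by blast
qed

text \<open>With no factor, the line F + s w stays in q and V; each further factor adds [x, F] to
  the velocity and preserves \<open>swept\<close>.\<close>

lemma swept_curve:
  assumes w: "w \<in> V \<inter> Z" and xs: "\<forall>x\<in>set xs. x \<in> r \<and> ad_nil x"
  shows "\<exists>c. polycurve c \<and> c 0 = w + (\<Sum>x\<leftarrow>xs. br x F) \<and> (\<forall>s. c s \<in> V \<and> F + s *s c s \<in> swept)"
  using xs
proof (induction xs)
  case Nil
  have "F + s *s w \<in> swept" for s
  proof -
    have "F + s *s w \<in> V" using w F_V by (intro vec.subspace_add[OF subspace_G] vec.subspace_scale[OF subspace_G]) auto
    moreover have "F + s *s w \<in> Z"
      using w triple_in_Z(4) by (intro vec.subspace_add[OF subspace_Z] vec.subspace_scale[OF subspace_Z]) auto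
    ultimately have "F + s *s w \<in> q \<inter> V" using V_Z_q by blast
    moreover have "id \<in> Z_sl2 br e h f" by (simp add: Z_sl2_def ag_id)
    ultimately show ?thesis unfolding swept_def
      by (intro UN_I[of id] image_eqI[of _ _ "F + s *s w"]) simp_all
  qed
  then show ?case using w by (intro exI[of _ "\<lambda>s. w"]) (simp add: polycurve_const)
next
  case (Cons x xs)
  then obtain c where c: "polycurve c" "c 0 = w + (\<Sum>x\<leftarrow>xs. br x F)"
    "\<And>s. c s \<in> V" "\<And>s. F + s *s c s \<in> swept" by auto
  have x: "x \<in> r" "ad_nil x" using Cons.prems by auto
  obtain c' where c': "polycurve c'" "c' 0 = c 0 + br x F"
    "\<And>s. c' s \<in> V \<and> exp_ad br (s *s x) (F + s *s c s) = F + s *s c' s"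
    using exp_ad_curve[OF c(1) subspace_G r_V[OF x(1)] F_V c(3)] by blast
  have "F + s *s c' s \<in> swept" for s using swept_exp[OF x c(4)[of s], of s] c'(3)[of s] by simp
  then show ?case using c' c(2) by (intro exI[of _ c']) (simp add: algebra_simps)
qed

lemma swept_dense: "zariski_dense_in V swept"
  unfolding zariski_dense_in_def
proof (intro conjI swept_V allI impI)
  fix C assume C: "zariski_closed_in V C \<and> swept \<subseteq> C"
  then obtain S where S: "S \<subseteq> polyfun" "C = {x \<in> V. \<forall>p\<in>S. p x = 0}" unfolding zariski_closed_in_def by blast
  have "p x = 0" if p: "p \<in> S" and x: "x \<in> V" for p x
  proof -
    have "p (F + (x - F)) = 0"
    proof (rule polyfun_vanishing_on_curves[where A = swept and V = V])
      show "p \<in> polyfun" using p S(1) by blast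
      show "p y = 0" if "y \<in> swept" for y using that C p unfolding S(2) by blast
      show "\<exists>c. polycurve c \<and> c 0 = v \<and> (\<forall>s. c s \<in> V \<and> F + s *s c s \<in> swept)" if "v \<in> V" for v
        using V_tangent[OF that] swept_curve unfolding tangent_def by blast
      show "x - F \<in> V" by (rule vec.subspace_diff[OF subspace_G x F_V])
    qed
    then show ?thesis by simp
  qed
  then show "C = V" unfolding S(2) by blast
qed

theorem reducing_q: "reducing_subalgebra br e h f q"
  unfolding reducing_subalgebra_def
  using semisimple_q br_Z_q triple_in_Z swept_dense unfolding swept_def by blast

section \<open>Regularity in the reducing subalgebra\<close>

text \<open>F is a nonzero element of q and q is nondegenerate, so some y in q pairs with F; its
  degree d component is nonzero and lies in q.\<close>

lemma depth_q: "depth br q h = d"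
proof -
  have e: "eigsp br q h j = q \<inter> G j" for j by (auto simp: eigsp_def)
  have sub: "{j. eigsp br q h j \<noteq> {0}} \<subseteq> {j. G j \<noteq> {0}}"
    using vec.subspace_0[OF subspace_q] by (auto simp: e)
  have fin: "finite {j. eigsp br q h j \<noteq> {0}}" by (rule finite_subset[OF sub finite_weights])
  have Fq: "F \<in> q" using V_Z_q F_V triple_in_Z(4) by blast
  have "F \<noteq> 0" by (rule U_nonzero[OF F_U])
  then obtain y where y: "y \<in> q" "kap F y \<noteq> 0" using nondeg_q Fq by (auto simp: nondeg_on_def)
  have "pr d y \<in> q"
    by (rule pr_in_invariant[OF subspace_q _ y(1)]) (rule br_Z_q[OF triple_in_Z(2)])
  moreover have "pr d y \<noteq> 0" using kap_pr[OF F_V, of y] y(2) by auto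
  ultimately have "eigsp br q h d \<noteq> {0}" using pr_mem[of d y] by (auto simp: e)
  then show ?thesis unfolding depth_def[of br q]
    by (intro Max_eqI fin) (use sub G_le_depth in auto)
qed

section \<open>The grading modulo d + 2\<close>

definition residue_indicator :: "nat \<Rightarrow> 'k \<Rightarrow> 'k" where
  "residue_indicator i c = (if \<exists>j::int. c = of_int j \<and> j mod (d + 2) = int i then 1 else 0)"

text \<open>\<open>residue_indicator i\<close> is not additive: here \<open>eigder\<close> produces
  a projection, not a derivation.\<close>

definition hom :: "nat \<Rightarrow> 'k^'n \<Rightarrow> 'k^'n" where "hom i = eigder h (residue_indicator i)"

text \<open>Modulo this number e and all of V have degree 2, which makes E homogeneous.\<close>

definition m :: nat where "m = nat (d + 2)"

lemma int_m: "int m = d + 2" using two_le_depth by (simp add: m_def)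

lemma lin_hom: "lin (hom i)" unfolding hom_def by (rule lin_eig_map[OF lin_ad ac])

lemma hom_G: "v \<in> G j \<Longrightarrow> hom i v = (if j mod int m = int i then v else 0)"
proof -
  assume "v \<in> G j"
  then have "hom i v = residue_indicator i (of_int j) *s v"
    unfolding hom_def G_gen by (rule eigder_gen)
  then show ?thesis by (simp add: residue_indicator_def int_m)
qed

lemma grading: "cyclic_grading br m hom"
proof -
  have m0: "m > 0" using int_m two_le_depth by linarith
  have mm: "j mod int m \<ge> 0 \<and> j mod int m < int m" for j using m0 by simp
  have 1: "(\<Sum>i<m. hom i v) = v" for v
  proof (induction v rule: G_induct)
    case (1 j v)
    define i0 where "i0 = nat (j mod int m)"
    have i0: "int i0 = j mod int m" "i0 < m" using mm[of j] by (simp_all add: i0_def nat_less_iff)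
    have "(\<Sum>i<m. hom i v) = (\<Sum>i<m. if i = i0 then v else 0)"
      by (rule sum.cong) (use i0(1) in \<open>auto simp: hom_G[OF 1]\<close>)
    then show ?case using i0(2) by simp
  next
    case (2 v w) then show ?case by (simp add: lin_add[OF lin_hom] sum.distrib)
  qed
  have 2: "hom i (hom j v) = (if i = j then hom i v else 0)" for i j v
  proof (induction v rule: G_induct)
    case (1 l v) then show ?case by (auto simp: hom_G[OF 1] lin_0[OF lin_hom])
  next
    case (2 v w) then show ?case by (auto simp: lin_add[OF lin_hom])
  qed
  have 3: "br (hom i u) (hom j v) = hom ((i + j) mod m) (br (hom i u) (hom j v))" if "i < m" "j < m" for i j u v
  proof (induction u rule: G_induct)
    case (1 a u)
    show ?case
    proof (induction v rule: G_induct)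
      case (1 b v)
      show ?case
      proof (cases "a mod int m = int i \<and> b mod int m = int j")
        case True
        have "(a + b) mod int m = (a mod int m + b mod int m) mod int m" by (simp add: mod_add_eq)
        also have "\<dots> = int ((i + j) mod m)" using True by (simp add: zmod_int)
        finally show ?thesis
          using hom_G[OF br_G[OF \<open>u \<in> G a\<close> 1], of "(i + j) mod m"] True
          by (simp add: hom_G[OF 1] hom_G[OF \<open>u \<in> G a\<close>])
      next
        case False
        then show ?thesis by (auto simp: hom_G[OF 1] hom_G[OF \<open>u \<in> G a\<close>] lin_0[OF lin_hom])
      qed
    next
      case (2 v w) then show ?case by (simp add: lin_add[OF lin_hom] br_add_right)
    qed
  next
    case (2 u w) then show ?case by (simp add: lin_add[OF lin_hom] br_add_left)
  qed
  show ?thesis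
    by (intro cyclic_grading.intro cyclic_grading_axioms.intro lie_alg_axioms m0 lin_hom 1 2 3)
qed

text \<open>The only multiple of d + 2 between -d and d is 0.\<close>

lemma hom_0: "hom 0 v = pr 0 v"
proof (induction v rule: G_induct)
  case (1 j v)
  show ?case
  proof (cases "d < j \<or> j < - d")
    case True
    then have "v = 0" using G_zero[OF True] 1 by simp
    then show ?thesis by (simp add: lin_0[OF lin_hom] lin_0[OF lin_pr])
  next
    case False
    have "j mod int m = 0 \<longleftrightarrow> j = 0"
    proof
      assume "j mod int m = 0"
      then have "int m dvd j" using mod_0_imp_dvd by blast
      then show "j = 0" using False int_m zdvd_imp_le[of "int m" "\<bar>j\<bar>"] by (cases "j = 0") auto
    qed simp
    then show ?thesis by (simp add: hom_G[OF 1] pr_G[OF 1])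
  qed
next
  case (2 v w) then show ?case by (simp add: lin_add[OF lin_hom] lin_add[OF lin_pr])
qed

lemma hom_in_q:
  assumes "v \<in> q"
  shows "hom i v \<in> q"
proof -
  have inv: "br h ` q \<subseteq> q" using br_Z_q[OF triple_in_Z(2)] by blast
  show ?thesis unfolding hom_def eig_map_def[OF lin_ad ac]
    by (intro vec.subspace_sum[OF subspace_q] vec.subspace_scale[OF subspace_q]
        proj_invariant[OF subspace_q inv assms])
qed

lemma hom_ad_E:
  assumes F': "F' \<in> V" and i: "i < m"
  shows "hom ((i + 2) mod m) (br (e + F') v) = br (e + F') (hom i v)"
proof (induction v rule: G_induct)
  case (1 j v)
  have shift: "(j + 2) mod int m = int ((i + 2) mod m) \<longleftrightarrow> j mod int m = int i"
  proof -
    have "int ((i + 2) mod m) = (int i + 2) mod int m" by (simp add: zmod_int add.commute)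
    then have "(j + 2) mod int m = int ((i + 2) mod m) \<longleftrightarrow> j mod int m = int i mod int m"
      by (simp add: mod_eq_dvd_iff)
    then show ?thesis using i by simp
  qed
  have jd: "(- d + j) mod int m = (j + 2) mod int m"
  proof -
    have "- d + j = (j + 2) + (-1) * int m" by (simp add: int_m)
    then show ?thesis by (simp only: mod_mult_self1)
  qed
  have he: "hom l (br e v) = (if (j + 2) mod int m = int l then br e v else 0)" for l
    using hom_G[OF br_G[OF e_G 1], of l] by (simp add: add.commute)
  have hF: "hom l (br F' v) = (if (j + 2) mod int m = int l then br F' v else 0)" for l
    using hom_G[OF br_G[OF F' 1], of l] unfolding jd .
  show ?case
    by (simp only: br_add_left lin_add[OF lin_hom] he hF shift hom_G[OF 1]) auto
next
  case (2 v w) then show ?case by (simp add: lin_add[OF lin_hom] br_add_right)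
qed

text \<open>The assumption \<open>tor\<close> says that the stabilizer of F' in r and Z is contained
  in that of F.\<close>

lemma regular_if_generic:
  assumes F': "F' \<in> U" "F' \<in> q"
    and tor: "\<And>y. y \<in> r \<Longrightarrow> y \<in> Z \<Longrightarrow> br y F' = 0 \<Longrightarrow> y \<in> tor"
  shows "regular_semisimple_elt br q (e + F')"
proof -
  let ?E = "e + F'"
  have dE: "diag ?E" by (rule U_diag[OF F'(1)])
  have F'V: "F' \<in> V" by (rule U_V[OF F'(1)])
  have Eq: "?E \<in> q" using vec.subspace_add[OF subspace_q] triple_in_q F'(2) by blast
  have adq: "br x y \<in> q" if "x \<in> q" "y \<in> q" for x y using subalgebra_q that by (auto simp: subalgebra_def)
  have inv: "br ?E ` q \<subseteq> q" using adq[OF Eq] by blast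
  have "v \<in> vec.span {v \<in> q. \<exists>c. br ?E v = c *s v}" if v: "v \<in> q" for v
  proof -
    have "proj ?E c v \<in> {v \<in> q. \<exists>c. br ?E v = c *s v}" for c
      using proj_invariant[OF subspace_q inv v] proj_mem diag_gen[OF dE] by blast
    then have "(\<Sum>c\<in>spectrum (br ?E). proj ?E c v) \<in> vec.span {v \<in> q. \<exists>c. br ?E v = c *s v}"
      by (intro vec.span_sum vec.span_base)
    then show ?thesis by (simp only: proj_sum[symmetric])
  qed
  then have ss: "semisimple_elt br q ?E" using Eq by (auto simp: semisimple_elt_def)
  define H where "H = {y \<in> q. br ?E y = 0}"
  have subH: "subalgebra br H"
  proof -
    have "H = q \<inter> {y. br ?E y = 0}" by (auto simp: H_def)
    then show ?thesis using subalgebra_q subalgebra_centralizer[of ?E]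
      by (auto simp: subalgebra_def vec.subspace_inter)
  qed
  have ndH: "nondeg_on H" unfolding H_def
    by (rule nondeg_on_centralizer[OF subspace_q nondeg_q dE]) (rule adq[OF Eq])
  interpret cyclic_grading br m hom by (rule grading)
  have "graded H"
    unfolding graded_def
  proof (intro conjI ballI allI impI subH)
    fix v i assume v: "v \<in> H" and i: "i < m"
    have "br ?E (hom i v) = 0" using hom_ad_E[OF F'V i, of v] v by (simp add: H_def lin_0[OF lin_hom])
    then show "hom i v \<in> H" using v hom_in_q by (simp add: H_def)
  qed
  \<comment> \<open>The degree 0 part of v commutes with e and F', so it lies in \<open>tor\<close>
    and is central in Z; the only such element of q is 0.\<close>
  moreover have "hom 0 v = 0" if v: "v \<in> H" for v
  proof (rule q_central_zero)
    have vq: "v \<in> q" and vE: "br ?E v = 0" using v by (auto simp: H_def)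
    show q0: "hom 0 v \<in> q" by (rule hom_in_q[OF vq])
    have "hom 0 v \<in> kF F'" unfolding hom_0 by (rule pr0_centralizer[OF F'V vE])
    then have "hom 0 v \<in> tor" using tor q0 q_Z by (auto simp: kF_def)
    then show "br (hom 0 v) y = 0" if "y \<in> Z" for y using tor_central that by blast
  qed
  ultimately have "solvable_lie br H" by (rule kreknin)
  then have ab: "br x y = 0" if "x \<in> H" "y \<in> H" for x y
    using solvable_nondeg_abelian[OF subH ndH _ that] by blast
  have "cartan_subalgebra br q H"
    unfolding cartan_subalgebra_def
  proof (intro conjI subH)
    show "H \<subseteq> q" by (auto simp: H_def)
    have "brackets H H \<subseteq> {0}" using ab by blast
    then have "lower_central br H 1 \<subseteq> {0}"
      using vec.span_minimal[OF _ vec.subspace_single_0] by simp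
    then show "nilpotent_lie br H" unfolding nilpotent_lie_def by blast
    show "normalizer br q H = H"
    proof
      show "H \<subseteq> normalizer br q H" using subH by (auto simp: normalizer_def subalgebra_def H_def)
      show "normalizer br q H \<subseteq> H"
      proof
        fix x assume x: "x \<in> normalizer br q H"
        \<comment> \<open>E itself lies in H, so a normalizing x satisfies [E, [E, x]] = 0, and ad E
          is semisimple.\<close>
        have "?E \<in> H" using Eq by (simp add: H_def br_self)
        then have "br x ?E \<in> H" using x by (auto simp: normalizer_def)
        then have "br ?E (br x ?E) = 0" by (simp add: H_def)
        then have "br ?E (br ?E x) = 0" by (simp add: br_swap[of x ?E] br_minus_right)
        then have "br ?E x = 0" by (rule diag_square[OF dE])
        then show "x \<in> H" using x by (simp add: H_def normalizer_def)
      qed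
    qed
  qed
  moreover have "centralizer_elt br q ?E = H" by (auto simp: centralizer_elt_def H_def)
  ultimately show ?thesis using ss by (simp add: regular_semisimple_elt_def)
qed

text \<open>The complement of \<open>tor\<close> in r and Z defined by a projection \<open>P\<close>
  acts injectively at F, an open condition. For F' in Z, P y kills F' by \<open>tor_central\<close>,
  so y - P y also kills F' and must be 0.\<close>

lemma tor_open: "\<exists>p\<in>polyfun. p F \<noteq> 0 \<and>
    (\<forall>F'. F' \<in> Z \<longrightarrow> p F' \<noteq> 0 \<longrightarrow> (\<forall>y. y \<in> r \<longrightarrow> y \<in> Z \<longrightarrow> br y F' = 0 \<longrightarrow> y \<in> tor))"
proof -
  have st: "vec.subspace tor" using subalgebra_tor by (simp add: subalgebra_def)
  obtain P where P0: "lin P \<and> (\<forall>w\<in>tor. P w = w) \<and> range P \<subseteq> tor" using lin_projection[OF st] ..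
  then have P: "lin P" "\<And>w. w \<in> tor \<Longrightarrow> P w = w" "\<And>v. P v \<in> tor" by auto
  have tor_r: "tor \<subseteq> r" and tor_Z: "tor \<subseteq> Z" by (auto simp: tor_def kF_def)
  let ?W = "r \<inter> Z \<inter> {y. P y = 0}"
  have sW: "vec.subspace ?W"
    by (intro vec.subspace_inter subspace_r subspace_Z vec.linear_subspace_kernel[OF P(1)])
  have inj: "w = 0" if "w \<in> ?W" "br w F = 0" for w
  proof -
    have "w \<in> tor" using that by (auto simp: tor_def kF_def)
    then have "P w = w" by (rule P(2))
    then show ?thesis using that by simp
  qed
  obtain p where p: "p \<in> polyfun" "p F \<noteq> 0"
    "\<And>F' w. p F' \<noteq> 0 \<Longrightarrow> w \<in> ?W \<Longrightarrow> br w F' = 0 \<Longrightarrow> w = 0"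
    using injective_open[of ?W "\<lambda>F' w. br w F'" F, OF sW lin_ad_left polyfun_ad inj] by blast
  have "y \<in> tor" if F': "F' \<in> Z" "p F' \<noteq> 0" and y: "y \<in> r" "y \<in> Z" "br y F' = 0" for F' y
  proof -
    have "br (P y) F' = 0" by (rule tor_central[OF P(3) F'(1)])
    then have z: "br (y - P y) F' = 0" using y(3) by (simp add: br_diff_left)
    have yW: "y - P y \<in> ?W"
      using y P(3)[of y] tor_r tor_Z vec.subspace_diff[OF subspace_r] vec.subspace_diff[OF subspace_Z]
      by (auto simp: lin_diff[OF P(1)] P(2)[OF P(3)])
    have "y - P y = 0" by (rule p(3)[OF F'(2) yW z])
    then show ?thesis using P(3)[of y] by simp
  qed
  then show ?thesis using p(1,2) by blast
qed

theorem regular_type_q: "regular_semisimple_type br q e h"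
proof -
  obtain p where p: "p \<in> polyfun" "p F \<noteq> 0" "\<And>F' y. F' \<in> Z \<Longrightarrow> p F' \<noteq> 0 \<Longrightarrow>
      y \<in> r \<Longrightarrow> y \<in> Z \<Longrightarrow> br y F' = 0 \<Longrightarrow> y \<in> tor" using tor_open by blast
  obtain p' where p': "p' \<in> polyfun" "p' F \<noteq> 0" "\<And>F'. F' \<in> V \<Longrightarrow> p' F' \<noteq> 0 \<Longrightarrow> F' \<in> U"
    using U_poly[OF F_U] by blast
  have eig: "eigsp br q h (- depth br q h) = q \<inter> V" unfolding depth_q by (auto simp: eigsp_def)
  let ?U = "{x \<in> q \<inter> V. p x * p' x \<noteq> 0}"
  have "q \<inter> V - ?U = {x \<in> q \<inter> V. \<forall>g\<in>{\<lambda>x. p x * p' x}. g x = 0}" by auto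
  moreover have "{\<lambda>x. p x * p' x} \<subseteq> polyfun" using p(1) p'(1) by (simp add: polyfun.pmult)
  ultimately have "zariski_closed_in (q \<inter> V) (q \<inter> V - ?U)" unfolding zariski_closed_in_def by blast
  then have "zariski_open_in (q \<inter> V) ?U" unfolding zariski_open_in_def by blast
  moreover have "F \<in> ?U" using p p' V_Z_q F_V triple_in_Z(4) by auto
  moreover have "regular_semisimple_elt br q (e + F')" if F': "F' \<in> ?U" for F'
  proof (rule regular_if_generic)
    show "F' \<in> U" "F' \<in> q" using F' p'(3) by auto
    have "F' \<in> Z" "p F' \<noteq> 0" using F' q_Z by auto
    then show "y \<in> tor" if "y \<in> r" "y \<in> Z" "br y F' = 0" for y using p(3) that by blast
  qed
  ultimately show ?thesis unfolding regular_semisimple_type_def eig by blast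
qed

end

theorem theorem3p11:
  fixes br :: "('k::field_char_0, 'n::finite) bracket"
    and e h f :: "'k^'n"
  assumes "alg_closed TYPE('k)"
    and "lie_algebra br"
    and "semisimple_lie br UNIV"
    and "e \<noteq> 0"
    and "ad_nilpotent br UNIV e"
    and "sl2_triple br e h f"
    and "even (depth br UNIV h)"
    and "semisimple_type br UNIV e h"
  shows "\<exists>q. reducing_subalgebra br e h f q \<and> e \<in> q \<and>
           (\<exists>h' f'. h' \<in> q \<and> f' \<in> q \<and> sl2_triple br e h' f' \<and>
                    regular_semisimple_type br q e h')"
proof -
  obtain U where U: "zariski_open_in (eigsp br UNIV h (- depth br UNIV h)) U" "U \<noteq> {}"
    "\<And>F. F \<in> U \<Longrightarrow> semisimple_elt br UNIV (e + F)"
    using assms(8) unfolding semisimple_type_def by blast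
  interpret semisimple_type_alg br e h f U
    using assms U by unfold_locales
  obtain F where F: "generic F" using generic_exists ..
  obtain x0 where x0: "toral_min F x0" using toral_min_exists ..
  interpret reduction br e h f U F x0
    using F x0 by unfold_locales
  \<comment> \<open>The triple inside q is the given one: h' = h and f' = f.\<close>
  show ?thesis using reducing_q triple_in_q triple regular_type_q by blast
qed

end
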